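(* Let $w\in A_s$ and let $\mathcal A$ satisfy the structural conditions listed in the context. For each $n\in\mathbb N$ let $u_n\in W^{1,p}(\Omega,w)$ and a distribution $G_n$ on $\Omega$ satisfy $$-\operatorname{div}(\mathcal A(x,\nabla u_n))=G_n\quad\text{in }\Omega,$$ i.e. $\int_\Omega\mathcal A(x,\nabla u_n)\cdot\nabla\phi\,dx=\langle G_n,\phi\rangle$ for all $\phi\in C_c^\infty(\Omega)$. Assume that $u_n\to u$ weakly in $W^{1,p}(\Omega,w)$, and that for every compact $K\subset\Omega$ there is a constant $C_K$ depending on $K$ (not on $n$) such that $$|\langle G_n,\phi\rangle|\le C_K\|\phi\|_{L^\infty(\Omega)}$$ for all $n$ and all $\phi\in C_c^\infty(\Omega)$ with $\operatorname{supp}\phi\subset K$. Then, up to a subsequence, $\nabla u_n\to\nabla u$ pointwise a.e. in $\Omega$.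
   Context: Setting: $N\ge 2$, $\Omega\subset\mathbb R^N$ is a bounded smooth domain, $1<p<\infty$. Weights: a locally integrable $w:\mathbb R^N\to(0,\infty)$ (with $0<w<\infty$ a.e.) belongs to $A_p$ if there is $c_{p,w}>0$ such that $\left(\frac1{|B|}\int_B w\,dx\right)\left(\frac1{|B|}\int_B w^{-\frac1{p-1}}dx\right)^{p-1}\le c_{p,w}$ for all balls $B\subset\mathbb R^N$. Fix $s\in[\frac1{p-1},\infty)\cap(\frac Np,\infty)$; $w\in A_s$ means $w\in A_p$ and $w^{-s}\in L^1(\Omega)$. Spaces: $W^{1,p}(\Omega,w)$ is the space of (weakly differentiable) measurable $u$ with $\|u\|_{1,p,w}=(\int_\Omega|u|^pw\,dx)^{1/p}+(\int_\Omega|\nabla u|^pw\,dx)^{1/p}<\infty$. Operator: $\mathcal A:\Omega\times\mathbb R^N\to\mathbb R^N$ is Carathéodory ($\mathcal A(\cdot,\zeta)$ measurable for every $\zeta$; $\mathcal A(x,\cdot)$ continuous for a.e. $x$), and for a.e. $x\in\Omega$ and all vectors in $\mathbb R^N$: (growth) $|\mathcal A(x,\zeta)|\le|\zeta|^{p-1}w(x)$; (degeneracy) $\mathcal A(x,\zeta)\cdot\zeta\ge|\zeta|^pw(x)$; (homogeneity) $\mathcal A(x,t\zeta)=t|t|^{p-2}\mathcal A(x,\zeta)$ for $t\in\mathbb R\setminus\{0\}$; (strong monotonicity) with $\gamma=\max\{p,2\}$ and some constant $c>0$, for $\zeta_1\ne\zeta_2$, $\langle\mathcal A(x,\zeta_1)-\mathcal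 A(x,\zeta_2),\zeta_1-\zeta_2\rangle\ge c|\zeta_1-\zeta_2|^\gamma\{\overline{\mathcal A}(x,\zeta_1,\zeta_2)\}^{1-\frac\gamma p}w(x)$, where $\overline{\mathcal A}(x,\zeta_1,\zeta_2)=\frac1{w(x)}(\langle\mathcal A(x,\zeta_1),\zeta_1\rangle+\langle\mathcal A(x,\zeta_2),\zeta_2\rangle)$. *)

theory Defs
  imports "HOL-Analysis.Analysis" "HOL-Probability.Essential_Supremum"
begin

section \<open>Smooth functions, test functions and distributions\<close>

text \<open>Iterated partial derivatives; the head of the list is the outermost direction, and the
  directions are meant to be basis vectors.\<close>

primrec partials :: "'a list \<Rightarrow> ('a::euclidean_space \<Rightarrow> real) \<Rightarrow> 'a \<Rightarrow> real" where
  "partials [] f = f"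
| "partials (b # bs) f = (\<lambda>x. frechet_derivative (partials bs f) (at x) b)"

text \<open>Differentiability of the partial derivatives of every order includes their continuity, so on
  an open set this is \<open>C\<^sup>\<infinity>\<close>.\<close>

definition smooth_on :: "'a::euclidean_space set \<Rightarrow> ('a \<Rightarrow> real) \<Rightarrow> bool" where
  "smooth_on S f \<longleftrightarrow> (\<forall>bs. set bs \<subseteq> Basis \<longrightarrow> (\<forall>x\<in>S. partials bs f differentiable (at x)))"

definition gradient :: "('a::euclidean_space \<Rightarrow> real) \<Rightarrow> 'a \<Rightarrow> 'a" where
  "gradient f x = (\<Sum>b\<in>Basis. partials [b] f x *\<^sub>R b)"

definition supp :: "('a::euclidean_space \<Rightarrow> real) \<Rightarrow> 'a set" where
  "supp f = closure {x. f x \<noteq> 0}"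

text \<open>\<open>C\<^sub>c\<^sup>\<infinity>(\<Omega>)\<close>, its elements being extended by zero to the whole space.\<close>

definition test_functions :: "'a::euclidean_space set \<Rightarrow> ('a \<Rightarrow> real) set" where
  "test_functions \<Omega> = {\<phi>. smooth_on UNIV \<phi> \<and> compact (supp \<phi>) \<and> supp \<phi> \<subseteq> \<Omega>}"

text \<open>Linear functionals on \<open>C\<^sub>c\<^sup>\<infinity>(\<Omega>)\<close> that are continuous, expressed as usual by a bound of finite
  order on every compact subset. Values outside the test functions are irrelevant.\<close>

definition distribution_on ::
  "'a::euclidean_space set \<Rightarrow> (('a \<Rightarrow> real) \<Rightarrow> real) \<Rightarrow> bool" where
  "distribution_on \<Omega> G \<longleftrightarrow>
     (\<forall>\<phi>\<in>test_functions \<Omega>. \<forall>\<psi>\<in>test_functions \<Omega>. G (\<lambda>x. \<phi> x + \<psi> x) = G \<phi> + G \<psi>) \<and>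
     (\<forall>\<phi>\<in>test_functions \<Omega>. \<forall>a. G (\<lambda>x. a * \<phi> x) = a * G \<phi>) \<and>
     (\<forall>K. compact K \<and> K \<subseteq> \<Omega> \<longrightarrow>
        (\<exists>C m. \<forall>\<phi>\<in>test_functions \<Omega>. supp \<phi> \<subseteq> K \<longrightarrow>
           \<bar>G \<phi>\<bar> \<le> C * (\<Sum>bs | set bs \<subseteq> Basis \<and> length bs \<le> m. SUP x. \<bar>partials bs \<phi> x\<bar>)))"

definition Linf_norm :: "'a::euclidean_space set \<Rightarrow> ('a \<Rightarrow> real) \<Rightarrow> real" where
  "Linf_norm \<Omega> \<phi> = real_of_ereal (esssup (lebesgue_on \<Omega>) (\<lambda>x. ereal \<bar>\<phi> x\<bar>))"

section \<open>Bounded smooth domains\<close>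

text \<open>Near every boundary point the domain is, after a choice of the vertical unit direction \<open>e\<close>,
  the region above the graph of a \<open>C\<^sup>\<infinity>\<close> function \<open>g\<close> of the orthogonal projection onto the
  hyperplane normal to \<open>e\<close>. Only the values of \<open>g\<close> on that hyperplane matter.\<close>

definition smooth_boundary :: "'a::euclidean_space set \<Rightarrow> bool" where
  "smooth_boundary \<Omega> \<longleftrightarrow>
     (\<forall>x0\<in>frontier \<Omega>. \<exists>r>0. \<exists>e g. norm e = 1 \<and> smooth_on UNIV g \<and>
        \<Omega> \<inter> ball x0 r = {x \<in> ball x0 r. g (x - (x \<bullet> e) *\<^sub>R e) < x \<bullet> e})"

definition bounded_smooth_domain :: "'a::euclidean_space set \<Rightarrow> bool" where
  "bounded_smooth_domain \<Omega> \<longleftrightarrow>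
     open \<Omega> \<and> connected \<Omega> \<and> \<Omega> \<noteq> {} \<and> bounded \<Omega> \<and> smooth_boundary \<Omega>"

section \<open>Weights\<close>

definition locally_integrable_on ::
  "('a::euclidean_space \<Rightarrow> 'b::euclidean_space) \<Rightarrow> 'a set \<Rightarrow> bool" where
  "locally_integrable_on f \<Omega> \<longleftrightarrow> (\<forall>K. compact K \<and> K \<subseteq> \<Omega> \<longrightarrow> f absolutely_integrable_on K)"

text \<open>The integrability of \<open>w\<^bsup>-1/(p-1)\<^esup>\<close> over balls is part of the finiteness of the supremum
  of the products of averages; it has to be stated because the Bochner integral of a
  non-integrable function is 0.\<close>

definition Ap_weight :: "real \<Rightarrow> ('a::euclidean_space \<Rightarrow> real) \<Rightarrow> bool" where
  "Ap_weight p w \<longleftrightarrow>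
     locally_integrable_on w UNIV \<and> (AE x in lebesgue. 0 < w x) \<and>
     (\<exists>c>0. \<forall>x r. 0 < r \<longrightarrow>
        (\<lambda>y. w y powr (- 1 / (p - 1))) absolutely_integrable_on ball x r \<and>
        (1 / measure lebesgue (ball x r) * (LINT y:ball x r|lebesgue. w y)) *
        (1 / measure lebesgue (ball x r) *
           (LINT y:ball x r|lebesgue. w y powr (- 1 / (p - 1)))) powr (p - 1) \<le> c)"

definition As_weight ::
  "real \<Rightarrow> real \<Rightarrow> 'a::euclidean_space set \<Rightarrow> ('a \<Rightarrow> real) \<Rightarrow> bool" where
  "As_weight p s \<Omega> w \<longleftrightarrow>
     Ap_weight p w \<and> (\<lambda>x. w x powr (- s)) absolutely_integrable_on \<Omega>"

section \<open>Weighted Sobolev spaces\<close>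

definition has_weak_gradient ::
  "'a::euclidean_space set \<Rightarrow> ('a \<Rightarrow> real) \<Rightarrow> ('a \<Rightarrow> 'a) \<Rightarrow> bool" where
  "has_weak_gradient \<Omega> u g \<longleftrightarrow>
     locally_integrable_on u \<Omega> \<and> locally_integrable_on g \<Omega> \<and>
     (\<forall>\<phi>\<in>test_functions \<Omega>. \<forall>b\<in>Basis.
        (LINT x:\<Omega>|lebesgue. u x * partials [b] \<phi> x) = - (LINT x:\<Omega>|lebesgue. (g x \<bullet> b) * \<phi> x))"

text \<open>A representative of the weak gradient, which is unique up to null subsets of \<open>\<Omega>\<close>.\<close>

definition weak_grad :: "'a::euclidean_space set \<Rightarrow> ('a \<Rightarrow> real) \<Rightarrow> 'a \<Rightarrow> 'a" where
  "weak_grad \<Omega> u = (SOME g. has_weak_gradient \<Omega> u g)"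

text \<open>The elements are functions rather than classes of almost everywhere equal functions, so
  \<open>W1p_norm\<close> below is a seminorm on this set.\<close>

definition W1p ::
  "real \<Rightarrow> 'a::euclidean_space set \<Rightarrow> ('a \<Rightarrow> real) \<Rightarrow> ('a \<Rightarrow> real) set" where
  "W1p p \<Omega> w = {u. (\<exists>g. has_weak_gradient \<Omega> u g) \<and>
     (\<lambda>x. \<bar>u x\<bar> powr p * w x) absolutely_integrable_on \<Omega> \<and>
     (\<lambda>x. norm (weak_grad \<Omega> u x) powr p * w x) absolutely_integrable_on \<Omega>}"

definition W1p_norm ::
  "real \<Rightarrow> 'a::euclidean_space set \<Rightarrow> ('a \<Rightarrow> real) \<Rightarrow> ('a \<Rightarrow> real) \<Rightarrow> real" where
  "W1p_norm p \<Omega> w u =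
     (LINT x:\<Omega>|lebesgue. \<bar>u x\<bar> powr p * w x) powr (1 / p) +
     (LINT x:\<Omega>|lebesgue. norm (weak_grad \<Omega> u x) powr p * w x) powr (1 / p)"

text \<open>Boundedness forces a functional to agree on almost everywhere equal functions, so these are
  the elements of the dual of the normed space of equivalence classes.\<close>

definition W1p_dual ::
  "real \<Rightarrow> 'a::euclidean_space set \<Rightarrow> ('a \<Rightarrow> real) \<Rightarrow> (('a \<Rightarrow> real) \<Rightarrow> real) set" where
  "W1p_dual p \<Omega> w = {F.
     (\<forall>u\<in>W1p p \<Omega> w. \<forall>v\<in>W1p p \<Omega> w. F (\<lambda>x. u x + v x) = F u + F v) \<and>
     (\<forall>u\<in>W1p p \<Omega> w. \<forall>a. F (\<lambda>x. a * u x) = a * F u) \<and>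
     (\<exists>C. \<forall>u\<in>W1p p \<Omega> w. \<bar>F u\<bar> \<le> C * W1p_norm p \<Omega> w u)}"

definition W1p_weakly_tendsto ::
  "real \<Rightarrow> 'a::euclidean_space set \<Rightarrow> ('a \<Rightarrow> real) \<Rightarrow> (nat \<Rightarrow> 'a \<Rightarrow> real) \<Rightarrow> ('a \<Rightarrow> real) \<Rightarrow> bool"
  where
  "W1p_weakly_tendsto p \<Omega> w u_seq u \<longleftrightarrow>
     (\<forall>n. u_seq n \<in> W1p p \<Omega> w) \<and> u \<in> W1p p \<Omega> w \<and>
     (\<forall>F\<in>W1p_dual p \<Omega> w. (\<lambda>n. F (u_seq n)) \<longlonglongrightarrow> F u)"

section \<open>The operator\<close>

definition caratheodory :: "'a::euclidean_space set \<Rightarrow> ('a \<Rightarrow> 'a \<Rightarrow> 'a) \<Rightarrow> bool" where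
  "caratheodory \<Omega> A \<longleftrightarrow>
     (\<forall>\<zeta>. (\<lambda>x. A x \<zeta>) \<in> borel_measurable (lebesgue_on \<Omega>)) \<and>
     (AE x in lebesgue_on \<Omega>. continuous_on UNIV (A x))"

definition A_bar ::
  "('a::euclidean_space \<Rightarrow> 'a \<Rightarrow> 'a) \<Rightarrow> ('a \<Rightarrow> real) \<Rightarrow> 'a \<Rightarrow> 'a \<Rightarrow> 'a \<Rightarrow> real" where
  "A_bar A w x \<zeta>1 \<zeta>2 = 1 / w x * (A x \<zeta>1 \<bullet> \<zeta>1 + A x \<zeta>2 \<bullet> \<zeta>2)"

definition structure_conditions ::
  "real \<Rightarrow> 'a::euclidean_space set \<Rightarrow> ('a \<Rightarrow> real) \<Rightarrow> ('a \<Rightarrow> 'a \<Rightarrow> 'a) \<Rightarrow> bool" where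
  "structure_conditions p \<Omega> w A \<longleftrightarrow>
     caratheodory \<Omega> A \<and>
     (AE x in lebesgue_on \<Omega>. \<forall>\<zeta>. norm (A x \<zeta>) \<le> norm \<zeta> powr (p - 1) * w x) \<and>
     (AE x in lebesgue_on \<Omega>. \<forall>\<zeta>. A x \<zeta> \<bullet> \<zeta> \<ge> norm \<zeta> powr p * w x) \<and>
     (AE x in lebesgue_on \<Omega>. \<forall>\<zeta> t. t \<noteq> 0 \<longrightarrow>
        A x (t *\<^sub>R \<zeta>) = (t * \<bar>t\<bar> powr (p - 2)) *\<^sub>R A x \<zeta>) \<and>
     (let \<gamma> = max p 2 in \<exists>c>0. AE x in lebesgue_on \<Omega>. \<forall>\<zeta>1 \<zeta>2. \<zeta>1 \<noteq> \<zeta>2 \<longrightarrow>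
        (A x \<zeta>1 - A x \<zeta>2) \<bullet> (\<zeta>1 - \<zeta>2) \<ge>
          c * norm (\<zeta>1 - \<zeta>2) powr \<gamma> * A_bar A w x \<zeta>1 \<zeta>2 powr (1 - \<gamma> / p) * w x)"

text \<open>\<open>-div (A(x, \<nabla>u)) = G\<close> in the sense of distributions on \<open>\<Omega>\<close>.\<close>

definition solves ::
  "'a::euclidean_space set \<Rightarrow> ('a \<Rightarrow> 'a \<Rightarrow> 'a) \<Rightarrow> ('a \<Rightarrow> real) \<Rightarrow> (('a \<Rightarrow> real) \<Rightarrow> real) \<Rightarrow> bool" where
  "solves \<Omega> A u G \<longleftrightarrow>
     (\<forall>\<phi>\<in>test_functions \<Omega>. (LINT x:\<Omega>|lebesgue. A x (weak_grad \<Omega> u x) \<bullet> gradient \<phi> x) = G \<phi>)"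

end

theory Submission
  imports Defs
begin

text \<open>
  The argument is the one of Boccardo and Murat. Write \<open>v\<^sub>n = u\<^sub>n - u\<close> and
  \<open>e\<^sub>n = (\<A>(x, \<nabla>u\<^sub>n) - \<A>(x, \<nabla>u)) \<bullet> \<nabla>v\<^sub>n \<ge> 0\<close>. Testing the equation with \<open>\<phi> T\<^sub>\<delta>(v\<^sub>n)\<close>, where
  \<open>\<phi>\<close> is a cutoff function and \<open>T\<^sub>\<delta>(t) = \<delta> arctan (t/\<delta>)\<close>, bounds \<open>\<integral> \<phi> T\<^sub>\<delta>'(v\<^sub>n) \<A>(x, \<nabla>u\<^sub>n) \<bullet> \<nabla>v\<^sub>n\<close> by a
  multiple of \<open>\<delta>\<close> that does not depend on \<open>n\<close>, because \<open>G\<^sub>n\<close> is controlled by the supremum norm. The same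
  integral with \<open>\<A>(x, \<nabla>u)\<close> tends to 0 by weak convergence, once \<open>v\<^sub>n \<rightarrow> 0\<close> almost everywhere along a
  subsequence. Since \<open>min 1 e\<^sub>n \<le> T\<^sub>\<delta>'(v\<^sub>n) e\<^sub>n + (1 - T\<^sub>\<delta>'(v\<^sub>n))\<close>, letting \<open>n \<rightarrow> \<infinity>\<close> and then \<open>\<delta> \<rightarrow> 0\<close>
  shows that \<open>e\<^sub>n \<rightarrow> 0\<close> in measure, and strong monotonicity turns this into convergence of the gradients.

  The function \<open>\<phi> T\<^sub>\<delta>(v\<^sub>n)\<close> is admissible after mollifying \<open>v\<^sub>n\<close>: the \<open>A\<^sub>p\<close> condition makes the averaging
  operators bounded on \<open>L\<^sup>p(w)\<close> uniformly in the radius, by Hoelder's inequality and Tonelli's theorem alone.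
  Local compactness comes from \<open>\<parallel>\<rho>\<^sub>\<epsilon> * v - v\<parallel>\<^sub>1 \<le> \<epsilon> \<parallel>\<nabla>v\<parallel>\<^sub>1\<close>, since for fixed \<open>\<epsilon>\<close> weak convergence makes
  \<open>\<rho>\<^sub>\<epsilon> * v\<^sub>n\<close> converge pointwise.\<close>

section \<open>Smooth functions\<close>

text \<open>The energies e_n are bounded in L^1 and no better, so only truncations of them can be
  controlled: \<open>min 1\<close> keeps the integrand bounded, and what it costs is a term that
  tends to 0 with v_n. Compactness is needed only in unweighted L^1. The A_p condition makes
  w^(-1/(p-1)) integrable over balls; hence 1/w, restricted to \<Omega>, is an element of L^q(w)
  with q = p/(p-1), and pairing with it embeds L^p(w) into L^1(\<Omega>). All pairings keep the
  weight, so a flux a enters as a/w; the growth exponent p - 1 is exactly the one that puts a/w into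
  L^q(w) when the gradient is in L^p(w). Elements of W^{1,p} are Lebesgue measurable functions whose
  weak gradient is an arbitrary choice, and the weight is positive only almost everywhere. Tonelli's
  theorem, convolution and pointwise division by the weight ask for more, so the analysis is done
  for Borel representatives extended by zero off \<Omega> and for a weight positive everywhere; the
  conclusion is carried back almost everywhere.\<close>

lemma partials_append: "partials (bs @ cs) f = partials bs (partials cs f)"
  by (induction bs) auto

lemma partials_eqI:
  assumes "(f has_derivative f') (at x)"
  shows "partials [b] f x = f' b"
  using frechet_derivative_at[OF assms] by simp

text \<open>The order n gives the closure proofs for products and compositions something to induct
  on; smoothness is the conjunction over all n.\<close>

definition ck :: "nat \<Rightarrow> ('a::euclidean_space \<Rightarrow> real) \<Rightarrow> bool" where
  "ck n f \<longleftrightarrow> (\<forall>bs. set bs \<subseteq> Basis \<and> length bs \<le> n \<longrightarrow> (\<forall>x. partials bs f differentiable (at x)))"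

lemma smooth_iff_ck: "smooth_on UNIV f \<longleftrightarrow> (\<forall>n. ck n f)"
  unfolding smooth_on_def ck_def by auto

lemma ck_0: "ck 0 f \<longleftrightarrow> (\<forall>x. f differentiable (at x))"
  unfolding ck_def by (auto dest: spec[of _ "[]"])

text \<open>\<open>partials\<close> recurses on the outermost direction; here the innermost one is
  split off. An induction over n can then replace f by its first partial derivatives, which the
  product and chain rules express.\<close>

lemma ck_Suc: "ck (Suc n) f \<longleftrightarrow> (\<forall>x. f differentiable (at x)) \<and> (\<forall>b\<in>Basis. ck n (partials [b] f))"
proof
  assume L: "ck (Suc n) f"
  have "\<forall>x. f differentiable (at x)" using L unfolding ck_def by (auto dest: spec[of _ "[]"])
  moreover have "ck n (partials [b] f)" if "b \<in> Basis" for b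
    unfolding ck_def
  proof (intro allI impI)
    fix bs :: "'a list" and x assume "set bs \<subseteq> Basis \<and> length bs \<le> n"
    then show "partials bs (partials [b] f) differentiable (at x)"
      using L that unfolding ck_def partials_append[symmetric] by simp
  qed
  ultimately show "(\<forall>x. f differentiable (at x)) \<and> (\<forall>b\<in>Basis. ck n (partials [b] f))" by blast
next
  assume R: "(\<forall>x. f differentiable (at x)) \<and> (\<forall>b\<in>Basis. ck n (partials [b] f))"
  show "ck (Suc n) f"
    unfolding ck_def
  proof (intro allI impI)
    fix bs :: "'a list" and x assume a: "set bs \<subseteq> Basis \<and> length bs \<le> Suc n"
    show "partials bs f differentiable (at x)"
    proof (cases bs rule: rev_cases)
      case Nil then show ?thesis using R by simp
    next
      case (snoc cs b)
      then show ?thesis using R a unfolding ck_def snoc partials_append by auto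
    qed
  qed
qed

lemma ck_differentiable: "ck n f \<Longrightarrow> f differentiable (at x)"
  unfolding ck_def by (auto dest: spec[of _ "[]"])

lemma ck_SucD: "ck (Suc n) f \<Longrightarrow> ck n f"
  unfolding ck_def by auto

lemma has_derivative_frechet: "f differentiable (at x) \<Longrightarrow> (f has_derivative frechet_derivative f (at x)) (at x)"
  by (simp add: frechet_derivative_works)

lemma ck_const: "ck n (\<lambda>x. c)"
proof (induction n arbitrary: c)
  case (Suc n)
  have "partials [b] (\<lambda>x::'a. c) = (\<lambda>x. 0)" for b
    by (intro ext partials_eqI[where f' = "\<lambda>x. 0"]) auto
  then show ?case using Suc by (simp only: ck_Suc) simp
qed (simp add: ck_0)

lemma partials_add:
  assumes "f differentiable (at x)" "g differentiable (at x)"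
  shows "partials [b] (\<lambda>x. f x + g x) x = partials [b] f x + partials [b] g x"
  by (rule partials_eqI[THEN trans]) 
     (auto intro!: derivative_eq_intros has_derivative_frechet assms)

lemma partials_mult:
  assumes "f differentiable (at x)" "g differentiable (at x)"
  shows "partials [b] (\<lambda>x. f x * g x) x = f x * partials [b] g x + partials [b] f x * g x"
  by (rule partials_eqI[THEN trans])
     (auto intro!: derivative_eq_intros has_derivative_frechet assms)

lemma partials_comp:
  assumes "f differentiable (at x)" "(F has_real_derivative F') (at (f x))"
  shows "partials [b] (\<lambda>x. F (f x)) x = F' * partials [b] f x"
proof -
  have "((\<lambda>x. F (f x)) has_derivative (\<lambda>h. F' * frechet_derivative f (at x) h)) (at x)"
    using has_derivative_compose[OF has_derivative_frechet[OF assms(1)], of F "(*) F'"] assms(2)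
    by (simp add: has_field_derivative_def)
  from partials_eqI[OF this] show ?thesis by simp
qed

lemma ck_add: "ck n f \<Longrightarrow> ck n g \<Longrightarrow> ck n (\<lambda>x. f x + g x)"
proof (induction n arbitrary: f g)
  case (Suc n)
  have d: "f differentiable (at x)" "g differentiable (at x)" for x
    using Suc.prems ck_differentiable by blast+
  have "partials [b] (\<lambda>x. f x + g x) = (\<lambda>x. partials [b] f x + partials [b] g x)" for b
    using partials_add[OF d] by blast
  then show ?case using Suc d by (simp only: ck_Suc) (simp add: differentiable_add)
qed (simp add: ck_0 differentiable_add)

lemma ck_mult: "ck n f \<Longrightarrow> ck n g \<Longrightarrow> ck n (\<lambda>x. f x * g x)"
proof (induction n arbitrary: f g)
  case (Suc n)
  have d: "f differentiable (at x)" "g differentiable (at x)" for x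
    using Suc.prems ck_differentiable by blast+
  have "partials [b] (\<lambda>x. f x * g x) = (\<lambda>x. f x * partials [b] g x + partials [b] f x * g x)" for b
    using partials_mult[OF d] by blast
  moreover have "ck n f" "ck n g" using Suc.prems ck_SucD by blast+
  ultimately show ?case using Suc d by (simp only: ck_Suc) (simp add: ck_add)
qed (simp add: ck_0)

text \<open>Smoothness of the outer function is expressed by its membership in a family \<open>\<F>\<close> that is closed
  under differentiation.\<close>

lemma ck_comp:
  assumes \<F>: "\<And>F. F \<in> \<F> \<Longrightarrow> \<exists>F'\<in>\<F>. \<forall>t. (F has_real_derivative F' t) (at t)"
  shows "F \<in> \<F> \<Longrightarrow> ck n f \<Longrightarrow> ck n (\<lambda>x. F (f x))"
proof (induction n arbitrary: F)
  case (0 F)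
  then obtain F' where "\<And>t. (F has_real_derivative F' t) (at t)" using \<F> by blast
  then have "F differentiable (at t)" for t
    unfolding has_field_derivative_def by (rule Derivative.differentiableI)
  then show ?case using 0 differentiable_chain_at[of f _ F] by (auto simp: ck_0 o_def)
next
  case (Suc n F)
  then obtain F' where F': "F' \<in> \<F>" "\<And>t. (F has_real_derivative F' t) (at t)" using \<F> by blast
  from F'(2) have "F differentiable (at t)" for t
    unfolding has_field_derivative_def by (rule Derivative.differentiableI)
  moreover have d: "f differentiable (at x)" for x
    using Suc.prems ck_differentiable by blast
  ultimately have "(\<lambda>x. F (f x)) differentiable (at x)" for x
    using differentiable_chain_at[of f _ F] by (auto simp: o_def)
  moreover have "partials [b] (\<lambda>x. F (f x)) = (\<lambda>x. F' (f x) * partials [b] f x)" for b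
    using partials_comp[OF d F'(2)] by blast
  moreover have "ck n (\<lambda>x. F' (f x))" using Suc.IH[OF F'(1)] Suc.prems ck_SucD by blast
  ultimately show ?case using Suc by (simp only: ck_Suc) (simp add: ck_mult)
qed

lemma smooth_const: "smooth_on UNIV (\<lambda>x. c)" by (simp add: smooth_iff_ck ck_const)

lemma smooth_mult: "smooth_on UNIV f \<Longrightarrow> smooth_on UNIV g \<Longrightarrow> smooth_on UNIV (\<lambda>x. f x * g x)"
  by (simp add: smooth_iff_ck ck_mult)

lemma smooth_comp:
  assumes "\<And>F. F \<in> \<F> \<Longrightarrow> \<exists>F'\<in>\<F>. \<forall>t. (F has_real_derivative F' t) (at t)" "F \<in> \<F>" "smooth_on UNIV f"
  shows "smooth_on UNIV (\<lambda>x. F (f x))"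
  using assms(3) ck_comp[of \<F> F, OF assms(1) assms(2)] unfolding smooth_iff_ck by blast

lemma smooth_partials: "smooth_on UNIV f \<Longrightarrow> b \<in> Basis \<Longrightarrow> smooth_on UNIV (partials [b] f)"
  by (meson ck_Suc smooth_iff_ck)

lemma smooth_differentiable: "smooth_on UNIV f \<Longrightarrow> f differentiable (at x)"
  using ck_differentiable smooth_iff_ck by blast

lemma smooth_continuous: "smooth_on UNIV f \<Longrightarrow> continuous_on UNIV f"
  by (simp add: smooth_differentiable differentiable_imp_continuous_on differentiable_on_def
      differentiable_at_withinI)

lemma frechet_derivative_partials:
  assumes "f differentiable (at x)"
  shows "frechet_derivative f (at x) h = (\<Sum>b\<in>Basis. (h \<bullet> b) * partials [b] f x)"
proof -
  interpret linear "frechet_derivative f (at x)"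
    using assms frechet_derivative_works has_derivative_linear by blast
  show ?thesis
    by (subst euclidean_representation[of h, symmetric]) (simp add: sum scale)
qed

lemma has_derivative_gradient:
  assumes "f differentiable (at x)"
  shows "(f has_derivative (\<lambda>h. gradient f x \<bullet> h)) (at x)"
proof -
  have "frechet_derivative f (at x) h = gradient f x \<bullet> h" for h
    unfolding frechet_derivative_partials[OF assms] gradient_def inner_sum_left inner_scaleR_left
    by (simp add: inner_commute[of h] mult.commute del: partials.simps)
  then have "frechet_derivative f (at x) = (\<lambda>h. gradient f x \<bullet> h)" by blast
  then show ?thesis using has_derivative_frechet[OF assms] by simp
qed

text \<open>The derivatives of arctan have the form P(t)/(1+t^2)^k with a polynomial P. Together
  with arctan itself these functions form a family closed under differentiation, as
  \<open>smooth_comp\<close> requires.\<close>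

lemma smooth_arctan:
  assumes "smooth_on UNIV f"
  shows "smooth_on UNIV (\<lambda>x. arctan (f x))"
proof -
  let ?\<F> = "insert arctan {(\<lambda>t. poly P t / (1 + t\<^sup>2) ^ k) | P k. True}"
  have ne: "1 + (t::real)\<^sup>2 \<noteq> 0" for t by (metis add_pos_nonneg less_irrefl zero_le_power2 zero_less_one)
  have "\<exists>F'\<in>?\<F>. \<forall>t. (F has_real_derivative F' t) (at t)" if F: "F \<in> ?\<F>" for F
  proof (cases "F = arctan")
    case True
    have "\<forall>t. (F has_real_derivative poly [:1:] t / (1 + t\<^sup>2) ^ 1) (at t)"
      unfolding True using DERIV_arctan by (simp add: field_simps)
    moreover have "(\<lambda>t. poly [:1:] t / (1 + t\<^sup>2) ^ 1) \<in> ?\<F>" by blast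
    ultimately show ?thesis by (rule bexI)
  next
    case False
    then obtain P k where F': "F = (\<lambda>t. poly P t / (1 + t\<^sup>2) ^ k)" using F by auto
    \<comment> \<open>The numerator over (1+t^2)^(k+1) is P'(1+t^2) - 2ktP; the coefficient lists
      \<open>[:1,0,1:]\<close> and \<open>[:0,1:]\<close> stand for 1+t^2 and t.\<close>
    let ?Q = "pderiv P * [:1,0,1:] - smult (2 * of_nat k) (P * [:0,1:])"
    have "\<forall>t. (F has_real_derivative poly ?Q t / (1 + t\<^sup>2) ^ (Suc k)) (at t)"
    proof
      fix t
      have *: "((\<lambda>t. (1 + t\<^sup>2) ^ k) has_real_derivative of_nat k * (1 + t\<^sup>2) ^ (k - 1) * (2 * t)) (at t)"
        by (auto intro!: derivative_eq_intros)
      have "(F has_real_derivative (poly (pderiv P) t * (1 + t\<^sup>2) ^ k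
               - poly P t * (of_nat k * (1 + t\<^sup>2) ^ (k - 1) * (2 * t))) / ((1 + t\<^sup>2) ^ k * (1 + t\<^sup>2) ^ k)) (at t)"
        unfolding F' by (rule DERIV_divide[OF poly_DERIV *]) (simp add: ne)
      also have "(poly (pderiv P) t * (1 + t\<^sup>2) ^ k
               - poly P t * (of_nat k * (1 + t\<^sup>2) ^ (k - 1) * (2 * t))) / ((1 + t\<^sup>2) ^ k * (1 + t\<^sup>2) ^ k)
           = poly ?Q t / (1 + t\<^sup>2) ^ (Suc k)"
      \<comment> \<open>The exponent k - 1 is a truncated subtraction, so k = 0 is treated
        apart.\<close>
      proof (cases k)
        case 0 then show ?thesis using ne[of t] by (simp add: field_simps power2_eq_square)
      next
        case (Suc m)
        define A where "A = (1 + t\<^sup>2) ^ m"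
        define B where "B = 1 + t\<^sup>2"
        have "A \<noteq> 0" "B \<noteq> 0" using ne[of t] by (auto simp: A_def B_def)
        moreover have "poly ?Q t = poly (pderiv P) t * B - 2 * k * (poly P t * t)"
          by (simp add: B_def algebra_simps power2_eq_square)
        ultimately show ?thesis unfolding Suc by (simp add: A_def[symmetric] B_def[symmetric] field_simps)
      qed
      finally show "(F has_real_derivative poly ?Q t / (1 + t\<^sup>2) ^ (Suc k)) (at t)" .
    qed
    moreover have "(\<lambda>t. poly ?Q t / (1 + t\<^sup>2) ^ (Suc k)) \<in> ?\<F>" by blast
    ultimately show ?thesis by (rule bexI)
  qed
  then show ?thesis by (rule smooth_comp[OF _ insertI1 assms])
qed

section \<open>Bump functions\<close>

text \<open>The flat function e^(-1/t) with a polynomial factor in 1/t. The factor is there to close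
  the family under differentiation; P = 1 is the case used for \<open>bump\<close>.\<close>

definition flat_exp :: "real poly \<Rightarrow> real \<Rightarrow> real" where
  "flat_exp P t = (if t > 0 then poly P (1 / t) * exp (- 1 / t) else 0)"

lemma poly_over_exp: "((\<lambda>s. poly P s * exp (- s)) \<longlongrightarrow> (0::real)) at_top"
proof -
  have "((\<lambda>s. (\<Sum>i\<le>degree P. coeff P i * (s ^ i / exp s))) \<longlongrightarrow> (\<Sum>i\<le>degree P. coeff P i * 0)) at_top"
    by (intro tendsto_intros tendsto_power_div_exp_0)
  then show ?thesis
    by (simp add: poly_altdef exp_minus sum_distrib_right divide_inverse mult.assoc)
qed

lemma flat_exp_tendsto_0: "(flat_exp P \<longlongrightarrow> 0) (at_right 0)"
proof -
  have "((\<lambda>t. poly P (inverse t) * exp (- inverse t)) \<longlongrightarrow> 0) (at_right 0)"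
    by (rule filterlim_compose[OF poly_over_exp filterlim_inverse_at_top_right])
  moreover have "eventually (\<lambda>t. poly P (inverse t) * exp (- inverse t) = flat_exp P t) (at_right 0)"
    using eventually_at_right_less[of 0]
    by eventually_elim (simp add: flat_exp_def divide_inverse)
  ultimately show ?thesis by (rule Lim_transform_eventually)
qed

text \<open>With s = 1/t, differentiating P(s) e^(-s) in t gives s^2 (P(s) - P'(s)) e^(-s), which is
  the new polynomial. At 0 the difference quotient is, on the right, the member of the family with
  polynomial sP, and this tends to 0.\<close>

lemma flat_exp_deriv:
  "(flat_exp P has_real_derivative flat_exp ([:0,0,1:] * (P - pderiv P)) t) (at t)"
proof -
  consider "t > 0" | "t < 0" | "t = 0" by linarith
  then show ?thesis
  proof cases
    case 1
    have "((\<lambda>t. poly P (1 / t) * exp (- 1 / t)) has_real_derivative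
       flat_exp ([:0,0,1:] * (P - pderiv P)) t) (at t)"
      using 1 by (auto intro!: derivative_eq_intros DERIV_chain2[of "poly P"] poly_DERIV
          simp: flat_exp_def field_simps power2_eq_square)
    moreover have "eventually (\<lambda>s. poly P (1 / s) * exp (- 1 / s) = flat_exp P s) (nhds t)"
      using eventually_nhds_in_open[of "{0<..}" t] 1 
      by (auto elim!: eventually_mono simp: flat_exp_def)
    ultimately show ?thesis by (simp only: DERIV_cong_ev[OF refl _ refl])
  next
    case 2
    have "((\<lambda>t. 0) has_real_derivative flat_exp ([:0,0,1:] * (P - pderiv P)) t) (at t)"
      using 2 by (simp add: flat_exp_def)
    moreover have "eventually (\<lambda>s. 0 = flat_exp P s) (nhds t)"
      using eventually_nhds_in_open[of "{..<0}" t] 2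
      by (auto elim!: eventually_mono simp: flat_exp_def)
    ultimately show ?thesis by (simp only: DERIV_cong_ev[OF refl _ refl])
  next
    case 3
    have "((\<lambda>h. flat_exp P h / h) \<longlongrightarrow> 0) (at 0)"
    proof (rule filterlim_split_at)
      have "((\<lambda>h. 0) \<longlongrightarrow> (0::real)) (at_left 0)" by simp
      moreover have "eventually (\<lambda>h. 0 = flat_exp P h / h) (at_left 0)"
        by (auto simp: flat_exp_def eventually_at_filter)
      ultimately show "((\<lambda>h. flat_exp P h / h) \<longlongrightarrow> 0) (at_left 0)" by (rule Lim_transform_eventually)
      have "eventually (\<lambda>h. flat_exp ([:0,1:] * P) h = flat_exp P h / h) (at_right 0)"
        by (auto simp: flat_exp_def eventually_at_filter)
      with flat_exp_tendsto_0 show "((\<lambda>h. flat_exp P h / h) \<longlongrightarrow> 0) (at_right 0)"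
        by (rule Lim_transform_eventually)
    qed
    then show ?thesis unfolding 3 DERIV_def by (simp add: flat_exp_def)
  qed
qed

lemma smooth_flat_exp:
  assumes "smooth_on UNIV f"
  shows "smooth_on UNIV (\<lambda>x. flat_exp P (f x))"
  by (rule smooth_comp[of "range flat_exp", OF _ _ assms]) (use flat_exp_deriv in auto)

definition bump :: "'a::euclidean_space \<Rightarrow> real \<Rightarrow> 'a \<Rightarrow> real" where
  "bump x0 r x = flat_exp 1 (1 - (norm (x - x0))\<^sup>2 / r\<^sup>2)"

lemma smooth_affine: "smooth_on UNIV (\<lambda>x. x \<bullet> a + c)"
proof -
  have "ck n (\<lambda>x. x \<bullet> a + c)" for n
  proof (cases n)
    case 0 then show ?thesis by (simp add: ck_0)
  next
    case (Suc m)
    have "partials [b] (\<lambda>x. x \<bullet> a + c) = (\<lambda>x. b \<bullet> a)" for b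
      by (intro ext partials_eqI[THEN trans]) (auto intro!: derivative_eq_intros)
    then show ?thesis unfolding Suc by (simp only: ck_Suc) (simp add: ck_const)
  qed
  then show ?thesis by (simp add: smooth_iff_ck)
qed

lemma bump_arg_deriv:
  "((\<lambda>x. 1 - (norm (x - x0))\<^sup>2 / r\<^sup>2) has_derivative (\<lambda>h. - 2 / r\<^sup>2 * ((x - x0) \<bullet> h))) (at x)"
  unfolding power2_norm_eq_inner
  by (auto intro!: derivative_eq_intros simp: inner_commute divide_inverse algebra_simps)

lemma smooth_bump_arg: "smooth_on UNIV (\<lambda>x. 1 - (norm (x - x0))\<^sup>2 / r\<^sup>2)"
proof -
  have d: "(\<lambda>x. 1 - (norm (x - x0))\<^sup>2 / r\<^sup>2) differentiable (at x)" for x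
    using bump_arg_deriv by (rule Derivative.differentiableI)
  have "ck n (\<lambda>x. 1 - (norm (x - x0))\<^sup>2 / r\<^sup>2)" for n
  proof (cases n)
    case 0 then show ?thesis using d by (simp only: ck_0) blast
  next
    case (Suc m)
    have "partials [b] (\<lambda>x. 1 - (norm (x - x0))\<^sup>2 / r\<^sup>2) = (\<lambda>x. x \<bullet> ((- 2 / r\<^sup>2) *\<^sub>R b) + 2 / r\<^sup>2 * (x0 \<bullet> b))" for b
      by (intro ext partials_eqI[OF bump_arg_deriv, THEN trans]) (simp add: inner_diff_left field_simps add_divide_distrib[symmetric])
    moreover have "ck m (\<lambda>x. x \<bullet> a + c)" for a :: 'a and c using smooth_affine smooth_iff_ck by blast
    ultimately show ?thesis unfolding Suc ck_Suc using d by (simp only:) blast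
  qed
  then show ?thesis by (simp add: smooth_iff_ck)
qed

lemma smooth_bump: "smooth_on UNIV (bump x0 r)"
  unfolding bump_def using smooth_flat_exp[OF smooth_bump_arg] by blast

lemma bump_nonneg: "0 \<le> bump x0 r x" and bump_le_1: "bump x0 r x \<le> 1"
  by (auto simp: bump_def flat_exp_def)

lemma bump_pos_iff: "0 < r \<Longrightarrow> 0 < bump x0 r x \<longleftrightarrow> x \<in> ball x0 r"
proof -
  assume r: "0 < r"
  have "(norm (x - x0))\<^sup>2 < r\<^sup>2 \<longleftrightarrow> norm (x - x0) < r"
    using r by (meson norm_ge_zero order_less_imp_le pos2 power2_less_imp_less power_strict_mono)
  then have "1 - (norm (x - x0))\<^sup>2 / r\<^sup>2 > 0 \<longleftrightarrow> x \<in> ball x0 r"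
    using r by (simp add: dist_norm norm_minus_commute[of x0])
  then show ?thesis by (simp add: bump_def flat_exp_def)
qed

lemma bump_eq_0: "0 < r \<Longrightarrow> x \<notin> ball x0 r \<Longrightarrow> bump x0 r x = 0"
  using bump_pos_iff[of r x0 x] bump_nonneg[of x0 r x] by linarith

text \<open>On the half ball the argument of \<open>flat_exp\<close> is at least 1 - 1/4 = 3/4, and
  e^(-1/t) is increasing. The constant reappears in the size of the normalized kernel in
  \<open>mker_le\<close>.\<close>

lemma bump_lower:
  assumes "0 < r" "x \<in> ball x0 (r / 2)"
  shows "exp (- 4 / 3) \<le> bump x0 r x"
proof -
  have "norm (x - x0) \<le> r / 2" using assms by (simp add: dist_norm norm_minus_commute)
  then have "(norm (x - x0))\<^sup>2 \<le> (r / 2)\<^sup>2" by (intro power_mono) auto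
  then have *: "3 / 4 \<le> 1 - (norm (x - x0))\<^sup>2 / r\<^sup>2" using assms by (simp add: field_simps)
  define t where "t = 1 - (norm (x - x0))\<^sup>2 / r\<^sup>2"
  have t: "3 / 4 \<le> t" using * t_def by simp
  then have "1 / t \<le> 4 / 3" by (simp add: field_simps)
  then show ?thesis using t unfolding bump_def flat_exp_def t_def[symmetric] by simp
qed

lemma partials_bump:
  "partials [b] (bump x0 r) x
     = flat_exp ([:0,0,1:] * (1 - pderiv 1)) (1 - (norm (x - x0))\<^sup>2 / r\<^sup>2) * (- 2 / r\<^sup>2 * ((x - x0) \<bullet> b))"
proof -
  have "partials [b] (\<lambda>x. flat_exp 1 (1 - (norm (x - x0))\<^sup>2 / r\<^sup>2)) x
     = flat_exp ([:0,0,1:] * (1 - pderiv 1)) (1 - (norm (x - x0))\<^sup>2 / r\<^sup>2)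
       * partials [b] (\<lambda>x. 1 - (norm (x - x0))\<^sup>2 / r\<^sup>2) x"
    by (rule partials_comp[OF _ flat_exp_deriv]) (rule bump_arg_deriv[THEN Derivative.differentiableI])
  then show ?thesis unfolding bump_def partials_eqI[OF bump_arg_deriv] .
qed

text \<open>As a function of y, the kernel centred at 0 and evaluated at x - y is the bump centred
  at x. This turns a mollification at x into a pairing with a test function.\<close>

lemma bump_reflect: "bump x0 r x = bump 0 r (x0 - x)"
  by (simp add: bump_def norm_minus_commute)

lemma partials_bump_reflect: "partials [b] (bump x0 r) x = - partials [b] (bump 0 r) (x0 - x)"
proof -
  have "(x - x0) \<bullet> b = - ((x0 - x - 0) \<bullet> b)" by (simp add: inner_diff_left)
  then show ?thesis unfolding partials_bump norm_minus_commute[of x x0] by simp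
qed

section \<open>Test functions\<close>

lemma test_functions_smooth: "\<phi> \<in> test_functions \<Omega> \<Longrightarrow> smooth_on UNIV \<phi>"
  by (simp add: test_functions_def)

lemma supp_subset_closed: "(\<And>x. x \<notin> S \<Longrightarrow> f x = 0) \<Longrightarrow> closed S \<Longrightarrow> supp f \<subseteq> S"
  unfolding supp_def by (intro closure_minimal) auto

lemma not_in_supp: "x \<notin> supp f \<Longrightarrow> f x = 0"
  unfolding supp_def using closure_subset[of "{x. f x \<noteq> 0}"] by auto

lemma supp_closed: "closed (supp f)" by (simp add: supp_def)

lemma test_functionsI:
  assumes "smooth_on UNIV f" "compact K" "K \<subseteq> \<Omega>" "\<And>x. x \<notin> K \<Longrightarrow> f x = 0"
  shows "f \<in> test_functions \<Omega>"
proof -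
  have "supp f \<subseteq> K" using assms by (intro supp_subset_closed compact_imp_closed) auto
  moreover from this have "compact (supp f)"
    using compact_Int_closed[OF assms(2) supp_closed[of f]] by (simp add: inf.absorb2)
  ultimately show ?thesis using assms by (auto simp: test_functions_def)
qed

lemma bump_test_function: "0 < r \<Longrightarrow> cball x0 r \<subseteq> \<Omega> \<Longrightarrow> bump x0 r \<in> test_functions \<Omega>"
  by (rule test_functionsI[where K = "cball x0 r"]) (auto simp: smooth_bump intro: bump_eq_0)

lemma partials_not_in_supp: "x \<notin> supp f \<Longrightarrow> partials [b] f x = 0"
proof -
  assume x: "x \<notin> supp f"
  have "((\<lambda>x. 0) has_derivative (\<lambda>h. 0)) (at x)" by simp
  then have "(f has_derivative (\<lambda>h. 0)) (at x)"
    by (rule has_derivative_transform_within_open[of _ _ _ _ "- supp f"])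
       (use x supp_closed[of f] not_in_supp in auto)
  from partials_eqI[OF this] show ?thesis .
qed

lemma test_functions_partials:
  assumes "\<phi> \<in> test_functions \<Omega>" "b \<in> Basis"
  shows "partials [b] \<phi> \<in> test_functions \<Omega>"
  by (rule test_functionsI[where K = "supp \<phi>"])
     (use assms smooth_partials partials_not_in_supp in \<open>auto simp: test_functions_def simp del: partials.simps\<close>)

lemma test_functions_mult:
  assumes "\<phi> \<in> test_functions \<Omega>" "smooth_on UNIV f"
  shows "(\<lambda>x. \<phi> x * f x) \<in> test_functions \<Omega>"
  by (rule test_functionsI[where K = "supp \<phi>"])
     (use assms smooth_mult not_in_supp in \<open>auto simp: test_functions_def\<close>)

lemma test_functions_bounded:
  assumes "\<phi> \<in> test_functions \<Omega>"
  obtains B where "0 < B" "\<And>x. \<bar>\<phi> x\<bar> \<le> B"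
proof -
  have "compact (\<phi> ` supp \<phi>)"
    using assms smooth_continuous[OF test_functions_smooth[OF assms]]
    by (intro compact_continuous_image) (auto simp: test_functions_def intro: continuous_on_subset)
  then obtain B where B: "\<And>x. x \<in> supp \<phi> \<Longrightarrow> norm (\<phi> x) \<le> B" "0 < B"
    using compact_imp_bounded bounded_pos by (metis imageI)
  have "\<bar>\<phi> x\<bar> \<le> B" for x using B not_in_supp[of x \<phi>] by (cases "x \<in> supp \<phi>") auto
  with B that show ?thesis by blast
qed

lemma gradient_bounded:
  assumes "\<phi> \<in> test_functions \<Omega>"
  obtains B where "0 < B" "\<And>x. norm (gradient \<phi> x) \<le> B"
proof -
  have "\<forall>b\<in>Basis. \<exists>B. \<forall>x. \<bar>partials [b] \<phi> x\<bar> \<le> B"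
    using test_functions_bounded[OF test_functions_partials[OF assms]] by (metis)
  then obtain B where B: "\<And>b x. b \<in> Basis \<Longrightarrow> \<bar>partials [b] \<phi> x\<bar> \<le> B b" by metis
  have "norm (gradient \<phi> x) \<le> (\<Sum>b\<in>Basis. B b)" for x
    unfolding gradient_def using B
    by (intro sum_norm_le) (simp del: partials.simps)
  then show ?thesis using that[of "max 1 (\<Sum>b\<in>Basis. B b)"] by (simp add: max.coboundedI2)
qed

lemma test_functions_lipschitz:
  assumes "\<phi> \<in> test_functions \<Omega>"
  obtains L where "0 < L" "\<And>x y. \<bar>\<phi> x - \<phi> y\<bar> \<le> L * norm (x - y)"
proof -
  from gradient_bounded[OF assms] obtain L where L: "0 < L" "\<And>x. norm (gradient \<phi> x) \<le> L" by blast
  have "norm (\<phi> x - \<phi> y) \<le> L * norm (x - y)" for x y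
  proof (rule differentiable_bound[of UNIV \<phi> "\<lambda>x h. gradient \<phi> x \<bullet> h"])
    show "(\<phi> has_derivative (\<lambda>h. gradient \<phi> x \<bullet> h)) (at x within UNIV)" for x
      using has_derivative_gradient smooth_differentiable test_functions_smooth[OF assms] by auto
    show "onorm (\<lambda>h. gradient \<phi> x \<bullet> h) \<le> L" for x
      using L by (intro onorm_le) (auto intro!: order_trans[OF Cauchy_Schwarz_ineq2] mult_right_mono)
  qed auto
  with L that show ?thesis by auto
qed

section \<open>Hoelder's inequality\<close>

lemma Hoelder_integrable:
  fixes f g :: "'a \<Rightarrow> real"
  assumes pq: "1 < p" "1 < q" "1 / p + 1 / q = 1"
    and [measurable]: "f \<in> borel_measurable M" "g \<in> borel_measurable M"
    and f: "integrable M (\<lambda>x. \<bar>f x\<bar> powr p)" and g: "integrable M (\<lambda>x. \<bar>g x\<bar> powr q)"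
  shows "integrable M (\<lambda>x. f x * g x)"
proof (rule Bochner_Integration.integrable_bound)
  show "integrable M (\<lambda>x. \<bar>f x\<bar> powr p / p + \<bar>g x\<bar> powr q / q)" using f g by simp
  show "AE x in M. norm (f x * g x) \<le> norm (\<bar>f x\<bar> powr p / p + \<bar>g x\<bar> powr q / q)"
    using Youngs_inequality[OF pq, of "\<bar>f x\<bar>" "\<bar>g x\<bar>" for x]
    by (intro AE_I2) (auto simp: abs_mult intro: order_trans[OF _ abs_ge_self])
qed simp

text \<open>Young's inequality for the functions divided by their norms. A vanishing norm, where
  division is impossible, forces the product to vanish almost everywhere.\<close>

lemma Hoelder:
  fixes f g :: "'a \<Rightarrow> real"
  assumes pq: "1 < p" "1 < q" "1 / p + 1 / q = 1"
    and [measurable]: "f \<in> borel_measurable M" "g \<in> borel_measurable M"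
    and f: "integrable M (\<lambda>x. \<bar>f x\<bar> powr p)" and g: "integrable M (\<lambda>x. \<bar>g x\<bar> powr q)"
  shows "(LINT x|M. \<bar>f x * g x\<bar>) \<le> (LINT x|M. \<bar>f x\<bar> powr p) powr (1/p) * (LINT x|M. \<bar>g x\<bar> powr q) powr (1/q)"
proof -
  define F where "F = (LINT x|M. \<bar>f x\<bar> powr p)"
  define G where "G = (LINT x|M. \<bar>g x\<bar> powr q)"
  have F0: "F \<ge> 0" "G \<ge> 0" unfolding F_def G_def by (auto intro!: integral_nonneg_AE)
  consider "F = 0" | "G = 0" | "F > 0" "G > 0" using F0 by linarith
  then have "(LINT x|M. \<bar>f x * g x\<bar>) \<le> F powr (1/p) * G powr (1/q)"
  proof cases
    case 1
    then have "AE x in M. \<bar>f x\<bar> powr p = 0"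
      using integral_nonneg_eq_0_iff_AE[OF f] F_def by auto
    then have "AE x in M. \<bar>f x * g x\<bar> = 0" by eventually_elim (auto simp: abs_mult)
    then have "(LINT x|M. \<bar>f x * g x\<bar>) = 0" by (rule integral_eq_zero_AE)
    then show ?thesis by simp
  next
    case 2
    then have "AE x in M. \<bar>g x\<bar> powr q = 0"
      using integral_nonneg_eq_0_iff_AE[OF g] G_def by auto
    then have "AE x in M. \<bar>f x * g x\<bar> = 0" by eventually_elim (auto simp: abs_mult)
    then have "(LINT x|M. \<bar>f x * g x\<bar>) = 0" by (rule integral_eq_zero_AE)
    then show ?thesis by simp
  next
    case 3
    define a where "a = F powr (1/p)"
    define b where "b = G powr (1/q)"
    have ab: "a > 0" "b > 0" "a powr p = F" "b powr q = G"
      using 3 pq by (auto simp: a_def b_def powr_powr)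
    have "\<bar>f x * g x\<bar> / (a * b) \<le> \<bar>f x\<bar> powr p / (F * p) + \<bar>g x\<bar> powr q / (G * q)" for x
      using Youngs_inequality[OF pq, of "\<bar>f x\<bar> / a" "\<bar>g x\<bar> / b"] ab
      by (simp add: powr_divide abs_mult)
    then have "(LINT x|M. \<bar>f x * g x\<bar> / (a * b)) \<le> (LINT x|M. \<bar>f x\<bar> powr p / (F * p) + \<bar>g x\<bar> powr q / (G * q))"
      using f g Hoelder_integrable[OF assms] by (intro integral_mono) auto
    also have "\<dots> = F / (F * p) + G / (G * q)"
      using f g by (simp add: F_def G_def)
    also have "\<dots> = 1" using 3 pq by simp
    finally have "(LINT x|M. \<bar>f x * g x\<bar>) / (a * b) \<le> 1" by simp
    then show ?thesis using ab by (simp add: a_def[symmetric] b_def[symmetric] field_simps)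
  qed
  then show ?thesis by (simp add: F_def G_def)
qed

section \<open>Mollification\<close>

lemma lborel_reflect: "distr lborel borel (\<lambda>y. x - y) = (lborel :: 'a::euclidean_space measure)"
  using lborel_affine[of "-1" x] by (simp add: density_1 one_ennreal_def[symmetric])

lemma nn_integral_reflect:
  fixes x :: "'a::euclidean_space"
  assumes [measurable]: "g \<in> borel_measurable borel"
  shows "(\<integral>\<^sup>+ y. g (x - y) \<partial>lborel) = (\<integral>\<^sup>+ y. g y \<partial>lborel)"
  by (subst (2) lborel_reflect[of x, symmetric]) (simp add: nn_integral_distr)

lemma nn_integral_shift:
  fixes x :: "'a::euclidean_space"
  assumes [measurable]: "g \<in> borel_measurable borel"
  shows "(\<integral>\<^sup>+ y. g (y - x) \<partial>lborel) = (\<integral>\<^sup>+ y. g y \<partial>lborel)"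
  by (subst (2) lborel_distr_plus[of "- x", symmetric]) (simp add: nn_integral_distr)

lemma integral_reflect:
  fixes x :: "'a::euclidean_space" and g :: "'a \<Rightarrow> 'b::{banach,second_countable_topology}"
  assumes [measurable]: "g \<in> borel_measurable borel"
  shows "(LINT y|lborel. g (x - y)) = (LINT y|lborel. g y)"
  by (subst (2) lborel_reflect[of x, symmetric]) (simp add: integral_distr)

lemma integrable_reflect:
  fixes x :: "'a::euclidean_space" and g :: "'a \<Rightarrow> 'b::{banach,second_countable_topology}"
  assumes "integrable lborel g"
  shows "integrable lborel (\<lambda>y. g (x - y))"
proof -
  have "integrable (distr lborel borel (\<lambda>y. x - y)) g" using assms by (simp add: lborel_reflect)
  then show ?thesis by (subst (asm) integrable_distr_eq) (use assms in auto)
qed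

lemma integrable_compact_support:
  fixes f :: "'a::euclidean_space \<Rightarrow> 'b::{banach,second_countable_topology}"
  assumes "continuous_on UNIV f" "compact K" "\<And>x. x \<notin> K \<Longrightarrow> f x = 0"
  shows "integrable lborel f"
proof -
  have "integrable lborel (\<lambda>x. indicator K x *\<^sub>R f x)"
    using assms by (intro borel_integrable_compact) (auto intro: continuous_on_subset)
  moreover have "(\<lambda>x. indicator K x *\<^sub>R f x) = f" using assms(3) by (auto simp: indicator_def)
  ultimately show ?thesis by simp
qed

lemma smooth_measurable: "smooth_on UNIV f \<Longrightarrow> f \<in> borel_measurable borel"
  by (simp add: borel_measurable_continuous_onI smooth_continuous)

lemma integrable_test_function: "\<phi> \<in> test_functions \<Omega> \<Longrightarrow> integrable lborel \<phi>"
  by (rule integrable_compact_support[of _ "supp \<phi>"])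
     (auto simp: test_functions_def smooth_continuous intro: not_in_supp)

lemma gradient_inner_Basis: "b \<in> Basis \<Longrightarrow> gradient f x \<bullet> b = partials [b] f x"
  unfolding gradient_def by (simp add: inner_sum_left_Basis del: partials.simps)

lemma gradient_measurable: "smooth_on UNIV f \<Longrightarrow> gradient f \<in> borel_measurable borel"
proof -
  assume f: "smooth_on UNIV f"
  have [measurable]: "partials [b] f \<in> borel_measurable borel" if "b \<in> Basis" for b
    using smooth_measurable smooth_partials[OF f that] by blast
  show ?thesis unfolding gradient_def[abs_def] by (intro borel_measurable_sum) measurable
qed

lemma gradient_continuous: "smooth_on UNIV f \<Longrightarrow> continuous_on UNIV (gradient f)"
  unfolding gradient_def[abs_def]
  by (intro continuous_on_sum continuous_on_scaleR continuous_on_const smooth_continuous smooth_partials)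

lemma gradient_lipschitz:
  assumes "\<phi> \<in> test_functions \<Omega>"
  obtains L where "0 < L" "\<And>x y. norm (gradient \<phi> x - gradient \<phi> y) \<le> L * norm (x - y)"
proof -
  have "\<forall>b\<in>Basis. \<exists>L. \<forall>x y. \<bar>partials [b] \<phi> x - partials [b] \<phi> y\<bar> \<le> L * norm (x - y)"
    using test_functions_lipschitz[OF test_functions_partials[OF assms]] by metis
  then obtain L where L: "\<And>b x y. b \<in> Basis \<Longrightarrow> \<bar>partials [b] \<phi> x - partials [b] \<phi> y\<bar> \<le> L b * norm (x - y)"
    by metis
  have "norm (gradient \<phi> x - gradient \<phi> y) \<le> max 1 (\<Sum>b\<in>Basis. L b) * norm (x - y)" for x y
  proof -
    have "gradient \<phi> x - gradient \<phi> y = (\<Sum>b\<in>Basis. (partials [b] \<phi> x - partials [b] \<phi> y) *\<^sub>R b)"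
      unfolding gradient_def by (simp add: sum_subtractf scaleR_diff_left del: partials.simps)
    also have "norm \<dots> \<le> (\<Sum>b\<in>Basis. L b * norm (x - y))"
      using L by (intro sum_norm_le) (simp del: partials.simps)
    also have "\<dots> \<le> max 1 (\<Sum>b\<in>Basis. L b) * norm (x - y)"
      unfolding sum_distrib_right[symmetric] by (intro mult_right_mono) auto
    finally show ?thesis .
  qed
  with that[of "max 1 (\<Sum>b\<in>Basis. L b)"] show ?thesis by auto
qed

text \<open>The gradient of a test function is globally Lipschitz, so the remainder is quadratic
  with one constant for all x. This uniformity allows differentiation under the integral in
  \<open>cnv_has_derivative\<close>.\<close>

lemma test_function_taylor:
  assumes "\<phi> \<in> test_functions \<Omega>"
  obtains L where "0 < L" "\<And>x h. \<bar>\<phi> (x + h) - \<phi> x - gradient \<phi> x \<bullet> h\<bar> \<le> L * (norm h)\<^sup>2"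
proof -
  obtain L where L: "0 < L" "\<And>x y. norm (gradient \<phi> x - gradient \<phi> y) \<le> L * norm (x - y)"
    using gradient_lipschitz[OF assms] by blast
  have "norm (\<phi> (x + h) - \<phi> x - gradient \<phi> x \<bullet> (x + h - x)) \<le> norm (x + h - x) * (L * norm h)" for x h
  proof (rule differentiable_bound_linearization[where S = "cball x (norm h)" and f' = "\<lambda>x h. gradient \<phi> x \<bullet> h" and ?x0.0 = x])
    show "x + t *\<^sub>R (x + h - x) \<in> cball x (norm h)" if "t \<in> {0..1}" for t
      using that by (auto simp: dist_norm intro: mult_left_le_one_le)
    show "(\<phi> has_derivative (\<bullet>) (gradient \<phi> y)) (at y within cball x (norm h))" for y
      using has_derivative_gradient smooth_differentiable test_functions_smooth[OF assms]
        has_derivative_at_withinI by blast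
    show "onorm (((\<bullet>) (gradient \<phi> y)) - ((\<bullet>) (gradient \<phi> x))) \<le> L * norm h"
      if "y \<in> cball x (norm h)" for y
      unfolding fun_diff_def
    proof (rule onorm_le)
      fix v
      have "norm (gradient \<phi> y \<bullet> v - gradient \<phi> x \<bullet> v) \<le> norm (gradient \<phi> y - gradient \<phi> x) * norm v"
        unfolding inner_diff_left[symmetric] using Cauchy_Schwarz_ineq2 by simp
      also have "\<dots> \<le> L * norm h * norm v"
        using that L(1) by (intro mult_right_mono order_trans[OF L(2)] mult_left_mono)
          (auto simp: dist_norm norm_minus_commute)
      finally show "norm (gradient \<phi> y \<bullet> v - gradient \<phi> x \<bullet> v) \<le> L * norm h * norm v" .
    qed
  qed auto
  then have "\<bar>\<phi> (x + h) - \<phi> x - gradient \<phi> x \<bullet> h\<bar> \<le> L * (norm h)\<^sup>2" for x h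
    by (simp add: power2_eq_square mult_ac)
  with L that show ?thesis by blast
qed

section \<open>Convolution with a smooth kernel\<close>

definition cnv :: "('a::euclidean_space \<Rightarrow> real) \<Rightarrow> ('a \<Rightarrow> real) \<Rightarrow> 'a \<Rightarrow> real" where
  "cnv k f x = (LINT y|lborel. k (x - y) * f y)"

lemma integrable_bounded_mult:
  fixes f :: "'a \<Rightarrow> 'b::{banach,second_countable_topology}"
  assumes "integrable M f" "k \<in> borel_measurable M" "\<And>x. \<bar>k x\<bar> \<le> (B::real)"
  shows "integrable M (\<lambda>x. k x *\<^sub>R f x)"
proof (rule Bochner_Integration.integrable_bound)
  show "integrable M (\<lambda>x. B * norm (f x))" using assms(1) by simp
  have "0 \<le> B" using assms(3)[of undefined] by linarith
  then show "AE x in M. norm (k x *\<^sub>R f x) \<le> norm (B * norm (f x))"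
    using assms(3) by (intro AE_I2) (auto simp: abs_mult intro!: mult_right_mono)
qed (use assms borel_measurable_integrable in auto)

lemma integral_norm_le:
  fixes f :: "'a \<Rightarrow> 'b::{banach,second_countable_topology}"
  assumes "integrable M f" "integrable M g" "\<And>x. norm (f x) \<le> g x"
  shows "norm (LINT x|M. f x) \<le> (LINT x|M. g x)"
  by (rule order_trans[OF integral_norm_bound]) (use assms in \<open>auto intro!: integral_mono\<close>)

text \<open>Integrating the uniform quadratic Taylor remainder of the kernel against |f| bounds the
  linearization error by L times the L^1 norm of f times the square of the increment.\<close>

lemma cnv_has_derivative:
  assumes k: "k \<in> test_functions \<Omega>" and f: "integrable lborel f"
  shows "(cnv k f has_derivative (\<lambda>h. (LINT y|lborel. f y *\<^sub>R gradient k (x - y)) \<bullet> h)) (at x)"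
proof -
  note ks = test_functions_smooth[OF k]
  note [measurable] = smooth_measurable[OF ks] gradient_measurable[OF ks] borel_measurable_integrable[OF f]
  obtain L where L: "0 < L" "\<And>x h. \<bar>k (x + h) - k x - gradient k x \<bullet> h\<bar> \<le> L * (norm h)\<^sup>2"
    using test_function_taylor[OF k] by blast
  obtain B where B: "0 < B" "\<And>x. \<bar>k x\<bar> \<le> B" using test_functions_bounded[OF k] by blast
  obtain B' where B': "0 < B'" "\<And>x. norm (gradient k x) \<le> B'" using gradient_bounded[OF k] by blast
  have i1: "integrable lborel (\<lambda>y. k (x - y) * f y)" for x
    using integrable_bounded_mult[OF f, of "\<lambda>y. k (x - y)" B] B by simp
  have i2: "integrable lborel (\<lambda>y. f y *\<^sub>R gradient k (x - y))"
  proof (rule Bochner_Integration.integrable_bound)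
    show "integrable lborel (\<lambda>y. B' * norm (f y))" using f by simp
    show "AE y in lborel. norm (f y *\<^sub>R gradient k (x - y)) \<le> norm (B' * norm (f y))"
      using B' by (intro AE_I2) (auto simp: abs_mult mult.commute[of B'] intro!: mult_left_mono)
  qed simp
  show ?thesis
  proof (rule has_derivativeI_sandwich[of 1])
    show "bounded_linear (\<lambda>h. (LINT y|lborel. f y *\<^sub>R gradient k (x - y)) \<bullet> h)"
      by (rule bounded_linear_inner_right)
    show "((\<lambda>y. L * (LINT y|lborel. \<bar>f y\<bar>) * norm (y - x)) \<longlongrightarrow> 0) (at x)"
      by (auto intro!: tendsto_eq_intros)
    fix z assume z: "z \<noteq> x"
    have "cnv k f z - cnv k f x - (LINT y|lborel. f y *\<^sub>R gradient k (x - y)) \<bullet> (z - x)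
        = (LINT y|lborel. f y * (k ((x - y) + (z - x)) - k (x - y) - gradient k (x - y) \<bullet> (z - x)))"
    proof -
      have "(LINT y|lborel. f y * (k ((x - y) + (z - x)) - k (x - y) - gradient k (x - y) \<bullet> (z - x)))
        = (LINT y|lborel. k (z - y) * f y - k (x - y) * f y - (f y *\<^sub>R gradient k (x - y)) \<bullet> (z - x))"
        by (intro Bochner_Integration.integral_cong) (auto simp: right_diff_distrib mult.commute)
      also have "\<dots> = (LINT y|lborel. k (z - y) * f y - k (x - y) * f y)
          - (LINT y|lborel. (f y *\<^sub>R gradient k (x - y)) \<bullet> (z - x))"
        using i1[of z] i1[of x] integrable_inner_left[OF i2, of "z - x"]
        by (intro Bochner_Integration.integral_diff) auto
      also have "\<dots> = cnv k f z - cnv k f x - (LINT y|lborel. f y *\<^sub>R gradient k (x - y)) \<bullet> (z - x)"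
        using i1[of z] i1[of x] integral_inner_left[OF i2, of "z - x"] by (simp add: cnv_def)
      finally show ?thesis by simp
    qed
    also have "norm \<dots> \<le> (LINT y|lborel. \<bar>f y\<bar> * (L * (norm (z - x))\<^sup>2))"
    proof (rule integral_norm_le)
      show "integrable lborel (\<lambda>y. f y * (k ((x - y) + (z - x)) - k (x - y) - gradient k (x - y) \<bullet> (z - x)))"
      proof -
        have "integrable lborel (\<lambda>y. k (z - y) * f y - k (x - y) * f y - (f y *\<^sub>R gradient k (x - y)) \<bullet> (z - x))"
          using i1[of z] i1[of x] integrable_inner_left[OF i2, of "z - x"]
          by (intro Bochner_Integration.integrable_diff)
        then show ?thesis
          by (rule Bochner_Integration.integrable_cong[THEN iffD1, rotated 2])
             (auto simp: right_diff_distrib mult.commute)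
      qed
      show "integrable lborel (\<lambda>y. \<bar>f y\<bar> * (L * (norm (z - x))\<^sup>2))" using f by simp
      show "norm (f y * (k ((x - y) + (z - x)) - k (x - y) - gradient k (x - y) \<bullet> (z - x)))
          \<le> \<bar>f y\<bar> * (L * (norm (z - x))\<^sup>2)" for y
        using L(2)[of "x - y" "z - x"] by (auto simp: abs_mult intro: mult_left_mono)
    qed
    also have "\<dots> = L * (LINT y|lborel. \<bar>f y\<bar>) * norm (z - x) * norm (z - x)"
      by (simp add: power2_eq_square)
    finally show "norm (cnv k f z - cnv k f x - (LINT y|lborel. f y *\<^sub>R gradient k (x - y)) \<bullet> (z - x)) / norm (z - x)
      \<le> L * (LINT y|lborel. \<bar>f y\<bar>) * norm (z - x)"
      using z by (simp add: divide_le_eq)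
  qed simp
qed

lemma partials_cnv:
  assumes k: "k \<in> test_functions \<Omega>" and f: "integrable lborel f" and b: "b \<in> Basis"
  shows "partials [b] (cnv k f) x = cnv (partials [b] k) f x"
proof -
  note ks = test_functions_smooth[OF k]
  note [measurable] = smooth_measurable[OF ks] gradient_measurable[OF ks] borel_measurable_integrable[OF f]
  obtain B' where B': "0 < B'" "\<And>x. norm (gradient k x) \<le> B'" using gradient_bounded[OF k] by blast
  have i2: "integrable lborel (\<lambda>y. f y *\<^sub>R gradient k (x - y))"
  proof (rule Bochner_Integration.integrable_bound)
    show "integrable lborel (\<lambda>y. B' * norm (f y))" using f by simp
    show "AE y in lborel. norm (f y *\<^sub>R gradient k (x - y)) \<le> norm (B' * norm (f y))"
      using B' by (intro AE_I2) (auto simp: abs_mult mult.commute[of B'] intro!: mult_left_mono)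
  qed simp
  show ?thesis
    unfolding partials_eqI[OF cnv_has_derivative[OF k f]] cnv_def integral_inner_left[OF i2, symmetric]
    by (simp add: gradient_inner_Basis[OF b] mult.commute del: partials.simps)
qed

text \<open>All derivatives fall on the kernel, whose partial derivatives are again test functions;
  so the induction varies k and keeps f merely integrable.\<close>

lemma smooth_cnv:
  assumes k: "k \<in> test_functions \<Omega>" and f: "integrable lborel f"
  shows "smooth_on UNIV (cnv k f)"
proof -
  have "ck n (cnv k f)" if "k \<in> test_functions \<Omega>" for n k
    using that
  proof (induction n arbitrary: k)
    case 0
    show ?case unfolding ck_0 using cnv_has_derivative[OF 0 f] Derivative.differentiableI by blast
  next
    case (Suc n)
    have "partials [b] (cnv k f) = cnv (partials [b] k) f" if "b \<in> Basis" for b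
      using partials_cnv[OF Suc.prems f that] by blast
    then show ?case unfolding ck_Suc
      using cnv_has_derivative[OF Suc.prems f] Derivative.differentiableI
        Suc.IH[OF test_functions_partials[OF Suc.prems]] by (metis (full_types))
  qed
  with k show ?thesis by (simp add: smooth_iff_ck)
qed

section \<open>The normalized mollifier\<close>

definition moll_mass :: "'a::euclidean_space itself \<Rightarrow> real \<Rightarrow> real" where
  "moll_mass _ \<epsilon> = (LINT y|lborel. bump (0::'a) \<epsilon> y)"

definition mker :: "real \<Rightarrow> 'a::euclidean_space \<Rightarrow> real" where
  "mker \<epsilon> z = bump 0 \<epsilon> z / moll_mass TYPE('a) \<epsilon>"

definition moll :: "real \<Rightarrow> ('a::euclidean_space \<Rightarrow> 'b::euclidean_space) \<Rightarrow> 'a \<Rightarrow> 'b" where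
  "moll \<epsilon> f x = (LINT y|lborel. mker \<epsilon> (x - y) *\<^sub>R f y)"

lemma bump_measurable [measurable]: "bump x0 r \<in> borel_measurable borel"
  by (simp add: smooth_bump smooth_measurable)

lemma mker_measurable [measurable]: "mker \<epsilon> \<in> borel_measurable borel"
  unfolding mker_def[abs_def] by simp

lemma integrable_bump: "0 < r \<Longrightarrow> integrable lborel (bump x0 r)"
  by (rule integrable_test_function[OF bump_test_function[of r x0 UNIV]]) auto

text \<open>The half ball carries the fraction 2^(-N) of the volume, N the dimension, and the bump
  is at least e^(-4/3) on it.\<close>

lemma moll_mass_lower:
  assumes "0 < \<epsilon>"
  shows "exp (- 4 / 3) / 2 ^ DIM('a) * measure lborel (ball (0::'a::euclidean_space) \<epsilon>) \<le> moll_mass TYPE('a) \<epsilon>"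
proof -
  let ?B = "ball (0::'a) (\<epsilon> / 2)"
  have "measure lborel ?B = measure lborel (ball (0::'a) \<epsilon>) / 2 ^ DIM('a)"
    using content_ball_conv_unit_ball[of "\<epsilon> / 2" "0::'a"] content_ball_conv_unit_ball[of "\<epsilon>" "0::'a"] assms
    by (simp add: power_divide)
  then have "exp (- 4 / 3) / 2 ^ DIM('a) * measure lborel (ball (0::'a) \<epsilon>)
      = (LINT y|lborel. exp (- 4 / 3) * indicator ?B y)" by simp
  also have "\<dots> \<le> moll_mass TYPE('a) \<epsilon>"
    unfolding moll_mass_def
  proof (rule integral_mono)
    show "integrable lborel (\<lambda>y. exp (- 4 / 3) * indicator ?B y :: real)"
      by (intro integrable_mult_right integrable_real_indicator) (use emeasure_lborel_ball_finite[of 0 "\<epsilon> / 2"] in auto)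
    show "exp (- 4 / 3) * indicator ?B y \<le> bump 0 \<epsilon> y" for y
      using bump_lower[OF assms, of y 0] bump_nonneg[of 0 \<epsilon> y] by (auto simp: indicator_def)
  qed (rule integrable_bump[OF assms])
  finally show ?thesis .
qed

lemma moll_mass_pos: "0 < \<epsilon> \<Longrightarrow> 0 < moll_mass TYPE('a::euclidean_space) \<epsilon>"
  by (rule less_le_trans[OF _ moll_mass_lower]) (auto simp: content_ball_pos)

lemma mker_nonneg: "0 < \<epsilon> \<Longrightarrow> 0 \<le> mker \<epsilon> (z::'a::euclidean_space)"
  using moll_mass_pos[of \<epsilon>, where 'a='a] by (simp add: mker_def bump_nonneg)

lemma mker_eq_0: "0 < \<epsilon> \<Longrightarrow> \<epsilon> \<le> norm z \<Longrightarrow> mker \<epsilon> z = 0"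
  using bump_eq_0[of \<epsilon> z 0] by (simp add: mker_def)

text \<open>The kernel is dominated by a dimensional multiple of the normalized indicator of the
  ball. Mollifications are thereby controlled by averages over balls, the quantities that occur in
  the A_p condition.\<close>

lemma mker_le:
  fixes z :: "'a::euclidean_space"
  assumes "0 < \<epsilon>"
  shows "mker \<epsilon> z \<le> exp (4 / 3) * 2 ^ DIM('a) / measure lborel (ball (0::'a) \<epsilon>)"
proof -
  have "measure lborel (ball (0::'a) \<epsilon>) > 0" using assms by (simp add: content_ball_pos)
  moreover have "mker \<epsilon> z \<le> 1 / moll_mass TYPE('a) \<epsilon>"
    unfolding mker_def using moll_mass_pos[OF assms, where 'a='a] bump_le_1 by (intro divide_right_mono) auto
  moreover have "1 / moll_mass TYPE('a) \<epsilon> \<le> 1 / (exp (- 4 / 3) / 2 ^ DIM('a) * measure lborel (ball (0::'a) \<epsilon>))"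
    using moll_mass_lower[OF assms, where 'a='a] calculation(1) by (intro divide_left_mono mult_pos_pos moll_mass_pos assms) auto
  moreover have "1 / (exp (- 4 / 3) / 2 ^ DIM('a) * measure lborel (ball (0::'a) \<epsilon>))
      = exp (4 / 3) * 2 ^ DIM('a) / measure lborel (ball (0::'a) \<epsilon>)"
    by (simp add: exp_minus field_simps)
  ultimately show ?thesis by linarith
qed

lemma mker_bounded: "0 < \<epsilon> \<Longrightarrow> \<exists>B. \<forall>z::'a::euclidean_space. \<bar>mker \<epsilon> z\<bar> \<le> B"
  using mker_le mker_nonneg by (metis abs_of_nonneg)

lemma mker_integrable: "0 < \<epsilon> \<Longrightarrow> integrable lborel (mker \<epsilon>)"
  unfolding mker_def[abs_def] by (simp add: integrable_bump)

lemma mker_integral: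
  fixes x :: "'a::euclidean_space"
  assumes "0 < \<epsilon>"
  shows "(LINT y|lborel. mker \<epsilon> (x - y)) = 1" "integrable lborel (\<lambda>y. mker \<epsilon> (x - y))"
    "(\<integral>\<^sup>+ y. ennreal (mker \<epsilon> (y::'a)) \<partial>lborel) = 1" "(\<integral>\<^sup>+ y. ennreal (mker \<epsilon> (x - y)) \<partial>lborel) = 1"
    "(\<integral>\<^sup>+ y. ennreal (mker \<epsilon> (y - x)) \<partial>lborel) = 1"
proof -
  have 1: "(LINT y|lborel. mker \<epsilon> (y::'a)) = 1"
    using moll_mass_pos[OF assms, where 'a='a] unfolding mker_def by (simp add: moll_mass_def)
  then show "(LINT y|lborel. mker \<epsilon> (x - y)) = 1" by (subst integral_reflect) auto
  show "integrable lborel (\<lambda>y. mker \<epsilon> (x - y))" by (rule integrable_reflect[OF mker_integrable[OF assms]])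
  show 2: "(\<integral>\<^sup>+ y. ennreal (mker \<epsilon> (y::'a)) \<partial>lborel) = 1"
    using 1 mker_nonneg[OF assms] by (subst nn_integral_eq_integral[OF mker_integrable[OF assms]]) auto
  then show "(\<integral>\<^sup>+ y. ennreal (mker \<epsilon> (x - y)) \<partial>lborel) = 1"
    using nn_integral_reflect[of "\<lambda>y. ennreal (mker \<epsilon> y)" x] by simp
  from 2 show "(\<integral>\<^sup>+ y. ennreal (mker \<epsilon> (y - x)) \<partial>lborel) = 1"
    using nn_integral_shift[of "\<lambda>y. ennreal (mker \<epsilon> y)" x] by simp
qed

lemma moll_integrable:
  fixes f :: "'a::euclidean_space \<Rightarrow> 'b::euclidean_space"
  assumes "0 < \<epsilon>" "integrable lborel f"
  shows "integrable lborel (\<lambda>y. mker \<epsilon> (x - y) *\<^sub>R f y)"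
proof -
  obtain B where "\<And>z::'a. \<bar>mker \<epsilon> z\<bar> \<le> B" using mker_bounded[OF assms(1)] by blast
  then show ?thesis using integrable_bounded_mult[OF assms(2), of "\<lambda>y. mker \<epsilon> (x - y)" B] by simp
qed

lemma moll_measurable [measurable]:
  fixes f :: "'a::euclidean_space \<Rightarrow> 'b::euclidean_space"
  assumes [measurable]: "f \<in> borel_measurable borel"
  shows "moll \<epsilon> f \<in> borel_measurable borel"
  unfolding moll_def[abs_def] by measurable

lemma moll_diff:
  fixes f :: "'a::euclidean_space \<Rightarrow> 'b::euclidean_space"
  assumes "0 < \<epsilon>" "integrable lborel f" "integrable lborel g"
  shows "moll \<epsilon> (\<lambda>y. f y - g y) x = moll \<epsilon> f x - moll \<epsilon> g x"
  unfolding moll_def using moll_integrable[OF assms(1,2)] moll_integrable[OF assms(1,3)]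
  by (simp add: scaleR_diff_right)

lemma moll_eq_cnv: "moll \<epsilon> (f::'a::euclidean_space \<Rightarrow> real) x = cnv (bump 0 \<epsilon>) f x / moll_mass TYPE('a) \<epsilon>"
  unfolding moll_def cnv_def mker_def by simp

lemma smooth_moll: "0 < \<epsilon> \<Longrightarrow> integrable lborel f \<Longrightarrow> smooth_on UNIV (moll \<epsilon> f)"
  using smooth_mult[OF smooth_cnv[OF bump_test_function[of \<epsilon> 0 UNIV]] smooth_const]
  unfolding moll_eq_cnv[abs_def] divide_inverse by blast

lemma norm_moll_le:
  fixes f :: "'a::euclidean_space \<Rightarrow> 'b::euclidean_space"
  assumes "0 < \<epsilon>" "integrable lborel f"
  shows "norm (moll \<epsilon> f x) \<le> (LINT y|lborel. mker \<epsilon> (x - y) * norm (f y))"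
  unfolding moll_def
proof (intro integral_norm_le moll_integrable assms)
  show "integrable lborel (\<lambda>y. mker \<epsilon> (x - y) * norm (f y))"
    using moll_integrable[OF assms(1) integrable_norm[OF assms(2)]] by simp
qed (simp add: mker_nonneg[OF assms(1)])

lemma nn_norm_moll_le:
  fixes f :: "'a::euclidean_space \<Rightarrow> 'b::euclidean_space"
  assumes "0 < \<epsilon>" "integrable lborel f"
  shows "ennreal (norm (moll \<epsilon> f x)) \<le> (\<integral>\<^sup>+ y. ennreal (mker \<epsilon> (x - y)) * ennreal (norm (f y)) \<partial>lborel)"
proof -
  have "(\<integral>\<^sup>+ y. ennreal (mker \<epsilon> (x - y)) * ennreal (norm (f y)) \<partial>lborel)
     = ennreal (LINT y|lborel. mker \<epsilon> (x - y) * norm (f y))"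
    using moll_integrable[OF assms(1) integrable_norm[OF assms(2)]] mker_nonneg[OF assms(1), where 'a='a]
    by (subst nn_integral_eq_integral[symmetric]) (auto simp: ennreal_mult)
  then show ?thesis using norm_moll_le[OF assms] by (simp add: ennreal_leI)
qed

lemma moll_minus_self:
  fixes f :: "'a::euclidean_space \<Rightarrow> 'b::euclidean_space"
  assumes "0 < \<epsilon>" "integrable lborel f"
  shows "norm (moll \<epsilon> f x - f x) \<le> (LINT y|lborel. mker \<epsilon> (x - y) * norm (f y - f x))"
    "integrable lborel (\<lambda>y. mker \<epsilon> (x - y) * norm (f y - f x))"
proof -
  have [measurable]: "f \<in> borel_measurable borel" using assms(2) by auto
  have i: "integrable lborel (\<lambda>y. mker \<epsilon> (x - y) *\<^sub>R (f y - f x))"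
    using moll_integrable[OF assms, of x] mker_integral(2)[OF assms(1), of x]
    by (auto simp: scaleR_diff_right)
  then show j: "integrable lborel (\<lambda>y. mker \<epsilon> (x - y) * norm (f y - f x))"
    by (rule Bochner_Integration.integrable_bound) (use mker_nonneg[OF assms(1), where 'a='a] in auto)
  have "moll \<epsilon> f x - f x = (LINT y|lborel. mker \<epsilon> (x - y) *\<^sub>R (f y - f x))"
    unfolding moll_def using moll_integrable[OF assms, of x] mker_integral(1,2)[OF assms(1), of x]
    by (auto simp: scaleR_diff_right)
  also have "norm \<dots> \<le> (LINT y|lborel. mker \<epsilon> (x - y) * norm (f y - f x))"
    using i j mker_nonneg[OF assms(1), where 'a='a] by (intro integral_norm_le) auto
  finally show "norm (moll \<epsilon> f x - f x) \<le> (LINT y|lborel. mker \<epsilon> (x - y) * norm (f y - f x))" .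
qed

text \<open>Tonelli's theorem, and the unit mass of the kernel in the variable x for each fixed
  y.\<close>

lemma nn_moll_L1:
  assumes "0 < \<epsilon>" "integrable lborel f"
  shows "(\<integral>\<^sup>+ x. ennreal (norm (moll \<epsilon> f x)) \<partial>lborel) \<le> (\<integral>\<^sup>+ x. ennreal (norm (f x)) \<partial>lborel)"
proof -
  have [measurable]: "f \<in> borel_measurable borel" using assms(2) by auto
  have "(\<integral>\<^sup>+ x. ennreal (norm (moll \<epsilon> f x)) \<partial>lborel)
     \<le> (\<integral>\<^sup>+ x. \<integral>\<^sup>+ y. ennreal (mker \<epsilon> (x - y)) * ennreal (norm (f y)) \<partial>lborel \<partial>lborel)"
    by (intro nn_integral_mono nn_norm_moll_le assms)
  also have "\<dots> = (\<integral>\<^sup>+ y. \<integral>\<^sup>+ x. ennreal (mker \<epsilon> (x - y)) * ennreal (norm (f y)) \<partial>lborel \<partial>lborel)"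
    by (rule lborel_pair.Fubini') measurable
  also have "\<dots> = (\<integral>\<^sup>+ y. ennreal (norm (f y)) \<partial>lborel)"
    by (subst nn_integral_multc) (auto simp: mker_integral(5)[OF assms(1)])
  finally show ?thesis .
qed

lemma moll_eq_0:
  fixes f :: "'a::euclidean_space \<Rightarrow> 'b::euclidean_space"
  assumes "0 < \<epsilon>" "\<And>y. y \<in> ball x \<epsilon> \<Longrightarrow> f y = 0"
  shows "moll \<epsilon> f x = 0"
proof -
  have "mker \<epsilon> (x - y) *\<^sub>R f y = 0" for y
    using mker_eq_0[OF assms(1), of "x - y"] assms(2)[of y] by (cases "y \<in> ball x \<epsilon>") (auto simp: dist_norm)
  then show ?thesis unfolding moll_def by (simp only:) simp
qed

text \<open>The integration by parts identity alone, over \<open>lborel\<close>; integrability is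
  stated separately where it is used. Integrating over the whole space is harmless since test
  functions vanish off \<Omega>.\<close>

definition wgrad :: "'a::euclidean_space set \<Rightarrow> ('a \<Rightarrow> real) \<Rightarrow> ('a \<Rightarrow> 'a) \<Rightarrow> bool" where
  "wgrad \<Omega> v z \<longleftrightarrow> (\<forall>\<phi>\<in>test_functions \<Omega>. \<forall>b\<in>Basis.
        (LINT x|lborel. v x * partials [b] \<phi> x) = - (LINT x|lborel. (z x \<bullet> b) * \<phi> x))"

text \<open>Moving the derivative to the kernel and reflecting it produces the partial derivative of
  \<open>bump x \<epsilon>\<close>, a test function on \<Omega> because the closed ball lies in
  \<Omega>. The sign from the reflection cancels the one in the definition of the weak
  gradient.\<close>

lemma partials_moll:
  fixes v :: "'a::euclidean_space \<Rightarrow> real"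
  assumes \<epsilon>: "0 < \<epsilon>" and v: "integrable lborel v" and z: "integrable lborel z" and wg: "wgrad \<Omega> v z"
    and x: "cball x \<epsilon> \<subseteq> \<Omega>" and b: "b \<in> Basis"
  shows "partials [b] (moll \<epsilon> v) x = moll \<epsilon> z x \<bullet> b"
proof -
  have t: "bump (0::'a) \<epsilon> \<in> test_functions UNIV" using bump_test_function[OF \<epsilon>] by blast
  let ?c = "moll_mass TYPE('a) \<epsilon>"
  have "partials [b] (\<lambda>x. inverse ?c * cnv (bump 0 \<epsilon>) v x) x
     = inverse ?c * partials [b] (cnv (bump 0 \<epsilon>) v) x + partials [b] (\<lambda>x. inverse ?c) x * cnv (bump 0 \<epsilon>) v x"
    by (rule partials_mult) (auto intro: smooth_differentiable smooth_cnv[OF t v])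
  also have "partials [b] (\<lambda>x::'a. inverse ?c) x = 0" by (rule partials_eqI[THEN trans]) auto
  finally have "partials [b] (moll \<epsilon> v) x = inverse ?c * cnv (partials [b] (bump 0 \<epsilon>)) v x"
    unfolding moll_eq_cnv[abs_def] partials_cnv[OF t v b] by (simp add: divide_inverse mult.commute)
  also have "cnv (partials [b] (bump 0 \<epsilon>)) v x = - (LINT y|lborel. v y * partials [b] (bump x \<epsilon>) y)"
    unfolding cnv_def partials_bump_reflect[of b x] by (simp add: mult.commute del: partials.simps)
  also have "\<dots> = (LINT y|lborel. (z y \<bullet> b) * bump x \<epsilon> y)"
    using wg bump_test_function[OF \<epsilon> x] b unfolding wgrad_def by simp
  also have "inverse ?c * \<dots> = (LINT y|lborel. (mker \<epsilon> (x - y) *\<^sub>R z y) \<bullet> b)"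
    unfolding mker_def bump_reflect[of x] by (simp add: divide_inverse mult_ac flip: integral_mult_right_zero)
  also have "\<dots> = moll \<epsilon> z x \<bullet> b"
    unfolding moll_def by (rule integral_inner_left[OF moll_integrable[OF \<epsilon> z]])
  finally show ?thesis .
qed

lemma gradient_moll:
  fixes v :: "'a::euclidean_space \<Rightarrow> real"
  assumes "0 < \<epsilon>" "integrable lborel v" "integrable lborel z" "wgrad \<Omega> v z" "cball x \<epsilon> \<subseteq> \<Omega>"
  shows "gradient (moll \<epsilon> v) x = moll \<epsilon> z x"
  by (rule euclidean_eqI) (simp add: gradient_inner_Basis partials_moll[OF assms] del: partials.simps)

section \<open>Convergence of mollifications\<close>

text \<open>Comparison with three times the largest summand. The argument covers every positive
  exponent, convex or not, at the price of the factor \<open>3 powr q\<close>.\<close>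

lemma powr_add3_le:
  fixes a b c q :: real
  assumes "0 \<le> a" "0 \<le> b" "0 \<le> c" "0 < q"
  shows "(a + b + c) powr q \<le> 3 powr q * (a powr q + b powr q + c powr q)"
proof -
  define m where "m = max a (max b c)"
  have m: "0 \<le> m" "a + b + c \<le> 3 * m" using assms by (auto simp: m_def)
  have "m = a \<or> m = b \<or> m = c" unfolding m_def by linarith
  then have "m powr q = a powr q \<or> m powr q = b powr q \<or> m powr q = c powr q" by blast
  then have mq: "m powr q \<le> a powr q + b powr q + c powr q"
    using powr_ge_zero[of a q] powr_ge_zero[of b q] powr_ge_zero[of c q] by linarith
  have "(a + b + c) powr q \<le> (3 * m) powr q" using m assms by (intro powr_mono2) auto
  also have "\<dots> = 3 powr q * m powr q" using m by (simp add: powr_mult)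
  finally show ?thesis using mq by (meson mult_left_mono order_trans powr_ge_zero)
qed

text \<open>A triangle inequality up to a constant in L^q(W). Three summands are what the splitting
  of \<open>moll \<epsilon> f x - f x\<close> through a continuous approximation of f
  produces.\<close>

lemma nn_integral_add3_le:
  fixes f g h :: "'a \<Rightarrow> 'b::{second_countable_topology,real_normed_vector}"
  assumes [measurable]: "f \<in> borel_measurable M" "g \<in> borel_measurable M" "h \<in> borel_measurable M" "W \<in> borel_measurable M"
    and W: "\<And>x. 0 \<le> W x" and q: "0 < q"
  shows "(\<integral>\<^sup>+x. ennreal (norm (f x + g x + h x) powr q * W x) \<partial>M) \<le> ennreal (3 powr q) *
     ((\<integral>\<^sup>+x. ennreal (norm (f x) powr q * W x) \<partial>M) + (\<integral>\<^sup>+x. ennreal (norm (g x) powr q * W x) \<partial>M)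
      + (\<integral>\<^sup>+x. ennreal (norm (h x) powr q * W x) \<partial>M))"
proof -
  have "(\<integral>\<^sup>+x. ennreal (norm (f x + g x + h x) powr q * W x) \<partial>M)
    \<le> (\<integral>\<^sup>+x. ennreal (3 powr q) * (ennreal (norm (f x) powr q * W x) + ennreal (norm (g x) powr q * W x)
        + ennreal (norm (h x) powr q * W x)) \<partial>M)"
  proof (rule nn_integral_mono)
    fix x
    have "norm (f x + g x + h x) powr q \<le> (norm (f x) + norm (g x) + norm (h x)) powr q"
      using q by (intro powr_mono2 order_trans[OF norm_triangle_ineq] add_mono) auto
    also have "\<dots> \<le> 3 powr q * (norm (f x) powr q + norm (g x) powr q + norm (h x) powr q)"
      by (rule powr_add3_le) (use q in auto)
    finally have "norm (f x + g x + h x) powr q * W x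
      \<le> 3 powr q * (norm (f x) powr q * W x + norm (g x) powr q * W x + norm (h x) powr q * W x)"
      using mult_right_mono[OF _ W[of x]] by (fastforce simp: algebra_simps)
    then show "ennreal (norm (f x + g x + h x) powr q * W x) \<le> ennreal (3 powr q) * (ennreal (norm (f x) powr q * W x)
       + ennreal (norm (g x) powr q * W x) + ennreal (norm (h x) powr q * W x))"
      using W by (simp add: ennreal_plus[symmetric] ennreal_mult'[symmetric] ennreal_leI del: ennreal_plus)
  qed
  also have "\<dots> = ennreal (3 powr q) *
     ((\<integral>\<^sup>+x. ennreal (norm (f x) powr q * W x) \<partial>M) + (\<integral>\<^sup>+x. ennreal (norm (g x) powr q * W x) \<partial>M)
      + (\<integral>\<^sup>+x. ennreal (norm (h x) powr q * W x) \<partial>M))"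
    by (subst nn_integral_cmult, simp, subst nn_integral_add, simp, simp, subst nn_integral_add, auto)
  finally show ?thesis .
qed

text \<open>Dominated convergence: at each point the error is 0 as soon as n exceeds the norm of f
  there.\<close>

lemma bounded_approx_Lq:
  fixes f :: "'a \<Rightarrow> 'b::{second_countable_topology,real_normed_vector}"
  assumes [measurable]: "f \<in> borel_measurable M" "W \<in> borel_measurable M"
    and q: "0 < q" and f: "(\<integral>\<^sup>+x. ennreal (norm (f x) powr q * W x) \<partial>M) < \<infinity>" and e: "0 < (e::ennreal)"
  obtains n :: nat where
    "(\<integral>\<^sup>+x. ennreal (norm (f x - (if norm (f x) \<le> real n then f x else 0)) powr q * W x) \<partial>M) < e"
proof -
  let ?g = "\<lambda>n x. ennreal (norm (f x - (if norm (f x) \<le> real n then f x else 0)) powr q * W x)"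
  have "(\<lambda>n. \<integral>\<^sup>+x. ?g n x \<partial>M) \<longlonglongrightarrow> (\<integral>\<^sup>+x. 0 \<partial>M)"
  proof (rule nn_integral_dominated_convergence[OF _ _ _ _ f])
    show "AE x in M. ?g n x \<le> ennreal (norm (f x) powr q * W x)" for n
      by (intro AE_I2) (use q in auto)
    have "(\<lambda>n. ?g n x) \<longlonglongrightarrow> 0" for x
    proof (rule tendsto_eventually)
      show "eventually (\<lambda>n. ?g n x = 0) sequentially"
        using eventually_ge_at_top[of "nat \<lceil>norm (f x)\<rceil>"]
        by eventually_elim (use q in \<open>auto simp: nat_le_iff ceiling_le_iff\<close>)
    qed
    then show "AE x in M. (\<lambda>n. ?g n x) \<longlonglongrightarrow> 0" by simp
  qed measurable
  then have "eventually (\<lambda>n. (\<integral>\<^sup>+x. ?g n x \<partial>M) < e) sequentially"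
    using e by (intro order_tendstoD(2)[where a = e]) auto
  then obtain n where "(\<integral>\<^sup>+x. ?g n x \<partial>M) < e" by (auto simp: eventually_sequentially)
  with that show ?thesis by blast
qed

lemma AE_lborel_of_negligible: "negligible N \<Longrightarrow> (\<And>x. x \<notin> N \<Longrightarrow> P x) \<Longrightarrow> AE x in lborel. P x"
proof -
  assume N: "negligible N" "\<And>x. x \<notin> N \<Longrightarrow> P x"
  have "AE x in lebesgue. x \<notin> N"
    using N(1) by (intro AE_not_in) (simp add: negligible_iff_null_sets)
  then have "AE x in lebesgue. P x" using N(2) by (auto elim!: AE_mp)
  then show ?thesis by (simp add: AE_completion_iff)
qed

text \<open>A measurable function is an almost everywhere limit of continuous ones, but these keep
  neither the bound M nor the support. Clipping the values and cutting off restore both, so that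
  (2M)^q W on a ball is an integrable majorant.\<close>

lemma continuous_approx_bounded:
  fixes f :: "'a::euclidean_space \<Rightarrow> 'b::euclidean_space"
  assumes [measurable]: "f \<in> borel_measurable borel" "W \<in> borel_measurable borel"
    and W: "\<And>x. 0 \<le> W x" "\<And>R. (\<integral>\<^sup>+x. ennreal (W x) * indicator (cball 0 R) x \<partial>lborel) < \<infinity>"
    and q: "0 < q" and M: "\<And>x. norm (f x) \<le> M" and R: "\<And>x. x \<notin> cball 0 R \<Longrightarrow> f x = 0" and e: "0 < (e::ennreal)"
  obtains g where "continuous_on UNIV g" "\<And>x. x \<notin> cball 0 (R + 1) \<Longrightarrow> g x = 0"
    "(\<integral>\<^sup>+x. ennreal (norm (f x - g x) powr q * W x) \<partial>lborel) < e"
proof -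
  have M0: "0 \<le> M" using M[of 0] norm_ge_zero[of "f 0"] by linarith
  have "f \<in> borel_measurable lebesgue" by (simp add: measurable_completion)
  then have "f measurable_on UNIV"
    by (simp add: measurable_on_iff_borel_measurable)
  then obtain N g where N: "negligible N" and g: "\<And>n. continuous_on UNIV (g n)"
    and lim: "\<And>x. x \<notin> N \<Longrightarrow> (\<lambda>n. g n x) \<longlonglongrightarrow> f x"
    unfolding measurable_on_def by auto
  \<comment> \<open>The nearest point of the closed ball of radius M: a continuous truncation that
    leaves values of norm at most M unchanged.\<close>
  define P where "P = closest_point (cball (0::'b) M)"
  have P: "continuous_on UNIV P" "\<And>y. norm (P y) \<le> M" "\<And>y. norm y \<le> M \<Longrightarrow> P y = y"
  proof -
    show "continuous_on UNIV P" unfolding P_def using M0 by (intro continuous_on_closest_point) auto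
    show "norm (P y) \<le> M" for y
      using closest_point_in_set[of "cball (0::'b) M" y] M0 by (auto simp: P_def)
    show "P y = y" if "norm y \<le> M" for y unfolding P_def using that by (intro closest_point_self) auto
  qed
  \<comment> \<open>A continuous cutoff, 1 on the ball of radius R and 0 off the ball of radius R +
    1; the enlargement of the support comes from here.\<close>
  define ct where "ct x = max 0 (min 1 (R + 1 - norm x))" for x :: 'a
  define G where "G n x = ct x *\<^sub>R P (g n x)" for n x
  have ct: "continuous_on UNIV ct" "\<And>x. 0 \<le> ct x" "\<And>x. ct x \<le> 1" "\<And>x. x \<notin> cball 0 (R + 1) \<Longrightarrow> ct x = 0"
    "\<And>x. x \<in> cball 0 R \<Longrightarrow> ct x = 1"
    unfolding ct_def by (auto intro!: continuous_intros)
  have Gc: "continuous_on UNIV (G n)" for n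
    unfolding G_def by (intro continuous_on_scaleR ct continuous_on_compose2[OF P(1) g]) auto
  then have [measurable]: "G n \<in> borel_measurable borel" for n by (rule borel_measurable_continuous_onI)
  have GM: "norm (G n x) \<le> M" for n x
    unfolding G_def using mult_mono[OF ct(3) P(2), of "g n x" x] ct(2)[of x] M0 by simp
  have "(\<lambda>n. \<integral>\<^sup>+x. ennreal (norm (f x - G n x) powr q * W x) \<partial>lborel) \<longlonglongrightarrow> (\<integral>\<^sup>+x. 0 \<partial>(lborel::'a measure))"
  proof (rule nn_integral_dominated_convergence[where w = "\<lambda>x. ennreal ((2 * M) powr q) * (ennreal (W x) * indicator (cball 0 (R + 1)) x)"])
    show "(\<integral>\<^sup>+x. ennreal ((2 * M) powr q) * (ennreal (W x) * indicator (cball 0 (R + 1)) x) \<partial>lborel) < \<infinity>"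
    proof -
      have [measurable]: "cball (0::'a) (R + 1) \<in> sets borel" by simp
      have [measurable]: "(\<lambda>x. ennreal (W x) * indicator (cball 0 (R + 1)) x) \<in> borel_measurable lborel"
        by measurable
      show ?thesis using W(2)[of "R + 1"] by (simp add: nn_integral_cmult ennreal_mult_less_top)
    qed
    show "AE x in lborel. ennreal (norm (f x - G n x) powr q * W x)
        \<le> ennreal ((2 * M) powr q) * (ennreal (W x) * indicator (cball 0 (R + 1)) x)" for n
    proof (rule AE_I2)
      fix x
      show "ennreal (norm (f x - G n x) powr q * W x)
        \<le> ennreal ((2 * M) powr q) * (ennreal (W x) * indicator (cball 0 (R + 1)) x)"
      proof (cases "x \<in> cball 0 (R + 1)")
        case True
        have "norm (f x - G n x) \<le> 2 * M" using norm_triangle_ineq4[of "f x" "G n x"] M[of x] GM[of n x] by linarith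
        then have "norm (f x - G n x) powr q * W x \<le> (2 * M) powr q * W x"
          using q W(1)[of x] by (intro mult_right_mono powr_mono2) auto
        then show ?thesis using True W(1)[of x] by (simp add: ennreal_mult'[symmetric] ennreal_leI)
      next
        case False
        then have "f x = 0" using R by auto
        moreover have "G n x = 0" using False ct(4) by (simp add: G_def)
        ultimately show ?thesis using q by simp
      qed
    qed
    show "AE x in lborel. (\<lambda>n. ennreal (norm (f x - G n x) powr q * W x)) \<longlonglongrightarrow> 0"
    proof (rule AE_lborel_of_negligible[OF N])
      fix x assume "x \<notin> N"
      then have "(\<lambda>n. P (g n x)) \<longlonglongrightarrow> P (f x)"
        by (intro continuous_on_tendsto_compose[OF P(1) lim]) auto
      then have "(\<lambda>n. G n x) \<longlonglongrightarrow> ct x *\<^sub>R P (f x)" unfolding G_def by (intro tendsto_intros)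
      also have "ct x *\<^sub>R P (f x) = f x"
        using P(3)[OF M[of x]] R[of x] ct(5)[of x] by (cases "x \<in> cball 0 R") auto
      finally have "(\<lambda>n. f x - G n x) \<longlonglongrightarrow> f x - f x" by (intro tendsto_diff tendsto_const)
      then have "(\<lambda>n. norm (f x - G n x)) \<longlonglongrightarrow> 0" by (intro tendsto_norm_zero) simp
      then have "(\<lambda>n. norm (f x - G n x) powr q) \<longlonglongrightarrow> 0"
        by (rule tendsto_zero_powrI[OF _ tendsto_const]) (use q in auto)
      from tendsto_ennrealI[OF tendsto_mult_left_zero[OF this, of "W x"]]
      show "(\<lambda>n. ennreal (norm (f x - G n x) powr q * W x)) \<longlonglongrightarrow> 0" by simp
    qed
    have [measurable]: "cball (0::'a) (R + 1) \<in> sets borel" by simp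
    show "(\<lambda>x. ennreal ((2 * M) powr q) * (ennreal (W x) * indicator (cball 0 (R + 1)) x)) \<in> borel_measurable lborel"
      by measurable
    show "(\<lambda>x. ennreal (norm (f x - G n x) powr q * W x)) \<in> borel_measurable lborel" for n
      by measurable
  qed simp
  then have "eventually (\<lambda>n. (\<integral>\<^sup>+x. ennreal (norm (f x - G n x) powr q * W x) \<partial>lborel) < e) sequentially"
    using e by (intro order_tendstoD(2)[where a = e]) auto
  then obtain n where n: "(\<integral>\<^sup>+x. ennreal (norm (f x - G n x) powr q * W x) \<partial>lborel) < e" by (auto simp: eventually_sequentially)
  show ?thesis by (rule that[OF Gc _ n]) (simp add: G_def ct(4) del: mem_cball)
qed

lemma continuous_approx_Lq:
  fixes f :: "'a::euclidean_space \<Rightarrow> 'b::euclidean_space"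
  assumes [measurable]: "f \<in> borel_measurable borel" "W \<in> borel_measurable borel"
    and W: "\<And>x. 0 \<le> W x" "\<And>R. (\<integral>\<^sup>+x. ennreal (W x) * indicator (cball 0 R) x \<partial>lborel) < \<infinity>"
    and q: "0 < q" and f: "(\<integral>\<^sup>+x. ennreal (norm (f x) powr q * W x) \<partial>lborel) < \<infinity>"
    and R: "\<And>x. x \<notin> cball 0 R \<Longrightarrow> f x = 0" and e: "0 < (e::real)"
  obtains g where "continuous_on UNIV g" "\<And>x. x \<notin> cball 0 (R + 1) \<Longrightarrow> g x = 0"
    "(\<integral>\<^sup>+x. ennreal (norm (f x - g x) powr q * W x) \<partial>lborel) \<le> ennreal e"
proof -
  \<comment> \<open>Of the three terms below one is 0 and two are at most d, all multiplied by
    \<open>3 powr q\<close>.\<close>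
  define d where "d = e / (2 * 3 powr q)"
  have d: "0 < d" using e by (simp add: d_def)
  obtain n :: nat where n: "(\<integral>\<^sup>+x. ennreal (norm (f x - (if norm (f x) \<le> real n then f x else 0)) powr q * W x) \<partial>lborel) < ennreal d"
    using bounded_approx_Lq[of f lborel W q "ennreal d"] q f d by auto
  define F where "F x = (if norm (f x) \<le> real n then f x else 0)" for x
  have [measurable]: "F \<in> borel_measurable borel" unfolding F_def by measurable
  have "norm (F x) \<le> real n" "x \<notin> cball 0 R \<Longrightarrow> F x = 0" for x using R by (auto simp: F_def)
  then obtain g where g: "continuous_on UNIV g" "\<And>x. x \<notin> cball 0 (R + 1) \<Longrightarrow> g x = 0"
    "(\<integral>\<^sup>+x. ennreal (norm (F x - g x) powr q * W x) \<partial>lborel) < ennreal d"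
    using continuous_approx_bounded[of F W q n R "ennreal d"] W q d by auto
  have [measurable]: "g \<in> borel_measurable borel" using g(1) by (rule borel_measurable_continuous_onI)
  have "(\<integral>\<^sup>+x. ennreal (norm ((f x - F x) + (F x - g x) + 0) powr q * W x) \<partial>lborel)
     \<le> ennreal (3 powr q) * ((\<integral>\<^sup>+x. ennreal (norm (f x - F x) powr q * W x) \<partial>lborel) + 
        (\<integral>\<^sup>+x. ennreal (norm (F x - g x) powr q * W x) \<partial>lborel) + (\<integral>\<^sup>+x. ennreal (norm (0::'b) powr q * W x) \<partial>lborel))"
    by (rule nn_integral_add3_le) (use W q in auto)
  also have "\<dots> \<le> ennreal (3 powr q) * (ennreal d + ennreal d + 0)"
    using n g(3) q unfolding F_def[symmetric] by (intro mult_left_mono add_mono) auto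
  also have "\<dots> = ennreal e"
    using d by (simp add: ennreal_plus[symmetric] ennreal_mult'[symmetric] d_def del: ennreal_plus)
  finally show ?thesis using that[OF g(1,2)] by simp
qed

lemma moll_continuous_uniform:
  fixes g :: "'a::euclidean_space \<Rightarrow> 'b::euclidean_space"
  assumes g: "continuous_on UNIV g" and R: "\<And>x. x \<notin> cball 0 R \<Longrightarrow> g x = 0" and \<omega>: "0 < \<omega>"
  shows "eventually (\<lambda>\<epsilon>. \<forall>x. norm (moll \<epsilon> g x - g x) \<le> \<omega> * indicator (cball 0 (R + 1)) x) (at_right 0)"
proof -
  have gi: "integrable lborel g" by (rule integrable_compact_support[OF g, of "cball 0 R"]) (use R in auto)
  \<comment> \<open>For x in the ball of radius R + 1 and \<epsilon> < 1, the averaging never leaves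
    the ball of radius R + 2.\<close>
  have "uniformly_continuous_on (cball 0 (R + 2)) g"
    by (intro compact_uniformly_continuous continuous_on_subset[OF g]) auto
  then obtain d where d: "0 < d" "\<And>x y. x \<in> cball 0 (R + 2) \<Longrightarrow> y \<in> cball 0 (R + 2) \<Longrightarrow> dist y x < d \<Longrightarrow> dist (g y) (g x) < \<omega>"
    using \<omega> unfolding uniformly_continuous_on_def by metis
  have "norm (moll \<epsilon> g x - g x) \<le> \<omega> * indicator (cball 0 (R + 1)) x" if \<epsilon>: "0 < \<epsilon>" "\<epsilon> < min 1 d" for \<epsilon> x
  proof (cases "x \<in> cball 0 (R + 1)")
    case True
    have "norm (moll \<epsilon> g x - g x) \<le> (LINT y|lborel. mker \<epsilon> (x - y) * norm (g y - g x))"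
      by (rule moll_minus_self[OF \<epsilon>(1) gi])
    also have "\<dots> \<le> (LINT y|lborel. mker \<epsilon> (x - y) * \<omega>)"
    proof (rule integral_mono)
      show "mker \<epsilon> (x - y) * norm (g y - g x) \<le> mker \<epsilon> (x - y) * \<omega>" for y
      proof (cases "\<epsilon> \<le> norm (x - y)")
        case True then show ?thesis using mker_eq_0[OF \<epsilon>(1), of "x - y"] by simp
      next
        case False
        then have "norm y \<le> R + 2" "dist y x < d" "norm x \<le> R + 2"
          using True \<epsilon> norm_triangle_sub[of y x] by (auto simp: dist_norm norm_minus_commute)
        then have "norm (g y - g x) \<le> \<omega>" using d(2)[of x y] by (auto simp: dist_norm)
        then show ?thesis using mker_nonneg[OF \<epsilon>(1), of "x - y"] by (intro mult_left_mono) auto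
      qed
    qed (use moll_minus_self(2)[OF \<epsilon>(1) gi] mker_integral(2)[OF \<epsilon>(1)] in auto)
    also have "\<dots> = \<omega>" using mker_integral(1,2)[OF \<epsilon>(1), of x] by simp
    finally show ?thesis using True by simp
  next
    case False
    have "moll \<epsilon> g x = 0"
    proof (rule moll_eq_0[OF \<epsilon>(1)])
      fix y assume "y \<in> ball x \<epsilon>"
      then show "g y = 0" using False \<epsilon> norm_triangle_sub[of x y] by (intro R) (auto simp: dist_norm)
    qed
    moreover have "g x = 0" using False by (intro R) auto
    ultimately show ?thesis using False by simp
  qed
  then show ?thesis using d(1) unfolding eventually_at_right_field by (intro exI[of _ "min 1 d"]) auto
qed

text \<open>A density argument: mollification converges uniformly on continuous functions of compact
  support, and by \<open>bound\<close> it is bounded in L^q(W) uniformly in the radius, so the error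
  of approximating f by such a function survives mollification up to the factor C.\<close>

lemma moll_tendsto_Lq:
  fixes f :: "'a::euclidean_space \<Rightarrow> 'b::euclidean_space"
  assumes [measurable]: "W \<in> borel_measurable borel"
    and W: "\<And>x. 0 \<le> W x" "\<And>R. (\<integral>\<^sup>+x. ennreal (W x) * indicator (cball 0 R) x \<partial>lborel) < \<infinity>"
    and q: "0 < q" and fi: "integrable lborel f" and f: "(\<integral>\<^sup>+x. ennreal (norm (f x) powr q * W x) \<partial>lborel) < \<infinity>"
    and R: "\<And>x. x \<notin> cball 0 R \<Longrightarrow> f x = 0" and C: "0 \<le> C"
    and bound: "\<And>\<epsilon> h::'a \<Rightarrow> 'b. 0 < \<epsilon> \<Longrightarrow> integrable lborel h \<Longrightarrow>
       (\<integral>\<^sup>+x. ennreal (norm (moll \<epsilon> h x) powr q * W x) \<partial>lborel) \<le> ennreal C * (\<integral>\<^sup>+x. ennreal (norm (h x) powr q * W x) \<partial>lborel)"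
  shows "((\<lambda>\<epsilon>. \<integral>\<^sup>+x. ennreal (norm (moll \<epsilon> f x - f x) powr q * W x) \<partial>lborel) \<longlongrightarrow> 0) (at_right 0)"
proof (rule order_tendstoI)
  fix a :: ennreal assume "0 < a"
  then obtain b where "0 < b" "b < a" using dense by blast
  then obtain \<eta> where \<eta>: "0 < \<eta>" "ennreal \<eta> < a"
    by (cases b) (auto simp: ennreal_less_zero_iff)
  have [measurable]: "f \<in> borel_measurable borel" using fi by auto
  \<comment> \<open>With the outer factor \<open>3 powr q\<close>, the mollified difference
    contributes C shares of \<eta>/D and each of the two other terms one share; together they make
    \<eta>.\<close>
  define D where "D = 3 powr q * (C + 2)"
  have D: "0 < D" using C by (auto simp: D_def)
  obtain g where g: "continuous_on UNIV g" "\<And>x. x \<notin> cball 0 (R + 1) \<Longrightarrow> g x = 0"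
    "(\<integral>\<^sup>+x. ennreal (norm (f x - g x) powr q * W x) \<partial>lborel) \<le> ennreal (\<eta> / D)"
    using continuous_approx_Lq[of f W q R "\<eta> / D"] W q f R \<eta> D by auto
  have [measurable]: "g \<in> borel_measurable borel" using g(1) by (rule borel_measurable_continuous_onI)
  have gi: "integrable lborel g" by (rule integrable_compact_support[OF g(1), of "cball 0 (R + 1)"]) (use g(2) in auto)
  obtain w where w: "0 \<le> w" "(\<integral>\<^sup>+x. ennreal (W x) * indicator (cball 0 (R + 2)) x \<partial>lborel) = ennreal w"
    using W(2)[of "R + 2"] by (cases "\<integral>\<^sup>+x. ennreal (W x) * indicator (cball 0 (R + 2)) x \<partial>lborel") auto
  \<comment> \<open>Chosen so that \<omega>^q times w, the integral of W over the ball, stays below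
    \<eta>/D; w + 1 avoids a vanishing denominator.\<close>
  define \<omega> where "\<omega> = (\<eta> / D / (w + 1)) powr (1 / q)"
  have \<omega>: "0 < \<omega>" "\<omega> powr q = \<eta> / D / (w + 1)" using \<eta> D w q by (auto simp: \<omega>_def powr_powr)
  have "eventually (\<lambda>\<epsilon>. \<forall>x. norm (moll \<epsilon> g x - g x) \<le> \<omega> * indicator (cball 0 (R + 1 + 1)) x) (at_right 0)"
    by (rule moll_continuous_uniform[OF g(1,2) \<omega>(1)])
  moreover have "eventually (\<lambda>\<epsilon>. 0 < (\<epsilon>::real)) (at_right 0)" by (simp add: eventually_at_right_less)
  ultimately show "eventually (\<lambda>\<epsilon>. (\<integral>\<^sup>+x. ennreal (norm (moll \<epsilon> f x - f x) powr q * W x) \<partial>lborel) < a) (at_right 0)"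
  proof eventually_elim
    case (elim \<epsilon>)
    have m: "moll \<epsilon> f x - f x = moll \<epsilon> (\<lambda>y. f y - g y) x + (moll \<epsilon> g x - g x) + (g x - f x)" for x
      unfolding moll_diff[OF elim(2) fi gi] by simp
    have "(\<integral>\<^sup>+x. ennreal (norm (moll \<epsilon> f x - f x) powr q * W x) \<partial>lborel) \<le> ennreal (3 powr q) *
     ((\<integral>\<^sup>+x. ennreal (norm (moll \<epsilon> (\<lambda>y. f y - g y) x) powr q * W x) \<partial>lborel)
      + (\<integral>\<^sup>+x. ennreal (norm (moll \<epsilon> g x - g x) powr q * W x) \<partial>lborel)
      + (\<integral>\<^sup>+x. ennreal (norm (g x - f x) powr q * W x) \<partial>lborel))"
      unfolding m by (rule nn_integral_add3_le) (use W q in auto)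
    also have "\<dots> \<le> ennreal (3 powr q) * (ennreal C * ennreal (\<eta> / D) + ennreal (\<eta> / D) + ennreal (\<eta> / D))"
    proof (intro mult_left_mono add_mono)
      show "(\<integral>\<^sup>+x. ennreal (norm (moll \<epsilon> (\<lambda>y. f y - g y) x) powr q * W x) \<partial>lborel) \<le> ennreal C * ennreal (\<eta> / D)"
        by (rule order_trans[OF bound mult_left_mono[OF g(3)]]) (use elim fi gi in auto)
      show "(\<integral>\<^sup>+x. ennreal (norm (g x - f x) powr q * W x) \<partial>lborel) \<le> ennreal (\<eta> / D)"
        using g(3) by (simp add: norm_minus_commute)
      have "(\<integral>\<^sup>+x. ennreal (norm (moll \<epsilon> g x - g x) powr q * W x) \<partial>lborel)
         \<le> (\<integral>\<^sup>+x. ennreal (\<omega> powr q) * (ennreal (W x) * indicator (cball 0 (R + 2)) x) \<partial>lborel)"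
      proof (rule nn_integral_mono)
        fix x
        show "ennreal (norm (moll \<epsilon> g x - g x) powr q * W x) \<le> ennreal (\<omega> powr q) * (ennreal (W x) * indicator (cball 0 (R + 2)) x)"
        proof (cases "x \<in> cball 0 (R + 2)")
          case True
          then have "norm (moll \<epsilon> g x - g x) \<le> \<omega>" using elim(1)[rule_format, of x] by (simp add: add.assoc)
          then have "norm (moll \<epsilon> g x - g x) powr q * W x \<le> \<omega> powr q * W x"
            using q W(1)[of x] by (intro mult_right_mono powr_mono2) auto
          then show ?thesis using True W(1)[of x] by (simp add: ennreal_mult'[symmetric] ennreal_leI)
        next
          case False
          then have "norm (moll \<epsilon> g x - g x) = 0" using elim(1)[rule_format, of x] by (simp add: add.assoc)
          then show ?thesis using q by simp
        qed
      qed
      also have "\<dots> = ennreal (\<omega> powr q * w)"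
      proof -
      have [measurable]: "cball (0::'a) (R + 2) \<in> sets borel" by simp
      have [measurable]: "(\<lambda>x. ennreal (W x) * indicator (cball 0 (R + 2)) x) \<in> borel_measurable lborel"
          by measurable
        show ?thesis using w by (simp add: nn_integral_cmult ennreal_mult')
      qed
      also have "\<dots> \<le> ennreal (\<eta> / D)"
      proof (rule ennreal_leI)
        have "\<eta> / D * (w / (w + 1)) \<le> \<eta> / D" using w \<eta> D by (intro mult_left_le) (auto simp: divide_le_eq)
        then show "\<omega> powr q * w \<le> \<eta> / D" unfolding \<omega> by simp
      qed
      finally show "(\<integral>\<^sup>+x. ennreal (norm (moll \<epsilon> g x - g x) powr q * W x) \<partial>lborel) \<le> ennreal (\<eta> / D)" .
    qed auto
    also have "\<dots> = ennreal (3 powr q * (C * (\<eta> / D) + \<eta> / D + \<eta> / D))"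
      using C \<eta> D by (simp add: ennreal_plus[symmetric] ennreal_mult'[symmetric] del: ennreal_plus)
    also have "3 powr q * (C * (\<eta> / D) + \<eta> / D + \<eta> / D) = \<eta>"
    proof -
      have "3 powr q * (C * x + x + x) = D * x" for x unfolding D_def by (simp add: algebra_simps)
      from this[of "\<eta> / D"] show ?thesis using D by simp
    qed
    finally show ?case using \<eta>(2) by simp
  qed
qed simp

lemma moll_tendsto_L1:
  fixes f :: "'a::euclidean_space \<Rightarrow> 'b::euclidean_space"
  assumes fi: "integrable lborel f" and R: "\<And>x. x \<notin> cball 0 R \<Longrightarrow> f x = 0"
  shows "((\<lambda>\<epsilon>. \<integral>\<^sup>+x. ennreal (norm (moll \<epsilon> f x - f x)) \<partial>lborel) \<longlongrightarrow> 0) (at_right 0)"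
proof -
  have "((\<lambda>\<epsilon>. \<integral>\<^sup>+x. ennreal (norm (moll \<epsilon> f x - f x) powr 1 * 1) \<partial>lborel) \<longlongrightarrow> 0) (at_right 0)"
  proof (rule moll_tendsto_Lq[where R = R and C = 1])
    show "(\<integral>\<^sup>+x. ennreal 1 * indicator (cball (0::'a) R) x \<partial>lborel) < \<infinity>" for R
      using emeasure_lborel_cball_finite[of "0::'a" R] by simp
    show "(\<integral>\<^sup>+x. ennreal (norm (f x) powr 1 * 1) \<partial>lborel) < \<infinity>"
      using fi by (simp add: integrable_iff_bounded)
    show "(\<integral>\<^sup>+x. ennreal (norm (moll \<epsilon> h x) powr 1 * 1) \<partial>lborel) \<le> ennreal 1 * (\<integral>\<^sup>+x. ennreal (norm (h x) powr 1 * 1) \<partial>lborel)"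
      if "0 < \<epsilon>" "integrable lborel h" for \<epsilon> and h :: "'a \<Rightarrow> 'b"
      using nn_moll_L1[OF that] by simp
  qed (use assms in auto)
  then show ?thesis by simp
qed

section \<open>The fundamental lemma of the calculus of variations\<close>

text \<open>Testing with bumps centred at x shows that mollifications of f of small radius vanish
  near a given point, while they also converge to f in L^1. Countably many balls suffice by
  Lindelof's theorem.\<close>

lemma fundamental_lemma:
  fixes f :: "'a::euclidean_space \<Rightarrow> real"
  assumes \<Omega>: "open \<Omega>" and [measurable]: "f \<in> borel_measurable borel"
    and f: "\<And>K. compact K \<Longrightarrow> K \<subseteq> \<Omega> \<Longrightarrow> set_integrable lborel K f"
    and ort: "\<And>\<phi>. \<phi> \<in> test_functions \<Omega> \<Longrightarrow> (LINT x|lborel. f x * \<phi> x) = 0"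
  shows "AE x in lborel. x \<in> \<Omega> \<longrightarrow> f x = 0"
proof -
  have loc: "AE x in lborel. x \<in> ball x0 r \<longrightarrow> f x = 0" if r: "0 < r" "cball x0 (2 * r) \<subseteq> \<Omega>" for x0 r
  proof -
    \<comment> \<open>Cutting at radius 2r makes f integrable over the whole space; for x in the
      ball of radius r and \<epsilon> < r the mollification does not see the cut.\<close>
    define F where "F x = indicator (cball x0 (2 * r)) x *\<^sub>R f x" for x
    have Fi: "integrable lborel F" using f[of "cball x0 (2 * r)"] r by (simp add: F_def[abs_def] set_integrable_def)
    then have [measurable]: "F \<in> borel_measurable borel" by auto
    have F0: "F x = 0" if "x \<notin> cball 0 (norm x0 + 2 * r)" for x
    proof -
      have "x \<notin> cball x0 (2 * r)" using that norm_triangle_sub[of x x0] by (auto simp: dist_norm norm_minus_commute)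
      then show ?thesis by (simp add: F_def)
    qed
    have moll0: "moll \<epsilon> F x = 0" if \<epsilon>: "0 < \<epsilon>" "\<epsilon> < r" and x: "x \<in> ball x0 r" for \<epsilon> x
    proof -
      have sub: "cball x \<epsilon> \<subseteq> cball x0 (2 * r)"
      proof
        fix y assume "y \<in> cball x \<epsilon>"
        then show "y \<in> cball x0 (2 * r)" using x \<epsilon> dist_triangle[of x0 y x] by auto
      qed
      have "mker \<epsilon> (x - y) *\<^sub>R F y = f y * bump x \<epsilon> y / moll_mass TYPE('a) \<epsilon>" for y
      proof (cases "y \<in> cball x0 (2 * r)")
        case True then show ?thesis by (simp add: F_def mker_def bump_reflect[of x])
      next
        case False
        then have "y \<notin> ball x \<epsilon>" using sub ball_subset_cball[of x \<epsilon>] by blast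
        then show ?thesis using bump_eq_0[OF \<epsilon>(1), of y x] False by (simp add: F_def)
      qed
      then have "moll \<epsilon> F x = (LINT y|lborel. f y * bump x \<epsilon> y) / moll_mass TYPE('a) \<epsilon>"
        unfolding moll_def by simp
      also have "(LINT y|lborel. f y * bump x \<epsilon> y) = 0"
        using sub r by (intro ort bump_test_function \<epsilon>) auto
      finally show ?thesis by simp
    qed
    let ?I = "\<integral>\<^sup>+x. ennreal (norm (F x)) * indicator (ball x0 r) x \<partial>lborel"
    have "?I \<le> 0"
    proof (rule tendsto_lowerbound[OF moll_tendsto_L1[OF Fi F0]])
      show "eventually (\<lambda>\<epsilon>. ?I \<le> (\<integral>\<^sup>+x. ennreal (norm (moll \<epsilon> F x - F x)) \<partial>lborel)) (at_right 0)"
        unfolding eventually_at_right_field using r(1) moll0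
        by (intro exI[of _ r]) (auto intro!: nn_integral_mono simp: indicator_def)
    qed auto
    moreover have [measurable]: "ball x0 r \<in> sets borel" by simp
    ultimately have "AE x in lborel. ennreal (norm (F x)) * indicator (ball x0 r) x = 0"
      by (subst (asm) le_zero_eq, subst (asm) nn_integral_0_iff_AE) auto
    then show ?thesis
      by eventually_elim (use r in \<open>auto simp: F_def indicator_def split: if_splits\<close>)
  qed
  define \<F> where "\<F> = {ball x0 r | x0 r. 0 < r \<and> cball x0 (2 * r) \<subseteq> \<Omega>}"
  have U: "\<Union>\<F> = \<Omega>"
  proof
    show "\<Union>\<F> \<subseteq> \<Omega>" unfolding \<F>_def by (fastforce simp: subset_iff)
    show "\<Omega> \<subseteq> \<Union>\<F>"
    proof
      fix x assume "x \<in> \<Omega>"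
      then obtain e where "0 < e" "cball x e \<subseteq> \<Omega>" using \<Omega> open_contains_cball by blast
      then have "ball x (e / 2) \<in> \<F>" unfolding \<F>_def by (auto intro!: exI[of _ x] exI[of _ "e / 2"])
      then show "x \<in> \<Union>\<F>" using \<open>0 < e\<close> by (intro UnionI[of "ball x (e / 2)"]) auto
    qed
  qed
  obtain \<F>' where \<F>': "\<F>' \<subseteq> \<F>" "countable \<F>'" "\<Union>\<F>' = \<Union>\<F>"
    using Lindelof[of \<F>] unfolding \<F>_def by auto
  have "AE x in lborel. \<forall>S\<in>\<F>'. x \<in> S \<longrightarrow> f x = 0"
    unfolding AE_ball_countable[OF \<F>'(2)] using loc \<F>'(1) by (auto simp: \<F>_def)
  then show ?thesis by eventually_elim (use \<F>'(3) U in blast)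
qed

section \<open>Muckenhoupt weights and mollification\<close>

text \<open>Write S and V for the integrals of W^(-1/(p-1)) and of W over balls. Hoelder's
  inequality bounds the p-th power of the mollification at x by the integral of |h|^p W over the
  ball about x, times S(x)^(p-1) and a power of the volume. After Tonelli's theorem, each y carries
  the integral of S(x)^(p-1) W(x) over x within \<epsilon> of y. There S(x) is at most S at y for
  the radius 2\<epsilon>, so this integral is at most S(y)^(p-1) V(y), to which the A_p condition
  for the single ball of radius 2\<epsilon> about y applies.\<close>

lemma Ap_moll_bound:
  fixes W :: "'a::euclidean_space \<Rightarrow> real"
  assumes p: "1 < p" and [measurable]: "W \<in> borel_measurable borel" and W: "\<And>x. 0 < W x"
    and Wi: "\<And>x r. 0 < r \<Longrightarrow> set_integrable lborel (ball x r) W"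
    and Si: "\<And>x r. 0 < r \<Longrightarrow> set_integrable lborel (ball x r) (\<lambda>y. W y powr (- 1 / (p - 1)))"
    and Ap: "\<And>x r. 0 < r \<Longrightarrow> (1 / measure lborel (ball x r) * (LINT y:ball x r|lborel. W y)) *
      (1 / measure lborel (ball x r) * (LINT y:ball x r|lborel. W y powr (- 1 / (p - 1)))) powr (p - 1) \<le> c"
  shows "\<exists>C\<ge>0. \<forall>\<epsilon>>0. \<forall>h::'a \<Rightarrow> 'b::euclidean_space. integrable lborel h \<longrightarrow>
    (\<integral>\<^sup>+x. ennreal (norm (moll \<epsilon> h x) powr p * W x) \<partial>lborel)
      \<le> ennreal C * (\<integral>\<^sup>+x. ennreal (norm (h x) powr p * W x) \<partial>lborel)"
proof -
  \<comment> \<open>Membership in the ball is written as a condition on \<open>dist x y\<close>, so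
    that measurability in x follows from joint measurability.\<close>
  define S where "S r x = (LINT y|lborel. (if dist x y < r then W y powr (- 1 / (p - 1)) else 0))" for r x
  define V where "V r x = (LINT y|lborel. (if dist x y < r then W y else 0))" for r x
  have SV: "S r x = (LINT y:ball x r|lborel. W y powr (- 1 / (p - 1)))" "V r x = (LINT y:ball x r|lborel. W y)" for r x
    unfolding S_def V_def set_lebesgue_integral_def
    by (auto intro!: Bochner_Integration.integral_cong simp: indicator_def)
  have SVi: "integrable lborel (\<lambda>y. if dist x y < r then W y powr (- 1 / (p - 1)) else 0)"
    "integrable lborel (\<lambda>y. if dist x y < r then W y else 0)" if "0 < r" for x r
  proof -
    have "(\<lambda>y. if dist x y < r then g y else 0) = (\<lambda>y. indicator (ball x r) y *\<^sub>R g y)" for g :: "'a \<Rightarrow> real"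
      by (auto simp: indicator_def)
    then show "integrable lborel (\<lambda>y. if dist x y < r then W y powr (- 1 / (p - 1)) else 0)"
      "integrable lborel (\<lambda>y. if dist x y < r then W y else 0)"
      using Wi[OF that, of x] Si[OF that, of x] unfolding set_integrable_def by simp_all
  qed
  have S0: "0 \<le> S r x" for r x unfolding S_def by (auto intro!: integral_nonneg_AE)
  have [measurable]: "S r \<in> borel_measurable borel" for r
    unfolding S_def[abs_def] by measurable
  \<comment> \<open>One factor 2^N, N the dimension, comes from \<open>mker_le\<close>, the other
    from comparing the balls of radius 2\<epsilon> and \<epsilon>; no volume is left in their
    product. In the next line \<open>max 0 c\<close> makes the constant nonnegative.\<close>
  define K :: real where "K = exp (4 / 3) * 4 ^ DIM('a)"
  define C where "C = K powr p * max 0 c"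
  have C: "0 \<le> C" by (simp add: C_def)
  have "(\<integral>\<^sup>+x. ennreal (norm (moll \<epsilon> h x) powr p * W x) \<partial>lborel)
      \<le> ennreal C * (\<integral>\<^sup>+x. ennreal (norm (h x) powr p * W x) \<partial>lborel)"
    if \<epsilon>: "0 < \<epsilon>" and hi: "integrable lborel h" and fin: "(\<integral>\<^sup>+x. ennreal (norm (h x) powr p * W x) \<partial>lborel) < \<infinity>"
    for \<epsilon> and h :: "'a \<Rightarrow> 'b"
  proof -
    have [measurable]: "h \<in> borel_measurable borel" using hi by auto
    define k where "k y = norm (h y) powr p * W y" for y
    have k0: "0 \<le> k y" for y using W[of y] by (simp add: k_def)
    have [measurable]: "k \<in> borel_measurable borel" unfolding k_def by measurable
    have ki: "integrable lborel k"
      using fin k0 by (auto simp: integrable_iff_bounded k_def)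
    define M where "M = exp (4 / 3) * 2 ^ DIM('a) / measure lborel (ball (0::'a) \<epsilon>)"
    have Bpos: "0 < measure lborel (ball (x::'a) r)" if "0 < r" for x r using that by (simp add: content_ball_pos)
    have M0: "0 < M" using Bpos[OF \<epsilon>] by (simp add: M_def)
    define F where "F x = (LINT y|lborel. (if dist x y < \<epsilon> then k y else 0))" for x
    have F0: "0 \<le> F x" for x unfolding F_def using k0 by (auto intro!: integral_nonneg_AE)
    have Fint: "integrable lborel (\<lambda>y. if dist x y < \<epsilon> then k y else 0)" for x
      by (rule Bochner_Integration.integrable_bound[OF ki]) auto
    have step1: "norm (moll \<epsilon> h x) powr p \<le> M powr p * F x * S \<epsilon> x powr (p - 1)" for x
    proof -
      define q where "q = p / (p - 1)"
      have pq: "1 < p" "1 < q" "1 / p + 1 / q = 1" "1 / q = (p - 1) / p"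
        using p by (auto simp: q_def field_simps)
      \<comment> \<open>The factorization h = (h W^(1/p)) W^(-1/p), restricted to the ball; the q-th
        power of the second factor is the dual weight W^(-1/(p-1)).\<close>
      define a where "a y = (if dist x y < \<epsilon> then norm (h y) * W y powr (1 / p) else 0)" for y
      define b where "b y = (if dist x y < \<epsilon> then W y powr (- 1 / p) else 0)" for y
      have [measurable]: "a \<in> borel_measurable borel" "b \<in> borel_measurable borel" unfolding a_def b_def by measurable
      have ap: "\<bar>a y\<bar> powr p = (if dist x y < \<epsilon> then k y else 0)" for y
        using p W[of y] by (auto simp: a_def k_def powr_mult powr_powr)
      have bq: "\<bar>b y\<bar> powr q = (if dist x y < \<epsilon> then W y powr (- 1 / (p - 1)) else 0)" for y
        using p W[of y] by (auto simp: b_def q_def powr_powr)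
      have ab: "a y * b y = (if dist x y < \<epsilon> then norm (h y) else 0)" for y
      proof -
        have "W y powr (1 / p) * W y powr (- 1 / p) = 1"
          using W[of y] by (simp add: powr_add[symmetric])
        then show ?thesis by (simp add: a_def b_def)
      qed
      have "norm (moll \<epsilon> h x) \<le> (LINT y|lborel. mker \<epsilon> (x - y) * norm (h y))"
        by (rule norm_moll_le[OF \<epsilon> hi])
      also have "\<dots> \<le> (LINT y|lborel. M * (if dist x y < \<epsilon> then norm (h y) else 0))"
      proof (rule integral_mono)
        show "integrable lborel (\<lambda>y. mker \<epsilon> (x - y) * norm (h y))"
          using moll_integrable[OF \<epsilon> integrable_norm[OF hi]] by simp
        show "integrable lborel (\<lambda>y. M * (if dist x y < \<epsilon> then norm (h y) else 0))"
          by (intro integrable_mult_right Bochner_Integration.integrable_bound[OF hi]) auto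
        show "mker \<epsilon> (x - y) * norm (h y) \<le> M * (if dist x y < \<epsilon> then norm (h y) else 0)" for y
          using mult_right_mono[OF mker_le[OF \<epsilon>, of "x - y"], of "norm (h y)"] mker_eq_0[OF \<epsilon>, of "x - y"]
          by (auto simp: M_def dist_norm)
      qed
      also have "\<dots> = M * (LINT y|lborel. \<bar>a y * b y\<bar>)" by (simp add: ab cong: if_cong)
      also have "\<dots> \<le> M * ((LINT y|lborel. \<bar>a y\<bar> powr p) powr (1/p) * (LINT y|lborel. \<bar>b y\<bar> powr q) powr (1/q))"
        using M0 by (intro mult_left_mono Hoelder[OF pq(1,2,3)]) (use SVi[OF \<epsilon>] Fint in \<open>auto simp: ap bq\<close>)
      also have "\<dots> = M * (F x powr (1 / p) * S \<epsilon> x powr ((p - 1) / p))"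
        unfolding ap bq pq(4) F_def S_def by simp
      finally have "norm (moll \<epsilon> h x) powr p \<le> (M * (F x powr (1 / p) * S \<epsilon> x powr ((p - 1) / p))) powr p"
        using p by (intro powr_mono2) auto
      also have "\<dots> = M powr p * F x * S \<epsilon> x powr (p - 1)"
        using M0 F0[of x] S0[of \<epsilon> x] p by (simp add: powr_mult powr_powr)
      finally show ?thesis .
    qed
    have "(\<integral>\<^sup>+x. ennreal (norm (moll \<epsilon> h x) powr p * W x) \<partial>lborel)
       \<le> (\<integral>\<^sup>+x. \<integral>\<^sup>+y. (if dist x y < \<epsilon> then ennreal (k y) else 0) * ennreal (M powr p * S \<epsilon> x powr (p - 1) * W x) \<partial>lborel \<partial>lborel)"
    proof (rule nn_integral_mono)
      fix x
      have "(\<integral>\<^sup>+y. (if dist x y < \<epsilon> then ennreal (k y) else 0) \<partial>lborel) = ennreal (F x)"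
        unfolding F_def using k0
        by (subst nn_integral_eq_integral[OF Fint, symmetric]) (auto intro!: nn_integral_cong)
      then have "(\<integral>\<^sup>+y. (if dist x y < \<epsilon> then ennreal (k y) else 0) * ennreal (M powr p * S \<epsilon> x powr (p - 1) * W x) \<partial>lborel)
        = ennreal (F x * (M powr p * S \<epsilon> x powr (p - 1) * W x))"
        using F0[of x] W[of x] by (subst nn_integral_multc) (auto simp: ennreal_mult')
      moreover have "norm (moll \<epsilon> h x) powr p * W x \<le> F x * (M powr p * S \<epsilon> x powr (p - 1) * W x)"
        using mult_right_mono[OF step1[of x], of "W x"] W[of x] by (simp add: mult_ac)
      ultimately show "ennreal (norm (moll \<epsilon> h x) powr p * W x)
       \<le> (\<integral>\<^sup>+y. (if dist x y < \<epsilon> then ennreal (k y) else 0) * ennreal (M powr p * S \<epsilon> x powr (p - 1) * W x) \<partial>lborel)"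
        by (simp add: ennreal_leI)
    qed
    also have "\<dots> = (\<integral>\<^sup>+y. \<integral>\<^sup>+x. (if dist x y < \<epsilon> then ennreal (k y) else 0) * ennreal (M powr p * S \<epsilon> x powr (p - 1) * W x) \<partial>lborel \<partial>lborel)"
      by (rule lborel_pair.Fubini') measurable
    also have "\<dots> \<le> (\<integral>\<^sup>+y. ennreal (k y) * ennreal C \<partial>lborel)"
    proof (rule nn_integral_mono)
      fix y :: 'a
      have "(\<integral>\<^sup>+x. (if dist x y < \<epsilon> then ennreal (k y) else 0) * ennreal (M powr p * S \<epsilon> x powr (p - 1) * W x) \<partial>lborel)
        \<le> (\<integral>\<^sup>+x. ennreal (k y) * ennreal (M powr p * S (2 * \<epsilon>) y powr (p - 1)) * ennreal (if dist y x < 2 * \<epsilon> then W x else 0) \<partial>lborel)"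
      proof (rule nn_integral_mono)
        fix x
        show "(if dist x y < \<epsilon> then ennreal (k y) else 0) * ennreal (M powr p * S \<epsilon> x powr (p - 1) * W x)
          \<le> ennreal (k y) * ennreal (M powr p * S (2 * \<epsilon>) y powr (p - 1)) * ennreal (if dist y x < 2 * \<epsilon> then W x else 0)"
        proof (cases "dist x y < \<epsilon>")
          case True
          then have d: "dist y x < 2 * \<epsilon>" using \<epsilon> by (simp add: dist_commute)
          \<comment> \<open>The ball of radius \<epsilon> about x lies in the ball of radius
            2\<epsilon> about y, which removes x from S.\<close>
          have "S \<epsilon> x \<le> S (2 * \<epsilon>) y"
            unfolding S_def
          proof (rule integral_mono)
            show "(if dist x z < \<epsilon> then W z powr (- 1 / (p - 1)) else 0) \<le> (if dist y z < 2 * \<epsilon> then W z powr (- 1 / (p - 1)) else 0)" for z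
              using dist_triangle[of y z x] True by (auto simp: dist_commute)
          qed (use SVi \<epsilon> in auto)
          then have "S \<epsilon> x powr (p - 1) \<le> S (2 * \<epsilon>) y powr (p - 1)"
            using S0 p by (intro powr_mono2) auto
          then have "M powr p * S \<epsilon> x powr (p - 1) * W x \<le> M powr p * S (2 * \<epsilon>) y powr (p - 1) * W x"
            using W[of x] by (intro mult_right_mono mult_left_mono) auto
          then have "ennreal (M powr p * S \<epsilon> x powr (p - 1) * W x)
              \<le> ennreal (M powr p * S (2 * \<epsilon>) y powr (p - 1)) * ennreal (W x)"
            using W[of x] by (subst ennreal_mult''[symmetric]) (auto intro!: ennreal_leI)
          then show ?thesis using True d by (simp add: mult.assoc mult_left_mono)
        qed simp
      qed
      also have "\<dots> = ennreal (k y) * ennreal (M powr p * S (2 * \<epsilon>) y powr (p - 1)) * ennreal (V (2 * \<epsilon>) y)"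
        unfolding V_def using \<epsilon> SVi[of "2 * \<epsilon>" y] W
        by (subst nn_integral_cmult, simp, subst nn_integral_eq_integral) (auto simp: less_imp_le)
      also have "\<dots> \<le> ennreal (k y) * ennreal C"
      proof -
        let ?B = "measure lborel (ball y (2 * \<epsilon>))"
        have B: "0 < ?B" using \<epsilon> Bpos by simp
        have V0: "0 \<le> V (2 * \<epsilon>) y" unfolding V_def using W by (auto intro!: integral_nonneg_AE simp: less_imp_le)
        have "(1 / ?B * V (2 * \<epsilon>) y) * (1 / ?B * S (2 * \<epsilon>) y) powr (p - 1) \<le> c"
          using Ap[of "2 * \<epsilon>" y] \<epsilon> unfolding SV by simp
        then have "(1 / ?B * V (2 * \<epsilon>) y) * (1 / ?B * S (2 * \<epsilon>) y) powr (p - 1) \<le> max 0 c" by simp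
        moreover have "(1 / ?B * S (2 * \<epsilon>) y) powr (p - 1) = S (2 * \<epsilon>) y powr (p - 1) / (?B powr p / ?B)"
          using B S0 p by (simp add: powr_mult powr_divide powr_diff)
        ultimately have "V (2 * \<epsilon>) y * S (2 * \<epsilon>) y powr (p - 1) \<le> max 0 c * ?B powr p"
          using B by (simp add: field_simps)
        then have "M powr p * (V (2 * \<epsilon>) y * S (2 * \<epsilon>) y powr (p - 1)) \<le> M powr p * (max 0 c * ?B powr p)"
          by (intro mult_left_mono) auto
        also have "\<dots> = (M * ?B) powr p * max 0 c" using M0 B by (simp add: powr_mult)
        also have "M * ?B = K"
        proof -
          have "?B = 2 ^ DIM('a) * measure lborel (ball (0::'a) \<epsilon>)"
            using content_ball_conv_unit_ball[of "2 * \<epsilon>" y] content_ball_conv_unit_ball[of \<epsilon> "0::'a"] \<epsilon>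
            by (simp add: power_mult_distrib)
          moreover have "(2::real) ^ DIM('a) * 2 ^ DIM('a) = 4 ^ DIM('a)"
            by (simp add: power_mult_distrib[symmetric])
          ultimately show ?thesis using Bpos[OF \<epsilon>, of 0] unfolding M_def K_def by (simp add: mult.assoc)
        qed
        finally have "M powr p * (V (2 * \<epsilon>) y * S (2 * \<epsilon>) y powr (p - 1)) \<le> C" by (simp add: C_def)
        then have "ennreal (M powr p * S (2 * \<epsilon>) y powr (p - 1)) * ennreal (V (2 * \<epsilon>) y) \<le> ennreal C"
          using V0 by (subst ennreal_mult''[symmetric]) (auto intro!: ennreal_leI simp: mult_ac)
        then show ?thesis by (simp add: mult.assoc mult_left_mono)
      qed
      finally show "(\<integral>\<^sup>+x. (if dist x y < \<epsilon> then ennreal (k y) else 0) * ennreal (M powr p * S \<epsilon> x powr (p - 1) * W x) \<partial>lborel)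
        \<le> ennreal (k y) * ennreal C" .
    qed
    also have "\<dots> = ennreal C * (\<integral>\<^sup>+x. ennreal (norm (h x) powr p * W x) \<partial>lborel)"
      by (subst nn_integral_multc) (auto simp: k_def mult.commute)
    finally show ?thesis .
  qed
  note main = this
  have "(\<integral>\<^sup>+x. ennreal (norm (moll \<epsilon> h x) powr p * W x) \<partial>lborel)
      \<le> ennreal (C + 1) * (\<integral>\<^sup>+x. ennreal (norm (h x) powr p * W x) \<partial>lborel)"
    if \<epsilon>: "0 < \<epsilon>" and hi: "integrable lborel h" for \<epsilon> and h :: "'a \<Rightarrow> 'b"
  proof (cases "(\<integral>\<^sup>+x. ennreal (norm (h x) powr p * W x) \<partial>lborel) < \<infinity>")
    case True
    show ?thesis using C by (intro order_trans[OF main[OF \<epsilon> hi True]] mult_right_mono ennreal_leI) auto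
  next
    case False
    then have "(\<integral>\<^sup>+x. ennreal (norm (h x) powr p * W x) \<partial>lborel) = \<infinity>" by (metis infinity_ennreal_def less_top)
    then show ?thesis using C by (simp add: ennreal_mult_top)
  qed
  \<comment> \<open>The constant is C + 1 because it has to be positive when the integral of h is
    infinite: in \<open>ennreal\<close> the product of 0 and \<infinity> is 0.\<close>
  with C show ?thesis by (intro exI[of _ "C + 1"]) auto
qed

section \<open>Translation estimates for functions with integrable gradient\<close>

text \<open>The fundamental theorem of calculus along the segment from x to x - h, then Tonelli's
  theorem and translation invariance of Lebesgue measure for each parameter t.\<close>

lemma translation_test_function:
  fixes \<phi> :: "'a::euclidean_space \<Rightarrow> real"
  assumes \<phi>: "smooth_on UNIV \<phi>"
  shows "(\<integral>\<^sup>+x. ennreal \<bar>\<phi> (x - h) - \<phi> x\<bar> \<partial>lborel)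
    \<le> ennreal (norm h) * (\<integral>\<^sup>+x. ennreal (norm (gradient \<phi> x)) \<partial>lborel)"
proof -
  note [measurable] = smooth_measurable[OF \<phi>] gradient_measurable[OF \<phi>]
  have "ennreal \<bar>\<phi> (x - h) - \<phi> x\<bar> \<le> (\<integral>\<^sup>+t. ennreal (norm h) * (ennreal (norm (gradient \<phi> (x - t *\<^sub>R h))) * indicator {0..1} t) \<partial>lborel)" for x
  proof -
    define F where "F t = \<phi> (x - t *\<^sub>R h)" for t
    define f where "f t = - (gradient \<phi> (x - t *\<^sub>R h) \<bullet> h)" for t
    have "(F has_real_derivative f t) (at t)" for t
    proof -
      have "((\<lambda>t. x - t *\<^sub>R h) has_derivative (\<lambda>s. - (s *\<^sub>R h))) (at t)"
        by (auto intro!: derivative_eq_intros)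
      from has_derivative_compose[OF this has_derivative_gradient[OF smooth_differentiable[OF \<phi>]]]
      have "(F has_derivative (\<lambda>s. gradient \<phi> (x - t *\<^sub>R h) \<bullet> - (s *\<^sub>R h))) (at t)"
        unfolding F_def .
      moreover have "(\<lambda>s. gradient \<phi> (x - t *\<^sub>R h) \<bullet> - (s *\<^sub>R h)) = (*) (f t)"
        by (auto simp: fun_eq_iff f_def)
      ultimately show ?thesis unfolding has_field_derivative_def by simp
    qed
    then have F: "(F has_vector_derivative f t) (at t within {0..1})" for t
      by (simp add: has_field_derivative_at_within has_real_derivative_iff_has_vector_derivative[symmetric])
    have fc: "continuous_on {0..1} f"
      unfolding f_def by (intro continuous_intros continuous_on_compose2[OF gradient_continuous[OF \<phi>]]) auto
    have I: "has_bochner_integral lborel (\<lambda>t. indicator {0..1} t *\<^sub>R f t) (F 1 - F 0)"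
      by (rule has_bochner_integral_FTC_Icc[OF _ F fc]) simp
    have "ennreal \<bar>\<phi> (x - h) - \<phi> x\<bar> = ennreal (norm (LINT t|lborel. indicator {0..1} t *\<^sub>R f t))"
      using has_bochner_integral_integral_eq[OF I] by (simp add: F_def)
    also have "\<dots> \<le> (\<integral>\<^sup>+t. ennreal (norm (indicator {0..1} t *\<^sub>R f t)) \<partial>lborel)"
      using I by (intro integral_norm_bound_ennreal) (auto simp: has_bochner_integral_iff)
    also have "\<dots> \<le> (\<integral>\<^sup>+t. ennreal (norm h) * (ennreal (norm (gradient \<phi> (x - t *\<^sub>R h))) * indicator {0..1} t) \<partial>lborel)"
    proof (rule nn_integral_mono)
      fix t
      have "\<bar>f t\<bar> \<le> norm h * norm (gradient \<phi> (x - t *\<^sub>R h))"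
        unfolding f_def using Cauchy_Schwarz_ineq2[of "gradient \<phi> (x - t *\<^sub>R h)" h] by (simp add: mult.commute)
      then show "ennreal (norm (indicator {0..1} t *\<^sub>R f t)) \<le> ennreal (norm h) * (ennreal (norm (gradient \<phi> (x - t *\<^sub>R h))) * indicator {0..1} t)"
        by (auto simp: indicator_def ennreal_mult'[symmetric] intro!: ennreal_leI)
    qed
    finally show ?thesis .
  qed
  then have "(\<integral>\<^sup>+x. ennreal \<bar>\<phi> (x - h) - \<phi> x\<bar> \<partial>lborel) \<le>
     (\<integral>\<^sup>+x. \<integral>\<^sup>+t. ennreal (norm h) * (ennreal (norm (gradient \<phi> (x - t *\<^sub>R h))) * indicator {0..1::real} t) \<partial>lborel \<partial>lborel)"
    by (intro nn_integral_mono)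
  also have "\<dots> = (\<integral>\<^sup>+t. \<integral>\<^sup>+x. ennreal (norm h) * (ennreal (norm (gradient \<phi> (x - t *\<^sub>R h))) * indicator {0..1::real} t) \<partial>lborel \<partial>lborel)"
    by (rule lborel_pair.Fubini') measurable
  also have "\<dots> = (\<integral>\<^sup>+t. ennreal (norm h) * (\<integral>\<^sup>+x. ennreal (norm (gradient \<phi> x)) \<partial>lborel) * indicator {0..1::real} t \<partial>lborel)"
  proof (rule nn_integral_cong)
    fix t :: real
    have "(\<integral>\<^sup>+x. ennreal (norm h) * (ennreal (norm (gradient \<phi> (x - t *\<^sub>R h))) * indicator {0..1::real} t) \<partial>lborel)
      = ennreal (norm h) * ((\<integral>\<^sup>+x. ennreal (norm (gradient \<phi> (x - t *\<^sub>R h))) \<partial>lborel) * indicator {0..1} t)"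
      by (subst nn_integral_cmult, simp, subst nn_integral_multc) auto
    also have "(\<integral>\<^sup>+x. ennreal (norm (gradient \<phi> (x - t *\<^sub>R h))) \<partial>lborel) = (\<integral>\<^sup>+x. ennreal (norm (gradient \<phi> x)) \<partial>lborel)"
      by (rule nn_integral_shift[of "\<lambda>x. ennreal (norm (gradient \<phi> x))"]) simp
    finally show "(\<integral>\<^sup>+x. ennreal (norm h) * (ennreal (norm (gradient \<phi> (x - t *\<^sub>R h))) * indicator {0..1::real} t) \<partial>lborel)
      = ennreal (norm h) * (\<integral>\<^sup>+x. ennreal (norm (gradient \<phi> x)) \<partial>lborel) * indicator {0..1::real} t"
      by (simp add: mult.assoc)
  qed
  also have "\<dots> = ennreal (norm h) * (\<integral>\<^sup>+x. ennreal (norm (gradient \<phi> x)) \<partial>lborel)"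
    by (subst nn_integral_cmult_indicator) auto
  finally show ?thesis .
qed

text \<open>The difference is an average of increments under translations by h, and the kernel
  vanishes once the norm of h reaches \<epsilon>.\<close>

lemma moll_diff_test_function:
  fixes \<phi> :: "'a::euclidean_space \<Rightarrow> real"
  assumes \<phi>: "\<phi> \<in> test_functions \<Omega>" and \<epsilon>: "0 < \<epsilon>"
  shows "(\<integral>\<^sup>+x. ennreal \<bar>moll \<epsilon> \<phi> x - \<phi> x\<bar> \<partial>lborel)
    \<le> ennreal \<epsilon> * (\<integral>\<^sup>+x. ennreal (norm (gradient \<phi> x)) \<partial>lborel)"
proof -
  note \<phi>s = test_functions_smooth[OF \<phi>]
  note [measurable] = smooth_measurable[OF \<phi>s] gradient_measurable[OF \<phi>s]
  note \<phi>i = integrable_test_function[OF \<phi>]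
  let ?G = "\<integral>\<^sup>+x. ennreal (norm (gradient \<phi> x)) \<partial>lborel"
  have "ennreal \<bar>moll \<epsilon> \<phi> x - \<phi> x\<bar> \<le> (\<integral>\<^sup>+h. ennreal (mker \<epsilon> h * \<bar>\<phi> (x - h) - \<phi> x\<bar>) \<partial>lborel)" for x
  proof -
    have "(\<integral>\<^sup>+h. ennreal (mker \<epsilon> h * \<bar>\<phi> (x - h) - \<phi> x\<bar>) \<partial>lborel)
        = (\<integral>\<^sup>+y. ennreal (mker \<epsilon> (x - y) * \<bar>\<phi> y - \<phi> x\<bar>) \<partial>lborel)"
      using nn_integral_reflect[of "\<lambda>h. ennreal (mker \<epsilon> h * \<bar>\<phi> (x - h) - \<phi> x\<bar>)" x] by simp
    also have "\<dots> = ennreal (LINT y|lborel. mker \<epsilon> (x - y) * \<bar>\<phi> y - \<phi> x\<bar>)"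
      using moll_minus_self(2)[OF \<epsilon> \<phi>i, of x] mker_nonneg[OF \<epsilon>, where 'a='a]
      by (intro nn_integral_eq_integral) auto
    finally show ?thesis using moll_minus_self(1)[OF \<epsilon> \<phi>i, of x] by (simp add: ennreal_leI)
  qed
  then have "(\<integral>\<^sup>+x. ennreal \<bar>moll \<epsilon> \<phi> x - \<phi> x\<bar> \<partial>lborel)
    \<le> (\<integral>\<^sup>+x. \<integral>\<^sup>+h. ennreal (mker \<epsilon> h * \<bar>\<phi> (x - h) - \<phi> x\<bar>) \<partial>lborel \<partial>lborel)"
    by (intro nn_integral_mono)
  also have "\<dots> = (\<integral>\<^sup>+h. \<integral>\<^sup>+x. ennreal (mker \<epsilon> h * \<bar>\<phi> (x - h) - \<phi> x\<bar>) \<partial>lborel \<partial>lborel)"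
    by (rule lborel_pair.Fubini') measurable
  also have "\<dots> \<le> (\<integral>\<^sup>+h. ennreal (mker \<epsilon> (h::'a)) * (ennreal \<epsilon> * ?G) \<partial>lborel)"
  proof (rule nn_integral_mono)
    fix h :: 'a
    have "(\<integral>\<^sup>+x. ennreal (mker \<epsilon> h * \<bar>\<phi> (x - h) - \<phi> x\<bar>) \<partial>lborel)
      = ennreal (mker \<epsilon> h) * (\<integral>\<^sup>+x. ennreal \<bar>\<phi> (x - h) - \<phi> x\<bar> \<partial>lborel)"
      using mker_nonneg[OF \<epsilon>, of h] by (subst nn_integral_cmult[symmetric]) (auto simp: ennreal_mult')
    also have "\<dots> \<le> ennreal (mker \<epsilon> h) * (ennreal \<epsilon> * ?G)"
    proof (cases "\<epsilon> \<le> norm h")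
      case True then show ?thesis by (simp add: mker_eq_0[OF \<epsilon>])
    next
      case False
      then show ?thesis
        by (intro mult_left_mono order_trans[OF translation_test_function[OF \<phi>s]] mult_right_mono ennreal_leI) auto
    qed
    finally show "(\<integral>\<^sup>+x. ennreal (mker \<epsilon> h * \<bar>\<phi> (x - h) - \<phi> x\<bar>) \<partial>lborel) \<le> ennreal (mker \<epsilon> h) * (ennreal \<epsilon> * ?G)" .
  qed
  also have "\<dots> = ennreal \<epsilon> * ?G"
    by (subst nn_integral_multc) (auto simp: mker_integral[OF \<epsilon>])
  finally show ?thesis .
qed

text \<open>The estimate for test functions is applied to the mollification of V at a second scale
  \<tau>. Its gradient is the mollification of Z, which has no larger L^1 norm than Z, and \<tau>
  \<rightarrow> 0 removes the error.\<close>

lemma moll_diff_wgrad: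
  fixes V :: "'a::euclidean_space \<Rightarrow> real"
  assumes V: "integrable lborel V" and Z: "integrable lborel Z" and R: "\<And>x. x \<notin> cball 0 R \<Longrightarrow> V x = 0"
    and wg: "wgrad UNIV V Z" and \<epsilon>: "0 < \<epsilon>"
  shows "(\<integral>\<^sup>+x. ennreal \<bar>moll \<epsilon> V x - V x\<bar> \<partial>lborel) \<le> ennreal \<epsilon> * (\<integral>\<^sup>+x. ennreal (norm (Z x)) \<partial>lborel)"
proof -
  have [measurable]: "V \<in> borel_measurable borel" "Z \<in> borel_measurable borel" using V Z by auto
  let ?Z = "\<integral>\<^sup>+x. ennreal (norm (Z x)) \<partial>lborel"
  let ?d = "\<lambda>\<tau>. \<integral>\<^sup>+x. ennreal \<bar>moll \<tau> V x - V x\<bar> \<partial>lborel"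
  \<comment> \<open>The error V - U occurs twice: once mollified at scale \<epsilon> and once as it
    stands.\<close>
  have *: "?d \<epsilon> \<le> 2 * ?d \<tau> + ennreal \<epsilon> * ?Z" if \<tau>: "0 < \<tau>" for \<tau>
  proof -
    define U where "U = moll \<tau> V"
    have U: "U \<in> test_functions UNIV"
    proof (rule test_functionsI[of _ "cball 0 (R + \<tau>)"])
      show "smooth_on UNIV U" unfolding U_def by (rule smooth_moll[OF \<tau> V])
      show "U x = 0" if "x \<notin> cball 0 (R + \<tau>)" for x
        unfolding U_def
      proof (rule moll_eq_0[OF \<tau>])
        fix y assume "y \<in> ball x \<tau>"
        then show "V y = 0" using that norm_triangle_sub[of x y] by (intro R) (auto simp: dist_norm)
      qed
    qed auto
    note Ui = integrable_test_function[OF U]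
    have [measurable]: "U \<in> borel_measurable borel" using Ui by auto
    have "gradient U x = moll \<tau> Z x" for x
      unfolding U_def by (rule gradient_moll[OF \<tau> V Z wg]) simp
    then have G: "(\<integral>\<^sup>+x. ennreal (norm (gradient U x)) \<partial>lborel) \<le> ?Z"
      using nn_moll_L1[OF \<tau> Z] by simp
    have "ennreal \<bar>moll \<epsilon> V x - V x\<bar> \<le> ennreal \<bar>moll \<epsilon> (\<lambda>y. V y - U y) x\<bar> + ennreal \<bar>moll \<epsilon> U x - U x\<bar> + ennreal \<bar>U x - V x\<bar>" for x
      unfolding moll_diff[OF \<epsilon> V Ui] by (simp add: ennreal_plus[symmetric] ennreal_leI del: ennreal_plus)
    then have "?d \<epsilon> \<le> (\<integral>\<^sup>+x. (ennreal \<bar>moll \<epsilon> (\<lambda>y. V y - U y) x\<bar> + ennreal \<bar>moll \<epsilon> U x - U x\<bar> + ennreal \<bar>U x - V x\<bar>) \<partial>lborel)"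
      by (intro nn_integral_mono)
    also have "\<dots> = (\<integral>\<^sup>+x. ennreal \<bar>moll \<epsilon> (\<lambda>y. V y - U y) x\<bar> \<partial>lborel) + (\<integral>\<^sup>+x. ennreal \<bar>moll \<epsilon> U x - U x\<bar> \<partial>lborel) + ?d \<tau>"
      unfolding U_def[symmetric] by (subst nn_integral_add, simp, simp, subst nn_integral_add, auto)
    also have "\<dots> \<le> ?d \<tau> + ennreal \<epsilon> * ?Z + ?d \<tau>"
    proof (intro add_mono order_refl)
      show "(\<integral>\<^sup>+x. ennreal \<bar>moll \<epsilon> (\<lambda>y. V y - U y) x\<bar> \<partial>lborel) \<le> ?d \<tau>"
        using nn_moll_L1[OF \<epsilon>, of "\<lambda>y. V y - U y"] V Ui by (simp add: abs_minus_commute U_def[symmetric])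
      show "(\<integral>\<^sup>+x. ennreal \<bar>moll \<epsilon> U x - U x\<bar> \<partial>lborel) \<le> ennreal \<epsilon> * ?Z"
        by (rule order_trans[OF moll_diff_test_function[OF U \<epsilon>]]) (intro mult_left_mono G, simp)
    qed
    finally show ?thesis by (simp add: mult_2 ac_simps)
  qed
  have "((\<lambda>\<tau>. 2 * ?d \<tau> + ennreal \<epsilon> * ?Z) \<longlongrightarrow> 2 * 0 + ennreal \<epsilon> * ?Z) (at_right 0)"
    using moll_tendsto_L1[OF V R] by (intro tendsto_add tendsto_const ennreal_tendsto_cmult) auto
  then have lim: "((\<lambda>\<tau>. 2 * ?d \<tau> + ennreal \<epsilon> * ?Z) \<longlongrightarrow> ennreal \<epsilon> * ?Z) (at_right 0)" by simp
  have ev: "eventually (\<lambda>\<tau>. ?d \<epsilon> \<le> 2 * ?d \<tau> + ennreal \<epsilon> * ?Z) (at_right 0)"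
    unfolding eventually_at_right_field using * by (intro exI[of _ 1]) auto
  show ?thesis by (rule tendsto_lowerbound[OF lim ev]) simp
qed

section \<open>Uniform boundedness\<close>

text \<open>A gliding hump: if the numbers \<open>N (u n)\<close> were unbounded, then a suitably signed series
  \<open>\<Sum>\<plusminus>3\<^sup>-\<^sup>k \<Phi> (m k)\<close> would be unbounded along the sequence \<open>u\<close>.\<close>

lemma gliding_hump:
  fixes N :: "'x \<Rightarrow> real" and \<Phi> :: "nat \<Rightarrow> 'x \<Rightarrow> real"
  assumes \<Phi>: "\<And>i n. \<bar>\<Phi> i (u n)\<bar> \<le> N (u n)" and norming: "\<And>n. \<Phi> n (u n) = N (u n)"
    and conv: "\<And>a m. (\<And>k. \<bar>a k\<bar> = (1/3) ^ k) \<Longrightarrow> Bseq (\<lambda>n. \<Sum>k. a k * \<Phi> (m k) (u n))"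
  shows "\<exists>B. \<forall>n. N (u n) \<le> B"
proof (rule ccontr)
  assume unb: "\<not> (\<exists>B. \<forall>n. N (u n) \<le> B)"
  then have "\<exists>n. N (u n) \<ge> 4 ^ k" for k :: nat by (meson linorder_le_cases)
  \<comment> \<open>Growth 4^k against coefficients 3^(-k) leaves the divergent lower bound (4/3)^k
    / 2.\<close>
  then obtain m where m: "\<And>k. N (u (m k)) \<ge> 4 ^ k" by metis
  \<comment> \<open>The k-th coefficient takes the sign of the partial sum at
    \<open>u (m k)\<close>, so that the new term cannot cancel what precedes it. As the sign depends
    on the earlier ones, the partial sums are built by recursion.\<close>
  define S where "S = rec_nat (\<lambda>v. 0) (\<lambda>k f v. f v + (if f (u (m k)) \<ge> 0 then (1/3) ^ k else - ((1/3) ^ k)) * \<Phi> (m k) v)"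
  define a where "a k = (if S k (u (m k)) \<ge> 0 then (1/3) ^ k else - ((1/3) ^ k :: real))" for k
  have a: "\<bar>a k\<bar> = (1/3) ^ k" for k by (simp add: a_def)
  have S0: "S 0 v = 0" and SS: "S (Suc k) v = S k v + a k * \<Phi> (m k) v" for k v
    by (simp_all add: S_def a_def)
  have Ssum: "S k v = (\<Sum>j<k. a j * \<Phi> (m j) v)" for k v by (induction k) (simp_all add: S0 SS)
  define F where "F v = (\<Sum>k. a k * \<Phi> (m k) v)" for v
  have bnd: "norm (a k * \<Phi> (m k) (u n)) \<le> (1/3) ^ k * N (u n)" for k n
    using \<Phi>[of "m k" n] by (simp add: abs_mult a mult_left_mono)
  have geo: "summable (\<lambda>k. (1/3) ^ k * N (u n))" for n by (intro summable_mult2 summable_geometric) simp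
  have sm: "summable (\<lambda>k. a k * \<Phi> (m k) (u n))" for n
    by (rule summable_comparison_test'[OF geo bnd])
  have low: "\<bar>F (u (m k))\<bar> \<ge> (4/3) ^ k / 2" for k
  proof -
    let ?v = "u (m k)"
    have N0: "0 \<le> N ?v" using \<Phi>[of 0 "m k"] by linarith
    have "F ?v = (\<Sum>j. a (j + Suc k) * \<Phi> (m (j + Suc k)) ?v) + S (Suc k) ?v"
      unfolding F_def Ssum by (rule suminf_split_initial_segment[OF sm])
    moreover have "\<bar>\<Sum>j. a (j + Suc k) * \<Phi> (m (j + Suc k)) ?v\<bar> \<le> (\<Sum>j. (1/3) ^ (j + Suc k) * N ?v)"
      unfolding real_norm_def[symmetric]
      by (rule norm_suminf_le[OF bnd summable_ignore_initial_segment[OF geo, of "Suc k"]])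
    \<comment> \<open>The tail is half of the k-th term, so half of that term survives. With ratio
      1/2 in place of 1/3 the tail could cancel it completely.\<close>
    moreover have "(\<Sum>j. (1/3) ^ (j + Suc k) * N ?v) = (1/3) ^ k / 2 * N ?v"
    proof -
      have "(\<lambda>j. (1/3::real) ^ j) sums (1 / (1 - 1/3))" by (rule geometric_sums) simp
      then have "(\<lambda>j. (1/3) ^ Suc k * N ?v * (1/3) ^ j) sums ((1/3) ^ Suc k * N ?v * (3/2))"
        by (intro sums_mult) simp
      then show ?thesis by (intro sums_unique[symmetric]) (simp add: power_add mult_ac)
    qed
    moreover have "\<bar>S (Suc k) ?v\<bar> \<ge> (1/3) ^ k * N ?v"
    proof -
      define P where "P = (1/3) ^ k * N ?v"
      have "0 \<le> P" using N0 by (simp add: P_def)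
      moreover have "S (Suc k) ?v = (if S k ?v \<ge> 0 then S k ?v + P else S k ?v - P)"
        by (simp add: SS a_def norming P_def)
      ultimately show ?thesis unfolding P_def[symmetric] by (auto split: if_splits)
    qed
    ultimately have "\<bar>F ?v\<bar> \<ge> (1/3) ^ k / 2 * N ?v" by linarith
    moreover have "(1/3) ^ k / 2 * N ?v \<ge> (1/3) ^ k / 2 * 4 ^ k" using m by (intro mult_left_mono) auto
    moreover have "(1/3) ^ k / 2 * 4 ^ k = (4/3 :: real) ^ k / 2" by (simp add: power_divide)
    ultimately show ?thesis by linarith
  qed
  have "Bseq (\<lambda>n. F (u n))" unfolding F_def using conv[OF a] .
  then obtain K where K: "\<And>n. \<bar>F (u n)\<bar> \<le> K" unfolding Bseq_def by auto
  obtain k where "2 * K < (4/3) ^ k" using real_arch_pow[of "4/3" "2 * K"] by auto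
  with low[of k] K[of "m k"] show False by linarith
qed

section \<open>Functions on an open set and their Borel representatives\<close>

lemma lint_lebesgue_on:
  fixes f :: "'a::euclidean_space \<Rightarrow> 'b::euclidean_space"
  shows "open \<Omega> \<Longrightarrow> (LINT x:\<Omega>|lebesgue. f x) = (LINT x|lebesgue_on \<Omega>. f x)"
  by (simp add: integral_restrict_space set_lebesgue_integral_def)

lemma absolutely_integrable_lebesgue_on:
  fixes f :: "'a::euclidean_space \<Rightarrow> 'b::euclidean_space"
  shows "open \<Omega> \<Longrightarrow> f absolutely_integrable_on \<Omega> \<longleftrightarrow> integrable (lebesgue_on \<Omega>) f"
  by (simp add: integrable_restrict_space set_integrable_def)

lemma AE_lebesgue_on:
  fixes \<Omega> :: "'a::euclidean_space set"
  shows "open \<Omega> \<Longrightarrow> (AE x in lebesgue_on \<Omega>. P x) \<longleftrightarrow> (AE x in lborel. x \<in> \<Omega> \<longrightarrow> P x)"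
  by (simp add: AE_restrict_space_iff AE_completion_iff)

lemma measurable_lebesgue_on_borel:
  fixes f :: "'a::euclidean_space \<Rightarrow> 'b::euclidean_space"
  shows "f \<in> borel_measurable borel \<Longrightarrow> f \<in> borel_measurable (lebesgue_on \<Omega>)"
  by (intro measurable_restrict_space1 measurable_completion) simp

text \<open>Vanishing off \<Omega> turns integrals over \<open>lebesgue_on \<Omega>\<close> into
  integrals over \<open>lborel\<close>, where Tonelli's theorem and convolution apply;
  \<open>borel_transfer\<close> makes the passage.\<close>

definition borel_rep :: "'a::euclidean_space set \<Rightarrow> ('a \<Rightarrow> 'b::euclidean_space) \<Rightarrow> ('a \<Rightarrow> 'b) \<Rightarrow> bool" where
  "borel_rep \<Omega> f f' \<longleftrightarrow> f' \<in> borel_measurable borel \<and> (\<forall>x. x \<notin> \<Omega> \<longrightarrow> f' x = 0) \<and> (AE x in lebesgue_on \<Omega>. f' x = f x)"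

lemma borel_rep_exists:
  fixes f :: "'a::euclidean_space \<Rightarrow> 'b::euclidean_space"
  assumes \<Omega>: "open \<Omega>" and f: "f \<in> borel_measurable (lebesgue_on \<Omega>)"
  obtains f' where "borel_rep \<Omega> f f'"
proof -
  have "\<exists>g\<in>borel_measurable lborel. AE x in lborel. indicator \<Omega> x * (f x \<bullet> i) = g x" for i
  proof (rule completion_ex_borel_measurable_real)
    have "(\<lambda>x. f x \<bullet> i) \<in> borel_measurable (lebesgue_on \<Omega>)" using f by measurable
    then show "(\<lambda>x. indicator \<Omega> x * (f x \<bullet> i)) \<in> borel_measurable lebesgue"
      using \<Omega> by (subst (asm) borel_measurable_restrict_space_iff) auto
  qed
  then have "\<forall>i. \<exists>g. g \<in> borel_measurable lborel \<and> (AE x in lborel. indicator \<Omega> x * (f x \<bullet> i) = g x)"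
    unfolding Bex_def by (intro allI)
  from choice[OF this] obtain g where "\<forall>i. g i \<in> borel_measurable lborel \<and> (AE x in lborel. indicator \<Omega> x * (f x \<bullet> i) = g i x)" ..
  then have g: "g i \<in> borel_measurable borel" "AE x in lborel. indicator \<Omega> x * (f x \<bullet> i) = g i x" for i
    by simp_all
  note [measurable] = g(1)
  have [measurable]: "\<Omega> \<in> sets borel" using \<Omega> by simp
  define f' where "f' x = (\<Sum>i\<in>Basis. (indicator \<Omega> x * g i x) *\<^sub>R (i::'b))" for x
  have "AE x in lborel. \<forall>i\<in>Basis. indicator \<Omega> x * (f x \<bullet> i) = g i x"
    using g(2) by (intro AE_finite_allI) auto
  then have "AE x in lborel. x \<in> \<Omega> \<longrightarrow> f' x = f x"
  proof eventually_elim
    case (elim x)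
    show ?case
    proof
      assume "x \<in> \<Omega>"
      then have "f' x = (\<Sum>i\<in>Basis. (f x \<bullet> i) *\<^sub>R i)" unfolding f'_def using elim by (intro sum.cong) auto
      then show "f' x = f x" by (simp add: euclidean_representation)
    qed
  qed
  moreover have "f' \<in> borel_measurable borel" unfolding f'_def by measurable
  moreover have "f' x = 0" if "x \<notin> \<Omega>" for x using that by (simp add: f'_def)
  ultimately show ?thesis using that[of f'] \<Omega> unfolding borel_rep_def by (simp add: AE_lebesgue_on)
qed

lemma borel_transfer:
  fixes h h0 :: "'a::euclidean_space \<Rightarrow> 'b::euclidean_space"
  assumes \<Omega>: "open \<Omega>" and h: "h \<in> borel_measurable borel" "\<And>x. x \<notin> \<Omega> \<Longrightarrow> h x = 0"
    and h0: "h0 \<in> borel_measurable (lebesgue_on \<Omega>)" and eq: "AE x in lebesgue_on \<Omega>. h x = h0 x"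
  shows "integrable (lebesgue_on \<Omega>) h0 \<longleftrightarrow> integrable lborel h"
    "(LINT x|lebesgue_on \<Omega>. h0 x) = (LINT x|lborel. h x)"
proof -
  have ih: "(\<lambda>x. indicator \<Omega> x *\<^sub>R h x) = h" using h(2) by (auto simp: indicator_def)
  have hm: "h \<in> borel_measurable (lebesgue_on \<Omega>)" by (rule measurable_lebesgue_on_borel[OF h(1)])
  have "integrable (lebesgue_on \<Omega>) h0 \<longleftrightarrow> integrable (lebesgue_on \<Omega>) h"
    by (rule integrable_cong_AE[OF h0 hm]) (use eq in \<open>auto elim: eventually_mono\<close>)
  also have "\<dots> \<longleftrightarrow> integrable lebesgue h" using \<Omega> by (simp add: integrable_restrict_space ih)
  also have "\<dots> \<longleftrightarrow> integrable lborel h" using h(1) by (intro integrable_completion) simp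
  finally show "integrable (lebesgue_on \<Omega>) h0 \<longleftrightarrow> integrable lborel h" .
  have "(LINT x|lebesgue_on \<Omega>. h0 x) = (LINT x|lebesgue_on \<Omega>. h x)"
    by (rule integral_cong_AE[OF h0 hm]) (use eq in \<open>auto elim: eventually_mono\<close>)
  also have "\<dots> = (LINT x|lebesgue. h x)" using \<Omega> by (simp add: integral_restrict_space ih)
  also have "\<dots> = (LINT x|lborel. h x)" using h(1) by (intro integral_completion) simp
  finally show "(LINT x|lebesgue_on \<Omega>. h0 x) = (LINT x|lborel. h x)" .
qed

text \<open>The restrictions of f to a compact exhaustion are measurable and, at each point of
  \<Omega>, eventually constant.\<close>

lemma locally_integrable_measurable:
  fixes f :: "'a::euclidean_space \<Rightarrow> 'b::euclidean_space"
  assumes \<Omega>: "open \<Omega>" and f: "locally_integrable_on f \<Omega>"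
  shows "f \<in> borel_measurable (lebesgue_on \<Omega>)"
proof -
  obtain C :: "nat \<Rightarrow> 'a set" where C: "\<forall>n. compact (C n)" "\<forall>n. C n \<subseteq> \<Omega>"
    "\<forall>K. compact K \<and> K \<subseteq> \<Omega> \<longrightarrow> (\<exists>N. \<forall>n\<ge>N. K \<subseteq> C n)"
  proof (rule open_Union_compact_subsets[OF \<Omega>])
    fix C :: "nat \<Rightarrow> 'a set"
    assume "\<And>n. compact (C n)" "\<And>n. C n \<subseteq> \<Omega>" "\<And>K. \<lbrakk>compact K; K \<subseteq> \<Omega>\<rbrakk> \<Longrightarrow> \<exists>N. \<forall>n\<ge>N. K \<subseteq> C n"
    then show thesis by (intro that[of C]) simp_all
  qed
  have "(\<lambda>x. indicator \<Omega> x *\<^sub>R f x) \<in> borel_measurable lebesgue"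
  proof (rule borel_measurable_LIMSEQ_metric)
    show "(\<lambda>x. indicator (C n) x *\<^sub>R f x) \<in> borel_measurable lebesgue" for n
    proof -
      have "f absolutely_integrable_on C n" using f C(1,2) by (simp add: locally_integrable_on_def)
      then show ?thesis unfolding set_integrable_def by (rule borel_measurable_integrable)
    qed
    fix x
    show "(\<lambda>n. indicator (C n) x *\<^sub>R f x) \<longlonglongrightarrow> indicator \<Omega> x *\<^sub>R f x"
    proof (cases "x \<in> \<Omega>")
      case True
      then obtain N where "\<forall>n\<ge>N. {x} \<subseteq> C n" using C(3)[rule_format, of "{x}"] by auto
      then show ?thesis using True
        by (intro tendsto_eventually) (auto simp: eventually_sequentially intro!: exI[of _ N])
    next
      case False
      then have "x \<notin> C n" for n using C(2) by auto
      then show ?thesis using False by simp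
    qed
  qed
  then show ?thesis using \<Omega> by (subst borel_measurable_restrict_space_iff) auto
qed

lemma locally_integrable_test:
  fixes f :: "'a::euclidean_space \<Rightarrow> 'b::euclidean_space"
  assumes \<Omega>: "open \<Omega>" and f: "locally_integrable_on f \<Omega>" and \<phi>: "\<phi> \<in> test_functions \<Omega>"
  shows "integrable (lebesgue_on \<Omega>) (\<lambda>x. \<phi> x *\<^sub>R f x)"
proof -
  obtain B where B: "\<And>x. \<bar>\<phi> x\<bar> \<le> B" using test_functions_bounded[OF \<phi>] by blast
  have K: "compact (supp \<phi>)" "supp \<phi> \<subseteq> \<Omega>" using \<phi> by (auto simp: test_functions_def)
  have "integrable lebesgue (\<lambda>x. indicator (supp \<phi>) x *\<^sub>R f x)"
    using f[unfolded locally_integrable_on_def, rule_format, of "supp \<phi>"] K unfolding set_integrable_def by simp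
  moreover have "\<phi> \<in> borel_measurable lebesgue"
    using smooth_measurable[OF test_functions_smooth[OF \<phi>]] by (simp add: measurable_completion)
  ultimately have "integrable lebesgue (\<lambda>x. \<phi> x *\<^sub>R indicator (supp \<phi>) x *\<^sub>R f x)"
    using B by (rule integrable_bounded_mult)
  also have "(\<lambda>x. \<phi> x *\<^sub>R indicator (supp \<phi>) x *\<^sub>R f x) = (\<lambda>x. indicator \<Omega> x *\<^sub>R \<phi> x *\<^sub>R f x)"
    using not_in_supp[of _ \<phi>] K by (auto simp: indicator_def fun_eq_iff)
  finally show ?thesis using \<Omega> by (simp add: integrable_restrict_space)
qed

section \<open>Weak gradients\<close>

lemma locally_integrable_add:
  "locally_integrable_on f \<Omega> \<Longrightarrow> locally_integrable_on g \<Omega> \<Longrightarrow> locally_integrable_on (\<lambda>x. f x + g x) \<Omega>"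
  unfolding locally_integrable_on_def by (auto intro: set_integral_add(1))

lemma locally_integrable_scaleR:
  fixes f :: "'a::euclidean_space \<Rightarrow> 'b::euclidean_space"
  assumes f: "locally_integrable_on f \<Omega>"
  shows "locally_integrable_on (\<lambda>x. a *\<^sub>R f x) \<Omega>"
  unfolding locally_integrable_on_def
proof (intro allI impI)
  fix K assume "compact K \<and> K \<subseteq> \<Omega>"
  then have "integrable lebesgue (\<lambda>x. indicator K x *\<^sub>R f x)"
    using f[unfolded locally_integrable_on_def, rule_format, of K] by (simp add: set_integrable_def)
  from integrable_scaleR_right[OF this, of a] show "(\<lambda>x. a *\<^sub>R f x) absolutely_integrable_on K"
    by (simp add: set_integrable_def mult.commute)
qed

lemma has_weak_gradient_inner_integrable:
  assumes "open \<Omega>" "has_weak_gradient \<Omega> u g" "\<phi> \<in> test_functions \<Omega>" "b \<in> Basis"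
  shows "integrable (lebesgue_on \<Omega>) (\<lambda>x. u x * partials [b] \<phi> x)"
    "integrable (lebesgue_on \<Omega>) (\<lambda>x. (g x \<bullet> b) * \<phi> x)"
proof -
  show "integrable (lebesgue_on \<Omega>) (\<lambda>x. u x * partials [b] \<phi> x)"
    using locally_integrable_test[OF assms(1) _ test_functions_partials[OF assms(3,4)], of u] assms(2)
    by (simp add: has_weak_gradient_def mult.commute del: partials.simps)
  have "integrable (lebesgue_on \<Omega>) (\<lambda>x. (\<phi> x *\<^sub>R g x) \<bullet> b)"
    using locally_integrable_test[OF assms(1) _ assms(3), of g] assms(2)
    by (intro integrable_inner_left) (simp add: has_weak_gradient_def)
  then show "integrable (lebesgue_on \<Omega>) (\<lambda>x. (g x \<bullet> b) * \<phi> x)" by (simp add: mult.commute)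
qed

lemma has_weak_gradient_iff:
  assumes "open \<Omega>"
  shows "has_weak_gradient \<Omega> u g \<longleftrightarrow> locally_integrable_on u \<Omega> \<and> locally_integrable_on g \<Omega> \<and>
     (\<forall>\<phi>\<in>test_functions \<Omega>. \<forall>b\<in>Basis.
        (LINT x|lebesgue_on \<Omega>. u x * partials [b] \<phi> x) = - (LINT x|lebesgue_on \<Omega>. (g x \<bullet> b) * \<phi> x))"
  unfolding has_weak_gradient_def by (simp add: lint_lebesgue_on[OF assms] del: partials.simps)

lemma has_weak_gradientD:
  "open \<Omega> \<Longrightarrow> has_weak_gradient \<Omega> u g \<Longrightarrow> \<phi> \<in> test_functions \<Omega> \<Longrightarrow> b \<in> Basis \<Longrightarrow>
    (LINT x|lebesgue_on \<Omega>. u x * partials [b] \<phi> x) = - (LINT x|lebesgue_on \<Omega>. (g x \<bullet> b) * \<phi> x)"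
  by (simp add: has_weak_gradient_iff del: partials.simps)

lemma has_weak_gradient_add:
  assumes \<Omega>: "open \<Omega>" and u: "has_weak_gradient \<Omega> u g" and v: "has_weak_gradient \<Omega> v h"
  shows "has_weak_gradient \<Omega> (\<lambda>x. u x + v x) (\<lambda>x. g x + h x)"
  unfolding has_weak_gradient_iff[OF \<Omega>]
proof (intro conjI ballI)
  show "locally_integrable_on (\<lambda>x. u x + v x) \<Omega>" "locally_integrable_on (\<lambda>x. g x + h x) \<Omega>"
    using u v by (auto simp: has_weak_gradient_def intro: locally_integrable_add)
  fix \<phi> b assume \<phi>: "\<phi> \<in> test_functions \<Omega>" "b \<in> (Basis :: 'a set)"
  have eq: "(LINT x|lebesgue_on \<Omega>. u x * partials [b] \<phi> x) = - (LINT x|lebesgue_on \<Omega>. (g x \<bullet> b) * \<phi> x)"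
    "(LINT x|lebesgue_on \<Omega>. v x * partials [b] \<phi> x) = - (LINT x|lebesgue_on \<Omega>. (h x \<bullet> b) * \<phi> x)"
    using has_weak_gradientD[OF \<Omega> u \<phi>] has_weak_gradientD[OF \<Omega> v \<phi>] .
  note i = has_weak_gradient_inner_integrable[OF \<Omega> u \<phi>] has_weak_gradient_inner_integrable[OF \<Omega> v \<phi>]
  show "(LINT x|lebesgue_on \<Omega>. (u x + v x) * partials [b] \<phi> x) = - (LINT x|lebesgue_on \<Omega>. ((g x + h x) \<bullet> b) * \<phi> x)"
    unfolding inner_add_left distrib_right
    by (simp only: Bochner_Integration.integral_add[OF i(1,3)] Bochner_Integration.integral_add[OF i(2,4)] eq)
qed

lemma has_weak_gradient_cmult:
  assumes \<Omega>: "open \<Omega>" and u: "has_weak_gradient \<Omega> u g"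
  shows "has_weak_gradient \<Omega> (\<lambda>x. a * u x) (\<lambda>x. a *\<^sub>R g x)"
  unfolding has_weak_gradient_iff[OF \<Omega>]
proof (intro conjI ballI)
  show "locally_integrable_on (\<lambda>x. a * u x) \<Omega>" "locally_integrable_on (\<lambda>x. a *\<^sub>R g x) \<Omega>"
    using u locally_integrable_scaleR[of u \<Omega> a] locally_integrable_scaleR[of g \<Omega> a]
    by (auto simp: has_weak_gradient_def)
  fix \<phi> b assume \<phi>: "\<phi> \<in> test_functions \<Omega>" "b \<in> (Basis :: 'a set)"
  have eq: "(LINT x|lebesgue_on \<Omega>. u x * partials [b] \<phi> x) = - (LINT x|lebesgue_on \<Omega>. (g x \<bullet> b) * \<phi> x)"
    using has_weak_gradientD[OF \<Omega> u \<phi>] .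
  show "(LINT x|lebesgue_on \<Omega>. a * u x * partials [b] \<phi> x) = - (LINT x|lebesgue_on \<Omega>. ((a *\<^sub>R g x) \<bullet> b) * \<phi> x)"
    unfolding inner_scaleR_left mult.assoc integral_mult_right_zero eq by simp
qed

lemma locally_integrable_borel_rep:
  fixes f :: "'a::euclidean_space \<Rightarrow> 'b::euclidean_space"
  assumes \<Omega>: "open \<Omega>" and f: "locally_integrable_on f \<Omega>" and f': "borel_rep \<Omega> f f'" and K: "compact K" "K \<subseteq> \<Omega>"
  shows "set_integrable lborel K f'"
proof -
  have [measurable]: "f' \<in> borel_measurable borel" using f' by (simp add: borel_rep_def)
  have [measurable]: "K \<in> sets borel" using K(1) by (simp add: borel_compact)
  have "integrable lebesgue (\<lambda>x. indicator K x *\<^sub>R f x)"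
    using f[unfolded locally_integrable_on_def, rule_format, of K] K unfolding set_integrable_def by simp
  moreover have "(\<lambda>x. indicator K x *\<^sub>R f' x) \<in> borel_measurable lborel" by measurable
  then have "(\<lambda>x. indicator K x *\<^sub>R f' x) \<in> borel_measurable lebesgue" by (rule measurable_completion)
  moreover have "AE x in lebesgue. x \<in> \<Omega> \<longrightarrow> f' x = f x"
    using f' \<Omega> unfolding borel_rep_def by (simp add: AE_restrict_space_iff)
  then have "AE x in lebesgue. indicator K x *\<^sub>R f x = indicator K x *\<^sub>R f' x"
    by eventually_elim (use K in \<open>auto simp: indicator_def\<close>)
  ultimately have "integrable lebesgue (\<lambda>x. indicator K x *\<^sub>R f' x)"
    by (rule integrable_cong_AE_imp)
  then show ?thesis unfolding set_integrable_def
    by (subst (asm) integrable_completion) measurable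
qed

text \<open>The fundamental lemma for each component of g - h. Since \<open>weak_grad\<close> is an
  arbitrary choice, this is what makes it additive and homogeneous almost everywhere.\<close>

lemma weak_gradient_unique:
  assumes \<Omega>: "open \<Omega>" and g: "has_weak_gradient \<Omega> u g" and h: "has_weak_gradient \<Omega> u h"
  shows "AE x in lebesgue_on \<Omega>. g x = h x"
proof -
  have "AE x in lebesgue_on \<Omega>. (g x - h x) \<bullet> b = 0" if b: "b \<in> Basis" for b
  proof -
    let ?f = "\<lambda>x. (g x - h x) \<bullet> b"
    have l: "locally_integrable_on g \<Omega>" "locally_integrable_on h \<Omega>" using g h by (auto simp: has_weak_gradient_def)
    have li: "locally_integrable_on ?f \<Omega>"
      unfolding locally_integrable_on_def
    proof (intro allI impI)
      fix K assume "compact K \<and> K \<subseteq> \<Omega>"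
      then have "g absolutely_integrable_on K" "h absolutely_integrable_on K" using l by (auto simp: locally_integrable_on_def)
      then have "integrable lebesgue (\<lambda>x. (indicator K x *\<^sub>R g x - indicator K x *\<^sub>R h x) \<bullet> b)"
        unfolding set_integrable_def by (intro integrable_inner_left Bochner_Integration.integrable_diff)
      then show "?f absolutely_integrable_on K" unfolding set_integrable_def
        by (simp add: inner_diff_left right_diff_distrib)
    qed
    have fm: "?f \<in> borel_measurable (lebesgue_on \<Omega>)" by (rule locally_integrable_measurable[OF \<Omega> li])
    then obtain f' where f': "borel_rep \<Omega> ?f f'" using borel_rep_exists[OF \<Omega>] by blast
    then have f'm: "f' \<in> borel_measurable borel" by (simp add: borel_rep_def)
    have "AE x in lborel. x \<in> \<Omega> \<longrightarrow> f' x = 0"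
    proof (rule fundamental_lemma[OF \<Omega> f'm])
      show "set_integrable lborel K f'" if "compact K" "K \<subseteq> \<Omega>" for K
        by (rule locally_integrable_borel_rep[OF \<Omega> li f' that])
    next
      fix \<phi> assume \<phi>: "\<phi> \<in> test_functions \<Omega>"
      note [measurable] = smooth_measurable[OF test_functions_smooth[OF \<phi>]] f'm
      note i = has_weak_gradient_inner_integrable[OF \<Omega> g \<phi> b] has_weak_gradient_inner_integrable[OF \<Omega> h \<phi> b]
      have "(LINT x|lborel. f' x * \<phi> x) = (LINT x|lebesgue_on \<Omega>. ?f x * \<phi> x)"
      proof (rule borel_transfer(2)[symmetric, OF \<Omega>])
        show "(\<lambda>x. ?f x * \<phi> x) \<in> borel_measurable (lebesgue_on \<Omega>)"
          by (intro borel_measurable_times fm measurable_lebesgue_on_borel smooth_measurable test_functions_smooth[OF \<phi>])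
        show "AE x in lebesgue_on \<Omega>. f' x * \<phi> x = ?f x * \<phi> x"
          using f' unfolding borel_rep_def by (auto elim!: eventually_mono)
      qed (use f' in \<open>auto simp: borel_rep_def\<close>)
      also have "\<dots> = (LINT x|lebesgue_on \<Omega>. (g x \<bullet> b) * \<phi> x - (h x \<bullet> b) * \<phi> x)"
        by (simp add: inner_diff_left left_diff_distrib)
      also have "\<dots> = (LINT x|lebesgue_on \<Omega>. (g x \<bullet> b) * \<phi> x) - (LINT x|lebesgue_on \<Omega>. (h x \<bullet> b) * \<phi> x)"
        by (rule Bochner_Integration.integral_diff[OF i(2,4)])
      also have "\<dots> = 0"
        using has_weak_gradientD[OF \<Omega> g \<phi> b] has_weak_gradientD[OF \<Omega> h \<phi> b] by simp
      finally show "(LINT x|lborel. f' x * \<phi> x) = 0" .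
    qed
    then have "AE x in lebesgue_on \<Omega>. f' x = 0" using \<Omega> by (simp add: AE_lebesgue_on)
    moreover have "AE x in lebesgue_on \<Omega>. f' x = ?f x" using f' by (simp add: borel_rep_def)
    ultimately show ?thesis by eventually_elim simp
  qed
  then have "AE x in lebesgue_on \<Omega>. \<forall>b\<in>Basis. (g x - h x) \<bullet> b = 0"
    by (intro AE_finite_allI) auto
  then show ?thesis
    by eventually_elim (metis euclidean_all_zero_iff right_minus_eq)
qed

lemma W1p_has_weak_gradient: "u \<in> W1p p \<Omega> w \<Longrightarrow> has_weak_gradient \<Omega> u (weak_grad \<Omega> u)"
  unfolding W1p_def weak_grad_def by (blast intro: someI_ex[of "has_weak_gradient \<Omega> u"])

lemma has_weak_gradient_weak_grad: "has_weak_gradient \<Omega> u g \<Longrightarrow> has_weak_gradient \<Omega> u (weak_grad \<Omega> u)"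
  unfolding weak_grad_def by (rule someI[of "has_weak_gradient \<Omega> u"])

lemma weak_grad_add:
  assumes \<Omega>: "open \<Omega>" and "u \<in> W1p p \<Omega> w" "v \<in> W1p p \<Omega> w"
  shows "AE x in lebesgue_on \<Omega>. weak_grad \<Omega> (\<lambda>x. u x + v x) x = weak_grad \<Omega> u x + weak_grad \<Omega> v x"
proof -
  note h = has_weak_gradient_add[OF \<Omega> assms(2,3)[THEN W1p_has_weak_gradient]]
  show ?thesis by (rule weak_gradient_unique[OF \<Omega> has_weak_gradient_weak_grad[OF h] h])
qed

lemma weak_grad_cmult:
  assumes \<Omega>: "open \<Omega>" and "u \<in> W1p p \<Omega> w"
  shows "AE x in lebesgue_on \<Omega>. weak_grad \<Omega> (\<lambda>x. a * u x) x = a *\<^sub>R weak_grad \<Omega> u x"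
proof -
  note h = has_weak_gradient_cmult[OF \<Omega> assms(2)[THEN W1p_has_weak_gradient], of a]
  show ?thesis by (rule weak_gradient_unique[OF \<Omega> has_weak_gradient_weak_grad[OF h] h])
qed

section \<open>Weighted Lebesgue spaces and duality\<close>

lemma powr_split_weight:
  fixes w :: real
  assumes "0 \<le> w" "1 / p + 1 / q = 1"
  shows "w powr (1 / q) * w powr (1 / p) = w"
  using assms by (simp add: powr_add[symmetric] add.commute)

text \<open>Hoelder's inequality after the splitting w = w^(1/q) w^(1/p), the two factors being
  absorbed into k and z.\<close>

lemma weighted_Hoelder:
  fixes k :: "'a \<Rightarrow> 'b::euclidean_space" and z :: "'a \<Rightarrow> 'c::euclidean_space"
  assumes pq: "1 < p" "1 < q" "1 / p + 1 / q = 1"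
    and [measurable]: "k \<in> borel_measurable M" "z \<in> borel_measurable M" "w \<in> borel_measurable M"
    and w: "AE x in M. 0 \<le> w x"
    and k: "integrable M (\<lambda>x. norm (k x) powr q * w x)" and z: "integrable M (\<lambda>x. norm (z x) powr p * w x)"
  shows "integrable M (\<lambda>x. norm (k x) * norm (z x) * w x)"
    "(LINT x|M. norm (k x) * norm (z x) * w x) \<le>
        (LINT x|M. norm (k x) powr q * w x) powr (1/q) * (LINT x|M. norm (z x) powr p * w x) powr (1/p)"
proof -
  let ?a = "\<lambda>x. norm (k x) * w x powr (1/q)" and ?b = "\<lambda>x. norm (z x) * w x powr (1/p)"
  have qp: "1 / q + 1 / p = 1" using pq by simp
  have a: "AE x in M. norm (k x) powr q * w x = \<bar>?a x\<bar> powr q"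
    using w by eventually_elim (use pq in \<open>simp add: powr_mult powr_powr\<close>)
  have b: "AE x in M. norm (z x) powr p * w x = \<bar>?b x\<bar> powr p"
    using w by eventually_elim (use pq in \<open>simp add: powr_mult powr_powr\<close>)
  have ab: "AE x in M. ?a x * ?b x = norm (k x) * norm (z x) * w x"
    using w
  proof eventually_elim
    case (elim x)
    have "?a x * ?b x = norm (k x) * norm (z x) * (w x powr (1/q) * w x powr (1/p))" by (simp add: mult_ac)
    then show ?case unfolding powr_split_weight[OF elim pq(3)] .
  qed
  have ia: "integrable M (\<lambda>x. \<bar>?a x\<bar> powr q)" by (rule integrable_cong_AE_imp[OF k _ a]) measurable
  have ib: "integrable M (\<lambda>x. \<bar>?b x\<bar> powr p)" by (rule integrable_cong_AE_imp[OF z _ b]) measurable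
  show "integrable M (\<lambda>x. norm (k x) * norm (z x) * w x)"
    by (rule integrable_cong_AE_imp[OF Hoelder_integrable[OF pq(2,1) qp _ _ ia ib] _ ab]) measurable
  have "(LINT x|M. norm (k x) * norm (z x) * w x) = (LINT x|M. \<bar>?a x * ?b x\<bar>)"
  proof (rule integral_cong_AE)
    show "AE x in M. norm (k x) * norm (z x) * w x = \<bar>?a x * ?b x\<bar>"
      using ab w
    proof eventually_elim
      case (elim x)
      show ?case unfolding elim(1) using elim(2) by simp
    qed
  qed measurable
  also have "\<dots> \<le> (LINT x|M. \<bar>?a x\<bar> powr q) powr (1/q) * (LINT x|M. \<bar>?b x\<bar> powr p) powr (1/p)"
    by (rule Hoelder[OF pq(2,1) qp _ _ ia ib]) measurable
  also have "(LINT x|M. \<bar>?a x\<bar> powr q) = (LINT x|M. norm (k x) powr q * w x)"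
    by (rule integral_cong_AE) (use a in \<open>auto elim: eventually_mono\<close>)
  also have "(LINT x|M. \<bar>?b x\<bar> powr p) = (LINT x|M. norm (z x) powr p * w x)"
    by (rule integral_cong_AE) (use b in \<open>auto elim: eventually_mono\<close>)
  finally show "(LINT x|M. norm (k x) * norm (z x) * w x) \<le>
        (LINT x|M. norm (k x) powr q * w x) powr (1/q) * (LINT x|M. norm (z x) powr p * w x) powr (1/p)" .
qed

lemma weighted_pairing:
  fixes k z :: "'a \<Rightarrow> 'b::euclidean_space"
  assumes pq: "1 < p" "1 < q" "1 / p + 1 / q = 1"
    and [measurable]: "k \<in> borel_measurable M" "z \<in> borel_measurable M" "w \<in> borel_measurable M"
    and w: "AE x in M. 0 \<le> w x"
    and k: "integrable M (\<lambda>x. norm (k x) powr q * w x)" and z: "integrable M (\<lambda>x. norm (z x) powr p * w x)"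
  shows "integrable M (\<lambda>x. (k x \<bullet> z x) * w x)"
    "\<bar>LINT x|M. (k x \<bullet> z x) * w x\<bar> \<le>
        (LINT x|M. norm (k x) powr q * w x) powr (1/q) * (LINT x|M. norm (z x) powr p * w x) powr (1/p)"
proof -
  have le: "AE x in M. norm ((k x \<bullet> z x) * w x) \<le> norm (k x) * norm (z x) * w x"
    using w by eventually_elim (simp add: abs_mult mult_right_mono Cauchy_Schwarz_ineq2)
  note H = weighted_Hoelder[OF assms]
  show i: "integrable M (\<lambda>x. (k x \<bullet> z x) * w x)"
    by (rule Bochner_Integration.integrable_bound[OF H(1)]) (use le in \<open>auto elim!: eventually_mono\<close>)
  have "\<bar>LINT x|M. (k x \<bullet> z x) * w x\<bar> \<le> (LINT x|M. norm ((k x \<bullet> z x) * w x))"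
    using integral_norm_bound[of M "\<lambda>x. (k x \<bullet> z x) * w x"] by simp
  also have "\<dots> \<le> (LINT x|M. norm (k x) * norm (z x) * w x)"
    by (rule integral_mono_AE[OF integrable_norm[OF i] H(1) le])
  finally show "\<bar>LINT x|M. (k x \<bullet> z x) * w x\<bar> \<le>
        (LINT x|M. norm (k x) powr q * w x) powr (1/q) * (LINT x|M. norm (z x) powr p * w x) powr (1/p)"
    using H(2) by linarith
qed

text \<open>Below, \<open>T\<close> is either the identity or the weak gradient.\<close>

locale sobolev_operator =
  fixes \<Omega> :: "'a::euclidean_space set" and p q :: real and w :: "'a \<Rightarrow> real" and T :: "('a \<Rightarrow> real) \<Rightarrow> 'a \<Rightarrow> 'b::euclidean_space"
  assumes pq: "1 < p" "1 < q" "1 / p + 1 / q = 1"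
    and wm [measurable]: "w \<in> borel_measurable (lebesgue_on \<Omega>)" and w: "AE x in lebesgue_on \<Omega>. 0 \<le> w x"
    and Tm: "\<And>v. v \<in> W1p p \<Omega> w \<Longrightarrow> T v \<in> borel_measurable (lebesgue_on \<Omega>)"
    and Ti: "\<And>v. v \<in> W1p p \<Omega> w \<Longrightarrow> integrable (lebesgue_on \<Omega>) (\<lambda>x. norm (T v x) powr p * w x)"
    and Tle: "\<And>v. v \<in> W1p p \<Omega> w \<Longrightarrow> (LINT x|lebesgue_on \<Omega>. norm (T v x) powr p * w x) powr (1/p) \<le> W1p_norm p \<Omega> w v"
    and Tadd_m: "\<And>u v. u \<in> W1p p \<Omega> w \<Longrightarrow> v \<in> W1p p \<Omega> w \<Longrightarrow> T (\<lambda>x. u x + v x) \<in> borel_measurable (lebesgue_on \<Omega>)"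
    and Tcmult_m: "\<And>u a. u \<in> W1p p \<Omega> w \<Longrightarrow> T (\<lambda>x. a * u x) \<in> borel_measurable (lebesgue_on \<Omega>)"
    and Tadd: "\<And>u v. u \<in> W1p p \<Omega> w \<Longrightarrow> v \<in> W1p p \<Omega> w \<Longrightarrow> AE x in lebesgue_on \<Omega>. T (\<lambda>x. u x + v x) x = T u x + T v x"
    and Tcmult: "\<And>u a. u \<in> W1p p \<Omega> w \<Longrightarrow> AE x in lebesgue_on \<Omega>. T (\<lambda>x. a * u x) x = a *\<^sub>R T u x"
begin

abbreviation "M \<equiv> lebesgue_on \<Omega>"

definition "N v = (LINT x|M. norm (T v x) powr p * w x) powr (1/p)"

text \<open>Membership in L^q(w). Because the pairing \<open>Fk\<close> keeps the weight, the dual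
  exponent comes with w itself and not with a power of it.\<close>

definition "dual_ok (k :: 'a \<Rightarrow> 'b) \<longleftrightarrow> k \<in> borel_measurable M \<and> integrable M (\<lambda>x. norm (k x) powr q * w x)"

definition "Fk (k :: 'a \<Rightarrow> 'b) v = (LINT x|M. (k x \<bullet> T v x) * w x)"

lemma Fk_bound:
  assumes k: "dual_ok k" and v: "v \<in> W1p p \<Omega> w"
  shows "\<bar>Fk k v\<bar> \<le> (LINT x|M. norm (k x) powr q * w x) powr (1/q) * N v"
    "integrable M (\<lambda>x. (k x \<bullet> T v x) * w x)"
  using weighted_pairing[OF pq _ Tm[OF v] wm w _ Ti[OF v]] k unfolding dual_ok_def Fk_def N_def by auto

lemma Fk_add:
  assumes k: "dual_ok k" and u: "u \<in> W1p p \<Omega> w" and v: "v \<in> W1p p \<Omega> w"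
  shows "Fk k (\<lambda>x. u x + v x) = Fk k u + Fk k v"
proof -
  have [measurable]: "k \<in> borel_measurable M" "T u \<in> borel_measurable M" "T v \<in> borel_measurable M"
    "T (\<lambda>x. u x + v x) \<in> borel_measurable M"
    using k Tm Tadd_m u v by (auto simp: dual_ok_def)
  have "Fk k (\<lambda>x. u x + v x) = (LINT x|M. (k x \<bullet> T u x) * w x + (k x \<bullet> T v x) * w x)"
    unfolding Fk_def
  proof (rule integral_cong_AE)
    show "AE x in M. (k x \<bullet> T (\<lambda>x. u x + v x) x) * w x = (k x \<bullet> T u x) * w x + (k x \<bullet> T v x) * w x"
      using Tadd[OF u v] by eventually_elim (simp add: inner_add_right distrib_right)
  qed measurable
  also have "\<dots> = Fk k u + Fk k v"
    unfolding Fk_def by (rule Bochner_Integration.integral_add) (use Fk_bound(2)[OF k] u v in auto)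
  finally show ?thesis .
qed

lemma Fk_cmult:
  assumes k: "dual_ok k" and u: "u \<in> W1p p \<Omega> w"
  shows "Fk k (\<lambda>x. a * u x) = a * Fk k u"
proof -
  have [measurable]: "k \<in> borel_measurable M" "T u \<in> borel_measurable M" "T (\<lambda>x. a * u x) \<in> borel_measurable M"
    using k Tm Tcmult_m u by (auto simp: dual_ok_def)
  have "Fk k (\<lambda>x. a * u x) = (LINT x|M. a * ((k x \<bullet> T u x) * w x))"
    unfolding Fk_def
  proof (rule integral_cong_AE)
    show "AE x in M. (k x \<bullet> T (\<lambda>x. a * u x) x) * w x = a * ((k x \<bullet> T u x) * w x)"
      using Tcmult[OF u, of a] by eventually_elim simp
  qed measurable
  then show ?thesis by (simp add: Fk_def)
qed

lemma N_le: "v \<in> W1p p \<Omega> w \<Longrightarrow> N v \<le> W1p_norm p \<Omega> w v"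
  unfolding N_def by (rule Tle)

lemma Fk_dual:
  assumes k: "dual_ok k"
  shows "Fk k \<in> W1p_dual p \<Omega> w"
  unfolding W1p_dual_def
proof (intro CollectI conjI ballI allI)
  show "\<exists>C. \<forall>u\<in>W1p p \<Omega> w. \<bar>Fk k u\<bar> \<le> C * W1p_norm p \<Omega> w u"
  proof (intro exI ballI)
    fix u assume u: "u \<in> W1p p \<Omega> w"
    show "\<bar>Fk k u\<bar> \<le> (LINT x|M. norm (k x) powr q * w x) powr (1/q) * W1p_norm p \<Omega> w u"
      using N_le[OF u] by (intro order_trans[OF Fk_bound(1)[OF k u]] mult_left_mono) auto
  qed
qed (auto simp: Fk_add[OF k] Fk_cmult[OF k])

lemma Fk_tendsto:
  assumes "W1p_weakly_tendsto p \<Omega> w us u" "dual_ok k"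
  shows "(\<lambda>n. LINT x|M. (k x \<bullet> T (us n) x) * w x) \<longlonglongrightarrow> (LINT x|M. (k x \<bullet> T u x) * w x)"
proof -
  have "(\<lambda>n. Fk k (us n)) \<longlonglongrightarrow> Fk k u"
    using assms(1) Fk_dual[OF assms(2)] by (simp add: W1p_weakly_tendsto_def)
  then show ?thesis unfolding Fk_def .
qed

text \<open>The extremal case of Hoelder's inequality: k is the multiple of |Tv|^(p-2) Tv that has
  norm 1 in L^q(w).\<close>

lemma norming:
  assumes v: "v \<in> W1p p \<Omega> w"
  obtains k where "dual_ok k" "Fk k v = N v" "\<And>u. u \<in> W1p p \<Omega> w \<Longrightarrow> \<bar>Fk k u\<bar> \<le> N u"
proof (cases "N v = 0")
  case True
  have "dual_ok (\<lambda>x. 0)" using pq by (simp add: dual_ok_def)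
  moreover have "Fk (\<lambda>x. 0) u = 0" for u by (simp add: Fk_def)
  moreover have "0 \<le> N u" for u by (simp add: N_def)
  ultimately show ?thesis using that[of "\<lambda>x. 0"] True by simp
next
  case False
  have [measurable]: "T v \<in> borel_measurable M" by (rule Tm[OF v])
  define I where "I = (LINT x|M. norm (T v x) powr p * w x)"
  have NI: "N v = I powr (1/p)" by (simp add: N_def I_def)
  have I0: "0 \<le> I" unfolding I_def using w by (intro integral_nonneg_AE) (auto elim: eventually_mono)
  with False NI have I: "0 < I" by (cases "I = 0") auto
  then have N: "0 < N v" "N v powr p = I" using NI pq by (auto simp: powr_powr)
  \<comment> \<open>Since (p-1)q = p, the q-th power of the norm of |Tv|^(p-2) Tv is I, the p-th
    power of \<open>N v\<close>; the q-th power of c is its inverse.\<close>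
  define c where "c = N v powr (1 - p)"
  have c: "0 < c" using N by (simp add: c_def)
  define k where "k x = (c * norm (T v x) powr (p - 2)) *\<^sub>R T v x" for x
  have [measurable]: "k \<in> borel_measurable M" unfolding k_def by measurable
  have qp: "q = p / (p - 1)" "(p - 1) * q = p" using pq by (auto simp: field_simps)
  have nk: "norm (k x) = c * norm (T v x) powr (p - 1)" for x
  proof (cases "T v x = 0")
    case True then show ?thesis by (simp add: k_def)
  next
    case False
    then have "norm (T v x) powr (p - 2) * norm (T v x) = norm (T v x) powr (p - 1)"
      using powr_add[of "norm (T v x)" "p - 2" 1] by simp
    then show ?thesis using c by (simp add: k_def)
  qed
  have nkq: "norm (k x) powr q * w x = c powr q * (norm (T v x) powr p * w x)" for x
    unfolding nk using c by (simp add: powr_mult powr_powr qp(2))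
  have ki: "integrable M (\<lambda>x. norm (k x) powr q * w x)"
    unfolding nkq using Ti[OF v] by simp
  have cq: "c powr q * I = 1"
  proof -
    have "c powr q = N v powr (- p)" unfolding c_def powr_powr using qp(2) by (simp add: algebra_simps)
    then show ?thesis unfolding N(2)[symmetric] using N(1) by (simp add: powr_add[symmetric])
  qed
  have kI: "(LINT x|M. norm (k x) powr q * w x) = 1"
    unfolding nkq using cq by (simp add: I_def)
  have dk: "dual_ok k" using ki by (simp add: dual_ok_def)
  have "(k x \<bullet> T v x) * w x = c * (norm (T v x) powr p * w x)" for x
  proof (cases "T v x = 0")
    case True then show ?thesis using pq by (simp add: k_def)
  next
    case False
    then have "norm (T v x) powr (p - 2) * (norm (T v x))\<^sup>2 = norm (T v x) powr p"
      using powr_add[of "norm (T v x)" "p - 2" 2] by simp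
    then show ?thesis by (simp add: k_def power2_norm_eq_inner[symmetric] mult.assoc)
  qed
  then have "Fk k v = c * I" by (simp only: Fk_def I_def integral_mult_right_zero)
  also have "c * I = N v powr (1 - p) * N v powr p" by (simp add: c_def N(2))
  also have "\<dots> = N v" using N(1) by (simp add: powr_add[symmetric])
  finally have "Fk k v = N v" .
  moreover have "\<bar>Fk k u\<bar> \<le> N u" if "u \<in> W1p p \<Omega> w" for u
    using Fk_bound(1)[OF dk that] unfolding kI by simp
  ultimately show ?thesis using that dk by blast
qed

text \<open>The gliding hump applies to norming functionals, because every series of them with
  coefficients of modulus 3^(-k) is again a bounded functional on W^{1,p}; weak convergence then
  makes it bounded along the sequence.\<close>

lemma weakly_convergent_bounded:
  assumes conv: "W1p_weakly_tendsto p \<Omega> w us u"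
  shows "\<exists>B. \<forall>n. (LINT x|M. norm (T (us n) x) powr p * w x) \<le> B"
proof -
  have us: "us n \<in> W1p p \<Omega> w" for n using conv by (simp add: W1p_weakly_tendsto_def)
  have "\<exists>k. dual_ok k \<and> Fk k (us n) = N (us n) \<and> (\<forall>u\<in>W1p p \<Omega> w. \<bar>Fk k u\<bar> \<le> N u)" for n
    using norming[OF us[of n]] by metis
  then obtain K where K: "\<And>n. dual_ok (K n)" "\<And>n. Fk (K n) (us n) = N (us n)"
    "\<And>n u. u \<in> W1p p \<Omega> w \<Longrightarrow> \<bar>Fk (K n) u\<bar> \<le> N u" by metis
  have "\<exists>B. \<forall>n. N (us n) \<le> B"
  proof (rule gliding_hump[where \<Phi> = "\<lambda>n. Fk (K n)" and u = us and N = N])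
    fix a :: "nat \<Rightarrow> real" and m :: "nat \<Rightarrow> nat" assume a: "\<And>k. \<bar>a k\<bar> = (1/3) ^ k"
    define F where "F v = (\<Sum>k. a k * Fk (K (m k)) v)" for v
    have bnd: "norm (a k * Fk (K (m k)) v) \<le> (1/3) ^ k * N v" if "v \<in> W1p p \<Omega> w" for k v
      using K(3)[OF that] by (simp add: abs_mult a mult_left_mono)
    have geo: "summable (\<lambda>k. (1/3) ^ k * N v)" for v by (intro summable_mult2 summable_geometric) simp
    have sm: "summable (\<lambda>k. a k * Fk (K (m k)) v)" if "v \<in> W1p p \<Omega> w" for v
      by (rule summable_comparison_test'[OF geo bnd[OF that]])
    have "F \<in> W1p_dual p \<Omega> w"
      unfolding W1p_dual_def
    proof (intro CollectI conjI ballI allI)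
      fix u v assume uv: "u \<in> W1p p \<Omega> w" "v \<in> W1p p \<Omega> w"
      show "F (\<lambda>x. u x + v x) = F u + F v"
        unfolding F_def Fk_add[OF K(1) uv] distrib_left by (rule suminf_add[OF sm sm, symmetric]) (use uv in auto)
    next
      fix u a assume u: "u \<in> W1p p \<Omega> w"
      show "F (\<lambda>x. a * u x) = a * F u"
        unfolding F_def Fk_cmult[OF K(1) u] suminf_mult[OF sm[OF u], symmetric] by (simp add: mult_ac)
    next
      show "\<exists>C. \<forall>u\<in>W1p p \<Omega> w. \<bar>F u\<bar> \<le> C * W1p_norm p \<Omega> w u"
      proof (intro exI ballI)
        fix u assume u: "u \<in> W1p p \<Omega> w"
        have "norm (F u) \<le> (\<Sum>k. (1/3) ^ k * N u)"
          unfolding F_def by (rule norm_suminf_le[OF bnd[OF u] geo])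
        also have "\<dots> = 3/2 * N u"
          by (subst suminf_mult2[symmetric]) (auto simp: suminf_geometric summable_geometric)
        also have "\<dots> \<le> 3/2 * W1p_norm p \<Omega> w u" using N_le[OF u] by simp
        finally show "\<bar>F u\<bar> \<le> 3/2 * W1p_norm p \<Omega> w u" by simp
      qed
    qed
    then have "(\<lambda>n. F (us n)) \<longlonglongrightarrow> F u" using conv by (simp add: W1p_weakly_tendsto_def)
    then show "Bseq (\<lambda>n. \<Sum>k. a k * Fk (K (m k)) (us n))"
      unfolding F_def by (intro convergent_imp_Bseq) (auto simp: convergent_def)
  qed (use K us in auto)
  then obtain B where B: "\<And>n. N (us n) \<le> B" by blast
  have "(LINT x|M. norm (T (us n) x) powr p * w x) \<le> B powr p" for n
  proof -
    have "0 \<le> (LINT x|M. norm (T (us n) x) powr p * w x)"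
      using w by (intro integral_nonneg_AE) (auto elim: eventually_mono)
    then have "(LINT x|M. norm (T (us n) x) powr p * w x) = N (us n) powr p"
      using pq by (simp add: N_def powr_powr)
    also have "\<dots> \<le> B powr p" using B[of n] pq by (intro powr_mono2) (auto simp: N_def)
    finally show ?thesis .
  qed
  then show ?thesis by blast
qed

end

section \<open>Almost everywhere convergence from local averages\<close>

lemma bump_integrable_bounded:
  fixes f :: "'a::euclidean_space \<Rightarrow> real"
  assumes "0 < r" "f \<in> borel_measurable borel" "\<And>x. \<bar>f x\<bar> \<le> B"
  shows "integrable lborel (\<lambda>x. bump x0 r x * f x)"
  using integrable_bounded_mult[OF integrable_bump[OF assms(1), of x0], of f B] assms(2,3)
  by (simp add: mult.commute)

text \<open>Summing the bumps of a countable cover with weights 2^(-j) gives one function S that is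
  positive on \<Omega>. As S f_n tends to 0 in L^1, a single extraction serves all of \<Omega>, and
  division by S recovers f_n.\<close>

lemma AE_subseq_of_bumps:
  fixes f :: "nat \<Rightarrow> 'a::euclidean_space \<Rightarrow> real"
  assumes \<Omega>: "open \<Omega>" "bounded \<Omega>" "\<Omega> \<noteq> {}"
    and fm [measurable]: "\<And>n. f n \<in> borel_measurable borel" and f: "\<And>n x. 0 \<le> f n x" "\<And>n x. f n x \<le> 1"
    and lim: "\<And>x0 r. 0 < r \<Longrightarrow> cball x0 (2 * r) \<subseteq> \<Omega> \<Longrightarrow> (\<lambda>n. LINT x|lborel. bump x0 r x * f n x) \<longlonglongrightarrow> 0"
  shows "\<exists>r. strict_mono r \<and> (AE x in lborel. x \<in> \<Omega> \<longrightarrow> (\<lambda>n. f (r n) x) \<longlonglongrightarrow> 0)"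
proof -
  define \<F> where "\<F> = {ball x0 r | x0 r. 0 < r \<and> cball x0 (2 * r) \<subseteq> \<Omega>}"
  have cover: "\<exists>B\<in>\<F>. x \<in> B" if "x \<in> \<Omega>" for x
  proof -
    have "\<exists>e>0. cball x e \<subseteq> \<Omega>" by (rule open_contains_cball[THEN iffD1, OF \<Omega>(1), rule_format, OF that])
    then obtain e where e: "0 < e" "cball x e \<subseteq> \<Omega>" by auto
    have "ball x (e / 2) \<in> \<F>"
      unfolding \<F>_def by (intro CollectI exI[of _ x] exI[of _ "e / 2"]) (use e in simp)
    moreover have "x \<in> ball x (e / 2)" using e by simp
    ultimately show ?thesis by (rule bexI[rotated])
  qed
  obtain \<F>' where \<F>': "\<F>' \<subseteq> \<F>" "countable \<F>'" "\<Union>\<F>' = \<Union>\<F>"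
    using Lindelof[of \<F>] unfolding \<F>_def by auto
  \<comment> \<open>\<open>from_nat_into\<close> has the set as its range only when the set is
    nonempty; this is where \<Omega> being nonempty enters.\<close>
  have "\<F>' \<noteq> {}"
  proof -
    obtain x where "x \<in> \<Omega>" using \<Omega>(3) by auto
    then have "x \<in> \<Union>\<F>" using cover[of x] by (simp add: Union_iff)
    then have "x \<in> \<Union>\<F>'" unfolding \<F>'(3) .
    then show ?thesis by auto
  qed
  then have rng: "range (from_nat_into \<F>') = \<F>'" using \<F>'(2) by (rule range_from_nat_into)
  have "\<exists>y. 0 < snd y \<and> cball (fst y) (2 * snd y) \<subseteq> \<Omega> \<and> from_nat_into \<F>' j = ball (fst y) (snd y)" for j
  proof -
    have "from_nat_into \<F>' j \<in> \<F>" using rng \<F>'(1) by blast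
    then obtain x0 r where "0 < r" "cball x0 (2 * r) \<subseteq> \<Omega>" "from_nat_into \<F>' j = ball x0 r" unfolding \<F>_def by auto
    then show ?thesis by (intro exI[of _ "(x0, r)"]) auto
  qed
  then have "\<forall>j. \<exists>y. 0 < snd y \<and> cball (fst y) (2 * snd y) \<subseteq> \<Omega> \<and> from_nat_into \<F>' j = ball (fst y) (snd y)" ..
  from choice[OF this] obtain Y where Y: "\<forall>j. 0 < snd (Y j) \<and> cball (fst (Y j)) (2 * snd (Y j)) \<subseteq> \<Omega>
     \<and> from_nat_into \<F>' j = ball (fst (Y j)) (snd (Y j))" ..
  define \<phi> where "\<phi> j = bump (fst (Y j)) (snd (Y j))" for j
  have [measurable]: "\<phi> j \<in> borel_measurable borel" for j by (simp add: \<phi>_def)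
  have \<phi>01: "0 \<le> \<phi> j x" "\<phi> j x \<le> 1" for j x by (simp_all add: \<phi>_def bump_nonneg bump_le_1)
  define d where "d j n = (LINT x|lborel. \<phi> j x * f n x)" for j n
  have d0: "(\<lambda>n. d j n) \<longlonglongrightarrow> 0" for j unfolding d_def \<phi>_def using Y lim by blast
  have \<phi>i: "integrable lborel (\<phi> j)" for j unfolding \<phi>_def using Y by (intro integrable_bump) auto
  have \<phi>fi: "integrable lborel (\<lambda>x. \<phi> j x * f n x)" for j n
    unfolding \<phi>_def using Y f by (intro bump_integrable_bounded[where B = 1]) auto
  have \<phi>out: "\<phi> j x = 0" if "x \<notin> \<Omega>" for j x
  proof -
    have "ball (fst (Y j)) (snd (Y j)) \<subseteq> cball (fst (Y j)) (2 * snd (Y j))"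
      using Y[rule_format, of j] by auto
    then have "x \<notin> ball (fst (Y j)) (snd (Y j))" using Y that by blast
    then show ?thesis unfolding \<phi>_def using Y by (intro bump_eq_0) auto
  qed
  define L where "L = measure lborel \<Omega>"
  have [measurable]: "\<Omega> \<in> sets borel" using \<Omega>(1) by simp
  have \<Omega>fin: "emeasure lborel \<Omega> < \<infinity>" using \<Omega>(2) by (rule emeasure_bounded_finite)
  have Li: "integrable lborel (indicator \<Omega> :: 'a \<Rightarrow> real)" using \<Omega>fin by (intro integrable_real_indicator) auto
  have dL: "0 \<le> d j n" "d j n \<le> L" for j n
  proof -
    show "0 \<le> d j n" unfolding d_def using \<phi>01 f by (intro integral_nonneg_AE) auto
    have "d j n \<le> (LINT x|lborel. indicator \<Omega> x)" unfolding d_def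
    proof (rule integral_mono[OF \<phi>fi Li])
      show "\<phi> j x * f n x \<le> indicator \<Omega> x" for x
        using \<phi>out[of x j] \<phi>01[of j x] f[of n x] by (cases "x \<in> \<Omega>") (auto intro: mult_le_one)
    qed
    then show "d j n \<le> L" by (simp add: L_def)
  qed
  have sg: "summable (\<lambda>j. (1/2) ^ j * c)" for c :: real by (intro summable_mult2 summable_geometric) simp
  have D0: "(\<lambda>n. \<Sum>j. (1/2) ^ j * d j n) \<longlonglongrightarrow> 0"
  proof -
    have "(\<lambda>n. \<Sum>j. (1/2) ^ j * d j n) \<longlonglongrightarrow> (\<Sum>j. (0::real))"
    \<comment> \<open>The limit in n passes through the sum over j, each integral being at most the
      volume L of \<Omega>.\<close>
    proof (rule tannerys_theorem[where M = "\<lambda>j. (1/2) ^ j * L", THEN conjunct2, THEN conjunct2])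
      show "(\<lambda>n. (1/2) ^ j * d j n) \<longlonglongrightarrow> 0" for j by (intro tendsto_mult_right_zero d0)
      show "eventually (\<lambda>(k, n). norm ((1/2) ^ k * d k n) \<le> (1/2) ^ k * L) (at_top \<times>\<^sub>F sequentially)"
        using dL by (intro always_eventually) (auto simp: abs_mult)
    qed (use sg in auto)
    then show ?thesis by simp
  qed
  define S where "S x = (\<Sum>j. (1/2) ^ j * \<phi> j x)" for x
  have [measurable]: "S \<in> borel_measurable borel" unfolding S_def by measurable
  have sm: "summable (\<lambda>j. (1/2) ^ j * \<phi> j x)" for x
    by (rule summable_comparison_test'[OF sg[of 1]]) (use \<phi>01 in \<open>simp add: mult_left_le\<close>)
  have S0: "0 \<le> S x" for x unfolding S_def using \<phi>01 by (intro suminf_nonneg sm) auto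
  have S2: "S x \<le> 2" for x
  proof -
    have "S x \<le> (\<Sum>j. (1/2) ^ j * 1)" unfolding S_def by (intro suminf_le sm sg) (use \<phi>01 in \<open>simp add: mult_left_le\<close>)
    then show ?thesis by (simp add: suminf_geometric)
  qed
  have Spos: "0 < S x" if "x \<in> \<Omega>" for x
  proof -
    have "x \<in> \<Union>\<F>'" unfolding \<F>'(3) using cover[OF that] by (simp add: Union_iff)
    then obtain B where B: "B \<in> \<F>'" "x \<in> B" by (rule UnionE)
    have "B \<in> range (from_nat_into \<F>')" using B(1) unfolding rng .
    then obtain j where j: "B = from_nat_into \<F>' j" by (rule rangeE)
    have "0 < \<phi> j x" unfolding \<phi>_def
      using Y[rule_format, of j] B(2) j by (subst bump_pos_iff) simp_all
    then show ?thesis unfolding S_def using \<phi>01 by (intro suminf_pos2[OF sm, where i = j]) auto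
  qed
  have Sout: "S x = 0" if "x \<notin> \<Omega>" for x unfolding S_def using \<phi>out[OF that] by simp
  have Sfi: "integrable lborel (\<lambda>x. S x * f n x)" for n
  proof (rule Bochner_Integration.integrable_bound)
    show "integrable lborel (\<lambda>x. 2 * indicator \<Omega> x :: real)" using Li by simp
    show "AE x in lborel. norm (S x * f n x) \<le> norm (2 * indicator \<Omega> x :: real)"
    proof (rule AE_I2)
      fix x
      have "S x * f n x \<le> 2 * 1" using S0 S2 f by (intro mult_mono) auto
      then show "norm (S x * f n x) \<le> norm (2 * indicator \<Omega> x :: real)"
        using S0[of x] f[of n x] Sout[of x] by (cases "x \<in> \<Omega>") auto
    qed
  qed measurable
  have "(LINT x|lborel. norm (S x * f n x)) = (\<Sum>j. (1/2) ^ j * d j n)" for n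
  proof -
    have smd: "summable (\<lambda>j. (1/2) ^ j * d j n)"
      by (rule summable_comparison_test'[OF sg[of L]]) (use dL in \<open>simp add: abs_mult\<close>)
    have "ennreal (LINT x|lborel. S x * f n x) = (\<integral>\<^sup>+x. ennreal (S x * f n x) \<partial>lborel)"
      using S0 f by (intro nn_integral_eq_integral[symmetric] Sfi) auto
    also have "\<dots> = (\<integral>\<^sup>+x. (\<Sum>j. ennreal ((1/2) ^ j * (\<phi> j x * f n x))) \<partial>lborel)"
    proof (rule nn_integral_cong)
      fix x
      have "S x * f n x = (\<Sum>j. (1/2) ^ j * \<phi> j x * f n x)" unfolding S_def by (rule suminf_mult2[OF sm])
      moreover have "(\<Sum>j. ennreal ((1/2) ^ j * \<phi> j x * f n x)) = ennreal (\<Sum>j. (1/2) ^ j * \<phi> j x * f n x)"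
        using \<phi>01 f by (intro suminf_ennreal2 summable_mult2 sm) auto
      ultimately show "ennreal (S x * f n x) = (\<Sum>j. ennreal ((1/2) ^ j * (\<phi> j x * f n x)))"
        by (simp add: mult.assoc)
    qed
    also have "\<dots> = (\<Sum>j. \<integral>\<^sup>+x. ennreal ((1/2) ^ j * (\<phi> j x * f n x)) \<partial>lborel)"
      by (rule nn_integral_suminf) measurable
    also have "\<dots> = (\<Sum>j. ennreal ((1/2) ^ j * d j n))"
    proof (rule arg_cong[where f = suminf], rule ext)
      fix j
      have "(\<integral>\<^sup>+x. ennreal ((1/2) ^ j * (\<phi> j x * f n x)) \<partial>lborel) = ennreal (LINT x|lborel. (1/2) ^ j * (\<phi> j x * f n x))"
        using \<phi>01 f by (intro nn_integral_eq_integral integrable_mult_right \<phi>fi) auto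
      then show "(\<integral>\<^sup>+x. ennreal ((1/2) ^ j * (\<phi> j x * f n x)) \<partial>lborel) = ennreal ((1/2) ^ j * d j n)"
        by (simp add: d_def)
    qed
    also have "\<dots> = ennreal (\<Sum>j. (1/2) ^ j * d j n)"
      using dL smd by (intro suminf_ennreal2) auto
    finally have "(LINT x|lborel. S x * f n x) = (\<Sum>j. (1/2) ^ j * d j n)"
      using dL smd S0 f by (subst (asm) ennreal_inj) (auto intro!: integral_nonneg_AE suminf_nonneg)
    moreover have "norm (S x * f n x) = S x * f n x" for x using S0[of x] f[of n x] by simp
    ultimately show ?thesis by simp
  qed
  with D0 have "(\<lambda>n. LINT x|lborel. norm (S x * f n x)) \<longlonglongrightarrow> 0" by simp
  from tendsto_L1_AE_subseq[OF Sfi this]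
  obtain r where r: "strict_mono r" "AE x in lborel. (\<lambda>n. S x * f (r n) x) \<longlonglongrightarrow> 0" by blast
  from r(2) have "AE x in lborel. x \<in> \<Omega> \<longrightarrow> (\<lambda>n. f (r n) x) \<longlonglongrightarrow> 0"
  proof eventually_elim
    case (elim x)
    show ?case
    proof
      assume "x \<in> \<Omega>"
      then have "0 < S x" by (rule Spos)
      moreover have "(\<lambda>n. inverse (S x) * (S x * f (r n) x)) \<longlonglongrightarrow> inverse (S x) * 0" by (intro tendsto_mult tendsto_const elim)
      ultimately show "(\<lambda>n. f (r n) x) \<longlonglongrightarrow> 0" by (simp add: mult.assoc[symmetric])
    qed
  qed
  with r(1) show ?thesis by blast
qed

section \<open>Local compactness in weighted Sobolev spaces\<close>

text \<open>Here W stands for a Borel representative of the weight, positive at every point, so that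
  W may be divided by without exceptional sets.\<close>

locale Ap_domain =
  fixes \<Omega> :: "'a::euclidean_space set" and p q c :: real and W :: "'a \<Rightarrow> real"
  assumes \<Omega>o: "open \<Omega>" and \<Omega>b: "bounded \<Omega>"
    and pq: "1 < p" "1 < q" "1 / p + 1 / q = 1"
    and Wm [measurable]: "W \<in> borel_measurable borel" and Wpos: "\<And>x. 0 < W x"
    and Wi: "\<And>x r. 0 < r \<Longrightarrow> set_integrable lborel (ball x r) W"
    and Si: "\<And>x r. 0 < r \<Longrightarrow> set_integrable lborel (ball x r) (\<lambda>y. W y powr (- 1 / (p - 1)))"
    and Ap: "\<And>x r. 0 < r \<Longrightarrow> (1 / measure lborel (ball x r) * (LINT y:ball x r|lborel. W y)) *
      (1 / measure lborel (ball x r) * (LINT y:ball x r|lborel. W y powr (- 1 / (p - 1)))) powr (p - 1) \<le> c"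
begin

definition Lp :: "('a \<Rightarrow> 'b::euclidean_space) \<Rightarrow> bool" where
  "Lp z \<longleftrightarrow> z \<in> borel_measurable borel \<and> (\<forall>x. x \<notin> \<Omega> \<longrightarrow> z x = 0) \<and> integrable lborel (\<lambda>x. norm (z x) powr p * W x)"

definition Lq :: "('a \<Rightarrow> 'b::euclidean_space) \<Rightarrow> bool" where
  "Lq k \<longleftrightarrow> k \<in> borel_measurable borel \<and> integrable lborel (\<lambda>x. norm (k x) powr q * W x)"

definition Ip :: "('a \<Rightarrow> 'b::euclidean_space) \<Rightarrow> real" where
  "Ip z = (LINT x|lborel. norm (z x) powr p * W x)"

definition Iq :: "('a \<Rightarrow> 'b::euclidean_space) \<Rightarrow> real" where
  "Iq k = (LINT x|lborel. norm (k x) powr q * W x)"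

lemma LpD: "Lp z \<Longrightarrow> z \<in> borel_measurable borel" "Lp z \<Longrightarrow> x \<notin> \<Omega> \<Longrightarrow> z x = 0"
  "Lp z \<Longrightarrow> integrable lborel (\<lambda>x. norm (z x) powr p * W x)"
  by (simp_all add: Lp_def)

lemma \<Omega>_sets [measurable]: "\<Omega> \<in> sets borel" using \<Omega>o by simp

lemma \<Omega>_ball: obtains R where "0 < R" "\<Omega> \<subseteq> ball 0 R"
  using \<Omega>b bounded_subset_ballD[of \<Omega> 0] by auto

lemma W_integrable: "integrable lborel (\<lambda>x. indicator \<Omega> x * W x)"
proof -
  obtain R where R: "0 < R" "\<Omega> \<subseteq> ball 0 R" by (rule \<Omega>_ball)
  have "integrable lborel (\<lambda>x. indicator (ball 0 R) x *\<^sub>R W x)" using Wi[OF R(1)] by (simp add: set_integrable_def)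
  then show ?thesis
    by (rule Bochner_Integration.integrable_bound) (use R Wpos in \<open>auto simp: indicator_def subset_iff intro!: AE_I2\<close>)
qed

lemma S_integrable: "integrable lborel (\<lambda>x. indicator \<Omega> x * W x powr (- 1 / (p - 1)))"
proof -
  obtain R where R: "0 < R" "\<Omega> \<subseteq> ball 0 R" by (rule \<Omega>_ball)
  have "integrable lborel (\<lambda>x. indicator (ball 0 R) x *\<^sub>R W x powr (- 1 / (p - 1)))"
    using Si[OF R(1)] by (simp add: set_integrable_def)
  then show ?thesis
    by (rule Bochner_Integration.integrable_bound) (use R in \<open>auto simp: indicator_def subset_iff intro!: AE_I2\<close>)
qed

lemma qm1: "1 - q = - 1 / (p - 1)" "(p - 1) * q = p"
  using pq by (auto simp: field_simps)

text \<open>Integration against a bounded function \<eta> over \<Omega> is the weighted pairing with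
  \<eta>/W. This lies in L^q(W) because (1/W)^q W = W^(1-q) = W^(-1/(p-1)), the dual weight of the
  A_p condition.\<close>

lemma Lq_over_W:
  assumes \<eta>: "(\<eta> :: 'a \<Rightarrow> real) \<in> borel_measurable borel" "\<And>x. \<bar>\<eta> x\<bar> \<le> B"
  shows "Lq (\<lambda>x. indicator \<Omega> x * \<eta> x / W x)"
proof -
  note [measurable] = \<eta>(1)
  have "integrable lborel (\<lambda>x. norm (indicator \<Omega> x * \<eta> x / W x) powr q * W x)"
  proof (rule Bochner_Integration.integrable_bound)
    show "integrable lborel (\<lambda>x. B powr q * (indicator \<Omega> x * W x powr (- 1 / (p - 1))))"
      using S_integrable by simp
    show "AE x in lborel. norm (norm (indicator \<Omega> x * \<eta> x / W x) powr q * W x)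
        \<le> norm (B powr q * (indicator \<Omega> x * W x powr (- 1 / (p - 1))))"
    proof (rule AE_I2)
      fix x
      show "norm (norm (indicator \<Omega> x * \<eta> x / W x) powr q * W x)
        \<le> norm (B powr q * (indicator \<Omega> x * W x powr (- 1 / (p - 1))))"
      proof (cases "x \<in> \<Omega>")
        case True
        have "W x / W x powr q = W x powr (- 1 / (p - 1))"
          using Wpos[of x] qm1(1) powr_diff[of "W x" 1 q] by simp
        moreover have "norm (indicator \<Omega> x * \<eta> x / W x) powr q * W x = \<bar>\<eta> x\<bar> powr q * (W x / W x powr q)"
          using True Wpos[of x] by (simp add: powr_divide abs_mult less_imp_le)
        ultimately have "norm (indicator \<Omega> x * \<eta> x / W x) powr q * W x = \<bar>\<eta> x\<bar> powr q * W x powr (- 1 / (p - 1))"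
          by simp
        also have "\<dots> \<le> B powr q * W x powr (- 1 / (p - 1))"
          using \<eta>(2)[of x] pq by (intro mult_right_mono powr_mono2) auto
        finally show ?thesis using True Wpos[of x] by simp
      next
        case False then show ?thesis using pq by simp
      qed
    qed
  qed measurable
  then show ?thesis by (simp add: Lq_def)
qed

lemma pairing:
  fixes k :: "'a \<Rightarrow> 'b::euclidean_space" and z :: "'a \<Rightarrow> 'd::euclidean_space"
  assumes k: "Lq k" and z: "z \<in> borel_measurable borel" "integrable lborel (\<lambda>x. norm (z x) powr p * W x)"
  shows "integrable lborel (\<lambda>x. norm (k x) * norm (z x) * W x)"
    "(LINT x|lborel. norm (k x) * norm (z x) * W x) \<le> Iq k powr (1/q) * Ip z powr (1/p)"
  using weighted_Hoelder[OF pq, of k lborel z W] k z Wpos unfolding Lq_def Ip_def Iq_def by (auto simp: less_imp_le)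

text \<open>Pairing with 1/W on \<Omega>, an element of L^q(W), turns the weighted integral into the
  plain one.\<close>

lemma Lp_integrable:
  fixes z :: "'a \<Rightarrow> 'b::euclidean_space"
  assumes "Lp z"
  shows "integrable lborel z"
    "(LINT x|lborel. norm (z x)) \<le> Iq (\<lambda>x. indicator \<Omega> x * 1 / W x :: real) powr (1/q) * Ip z powr (1/p)"
proof -
  note [measurable] = LpD(1)[OF assms]
  have k: "Lq (\<lambda>x. indicator \<Omega> x * 1 / W x :: real)" by (rule Lq_over_W[of _ 1]) auto
  have eq: "norm (indicator \<Omega> x * 1 / W x :: real) * norm (z x) * W x = norm (z x)" for x
    using Wpos[of x] LpD(2)[OF assms, of x] by (cases "x \<in> \<Omega>") auto
  note P = pairing[OF k LpD(1,3)[OF assms], unfolded eq]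
  show "integrable lborel z" using P(1) by (subst integrable_norm_iff[symmetric]) auto
  show "(LINT x|lborel. norm (z x)) \<le> Iq (\<lambda>x. indicator \<Omega> x * 1 / W x :: real) powr (1/q) * Ip z powr (1/p)"
    by (rule P(2))
qed

lemma Ip_nonneg: "0 \<le> Ip z" and Iq_nonneg: "0 \<le> Iq k"
  unfolding Ip_def Iq_def using Wpos by (auto intro!: integral_nonneg_AE simp: less_imp_le)

lemma Lp_diff:
  assumes "Lp y" "Lp z"
  shows "Lp (\<lambda>x. y x - z x)" "Ip (\<lambda>x. y x - z x) \<le> 3 powr p * (Ip y + Ip z)"
proof -
  note [measurable] = LpD(1)[OF assms(1)] LpD(1)[OF assms(2)]
  have le: "norm (y x - z x) powr p * W x \<le> 3 powr p * (norm (y x) powr p * W x + norm (z x) powr p * W x)" for x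
  proof -
    have "norm (y x - z x) powr p \<le> (norm (y x) + norm (z x) + 0) powr p"
      using pq norm_triangle_ineq4[of "y x" "z x"] by (intro powr_mono2) auto
    also have "\<dots> \<le> 3 powr p * (norm (y x) powr p + norm (z x) powr p + 0 powr p)"
      using pq by (intro powr_add3_le) auto
    finally have "norm (y x - z x) powr p \<le> 3 powr p * (norm (y x) powr p + norm (z x) powr p)" by simp
    from mult_right_mono[OF this less_imp_le[OF Wpos[of x]]] show ?thesis by (simp add: algebra_simps)
  qed
  have i: "integrable lborel (\<lambda>x. 3 powr p * (norm (y x) powr p * W x + norm (z x) powr p * W x))"
    using LpD(3)[OF assms(1)] LpD(3)[OF assms(2)] by simp
  have j: "integrable lborel (\<lambda>x. norm (y x - z x) powr p * W x)"
  proof (rule Bochner_Integration.integrable_bound[OF i])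
    show "AE x in lborel. norm (norm (y x - z x) powr p * W x) \<le> norm (3 powr p * (norm (y x) powr p * W x + norm (z x) powr p * W x))"
    proof (rule AE_I2)
      fix x
      have "norm (norm (y x - z x) powr p * W x) = norm (y x - z x) powr p * W x" using Wpos[of x] by simp
      then show "norm (norm (y x - z x) powr p * W x) \<le> norm (3 powr p * (norm (y x) powr p * W x + norm (z x) powr p * W x))"
        using le[of x] by simp
    qed
  qed measurable
  show "Lp (\<lambda>x. y x - z x)" using j LpD(2)[OF assms(1)] LpD(2)[OF assms(2)] by (simp add: Lp_def)
  have "Ip (\<lambda>x. y x - z x) \<le> (LINT x|lborel. 3 powr p * (norm (y x) powr p * W x + norm (z x) powr p * W x))"
    unfolding Ip_def by (rule integral_mono[OF j i le])
  also have "\<dots> = 3 powr p * (Ip y + Ip z)"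
    unfolding Ip_def using LpD(3)[OF assms(1)] LpD(3)[OF assms(2)] by simp
  finally show "Ip (\<lambda>x. y x - z x) \<le> 3 powr p * (Ip y + Ip z)" .
qed

lemma Lp_moll:
  fixes z :: "'a \<Rightarrow> 'b::euclidean_space"
  assumes z: "Lp z"
  shows "((\<lambda>\<epsilon>. \<integral>\<^sup>+x. ennreal (norm (moll \<epsilon> z x - z x) powr p * W x) \<partial>lborel) \<longlongrightarrow> 0) (at_right 0)"
proof -
  obtain R where R: "0 < R" "\<Omega> \<subseteq> ball 0 R" by (rule \<Omega>_ball)
  obtain C where C: "C \<ge> 0" "\<And>\<epsilon> h::'a \<Rightarrow> 'b. 0 < \<epsilon> \<Longrightarrow> integrable lborel h \<Longrightarrow>
    (\<integral>\<^sup>+x. ennreal (norm (moll \<epsilon> h x) powr p * W x) \<partial>lborel)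
      \<le> ennreal C * (\<integral>\<^sup>+x. ennreal (norm (h x) powr p * W x) \<partial>lborel)"
    using Ap_moll_bound[OF pq(1) Wm Wpos Wi Si Ap, where 'b = 'b] by auto
  show ?thesis
  proof (rule moll_tendsto_Lq[OF Wm _ _ _ Lp_integrable(1)[OF z] _ _ C])
    show "(\<integral>\<^sup>+x. ennreal (W x) * indicator (cball 0 r) x \<partial>lborel) < \<infinity>" for r
    proof -
      have "integrable lborel (\<lambda>x. indicator (ball 0 (\<bar>r\<bar> + 1)) x *\<^sub>R W x)"
        using Wi[of "\<bar>r\<bar> + 1" 0] by (simp add: set_integrable_def)
      then have "(\<integral>\<^sup>+x. ennreal (norm (indicator (ball 0 (\<bar>r\<bar> + 1)) x *\<^sub>R W x)) \<partial>lborel) < \<infinity>"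
        by (simp add: integrable_iff_bounded)
      moreover have "(\<integral>\<^sup>+x. ennreal (W x) * indicator (cball 0 r) x \<partial>lborel) \<le> (\<integral>\<^sup>+x. ennreal (norm (indicator (ball 0 (\<bar>r\<bar> + 1)) x *\<^sub>R W x)) \<partial>lborel)"
        using Wpos by (intro nn_integral_mono) (auto simp: indicator_def less_imp_le)
      ultimately show ?thesis by (rule le_less_trans[rotated])
    qed
    show "(\<integral>\<^sup>+x. ennreal (norm (z x) powr p * W x) \<partial>lborel) < \<infinity>"
      using LpD(3)[OF z] Wpos by (simp add: integrable_iff_bounded abs_mult less_imp_le)
    show "z x = 0" if "x \<notin> cball 0 R" for x using that R(2) by (intro LpD(2)[OF z]) auto
  qed (use pq Wpos in \<open>auto simp: less_imp_le\<close>)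
qed

text \<open>Testing with \<phi>\<psi>, which is supported in \<Omega> even when \<psi> is not. The
  cut-off function therefore has a weak gradient on the whole space, as
  \<open>moll_diff_wgrad\<close> asks.\<close>

lemma wgrad_cutoff:
  assumes wg: "wgrad \<Omega> V Z" and V: "integrable lborel V" and Z: "integrable lborel Z" and \<phi>: "\<phi> \<in> test_functions \<Omega>"
  shows "wgrad UNIV (\<lambda>x. \<phi> x * V x) (\<lambda>x. \<phi> x *\<^sub>R Z x + V x *\<^sub>R gradient \<phi> x)"
  unfolding wgrad_def
proof (intro ballI)
  fix \<psi> :: "'a \<Rightarrow> real" and b assume \<psi>: "\<psi> \<in> test_functions UNIV" and b: "b \<in> (Basis :: 'a set)"
  note \<phi>s = test_functions_smooth[OF \<phi>] and \<psi>s = test_functions_smooth[OF \<psi>]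
  note pt = test_functions_partials
  note [measurable] = smooth_measurable[OF \<phi>s] smooth_measurable[OF \<psi>s]
    smooth_measurable[OF smooth_partials[OF \<phi>s b]] smooth_measurable[OF smooth_partials[OF \<psi>s b]]
    borel_measurable_integrable[OF V] borel_measurable_integrable[OF Z]
  obtain B1 where B1: "\<And>x. \<bar>\<phi> x\<bar> \<le> B1" using test_functions_bounded[OF \<phi>] by blast
  obtain B2 where B2: "\<And>x. \<bar>\<psi> x\<bar> \<le> B2" using test_functions_bounded[OF \<psi>] by blast
  obtain B3 where B3: "\<And>x. \<bar>partials [b] \<phi> x\<bar> \<le> B3" using test_functions_bounded[OF pt[OF \<phi> b]] by blast
  obtain B4 where B4: "\<And>x. \<bar>partials [b] \<psi> x\<bar> \<le> B4" using test_functions_bounded[OF pt[OF \<psi> b]] by blast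
  have i: "integrable lborel (\<lambda>x. h x * (k x * V x))" if "\<And>x. \<bar>h x\<bar> \<le> B" "\<And>x. \<bar>k x\<bar> \<le> B'"
    "h \<in> borel_measurable borel" "k \<in> borel_measurable borel" for h k :: "'a \<Rightarrow> real" and B B'
    using integrable_bounded_mult[of lborel "\<lambda>x. k x * V x" h B] integrable_bounded_mult[OF V, of k B'] that by simp
  have i3: "integrable lborel (\<lambda>x. (\<phi> x * (Z x \<bullet> b)) * \<psi> x)"
  proof -
    have "integrable lborel (\<lambda>x. Z x \<bullet> b)" using Z by (rule integrable_inner_left)
    from integrable_bounded_mult[OF this, of \<phi> B1] B1 have "integrable lborel (\<lambda>x. \<phi> x * (Z x \<bullet> b))" by simp
    from integrable_bounded_mult[OF this, of \<psi> B2] B2 show ?thesis by (simp add: mult.commute)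
  qed
  note i1 = i[OF B4 B1 smooth_measurable[OF smooth_partials[OF \<psi>s b]] smooth_measurable[OF \<phi>s]]
    and i2 = i[OF B2 B3 smooth_measurable[OF \<psi>s] smooth_measurable[OF smooth_partials[OF \<phi>s b]]]
  have "(\<lambda>x. \<phi> x * \<psi> x) \<in> test_functions \<Omega>" by (rule test_functions_mult[OF \<phi> \<psi>s])
  then have "(LINT x|lborel. V x * partials [b] (\<lambda>x. \<phi> x * \<psi> x) x) = - (LINT x|lborel. (Z x \<bullet> b) * (\<phi> x * \<psi> x))"
    using wg b unfolding wgrad_def by (simp del: partials.simps)
  moreover have "V x * partials [b] (\<lambda>x. \<phi> x * \<psi> x) x = partials [b] \<psi> x * (\<phi> x * V x) + \<psi> x * (partials [b] \<phi> x * V x)" for x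
    unfolding partials_mult[OF smooth_differentiable[OF \<phi>s] smooth_differentiable[OF \<psi>s]] by (simp add: algebra_simps del: partials.simps)
  ultimately have eq: "(LINT x|lborel. partials [b] \<psi> x * (\<phi> x * V x)) + (LINT x|lborel. \<psi> x * (partials [b] \<phi> x * V x))
     = - (LINT x|lborel. (Z x \<bullet> b) * (\<phi> x * \<psi> x))"
    using Bochner_Integration.integral_add[OF i1 i2] by (simp del: partials.simps)
  have "(LINT x|lborel. ((\<phi> x *\<^sub>R Z x + V x *\<^sub>R gradient \<phi> x) \<bullet> b) * \<psi> x)
    = (LINT x|lborel. (\<phi> x * (Z x \<bullet> b)) * \<psi> x + \<psi> x * (partials [b] \<phi> x * V x))"
    by (simp add: inner_add_left gradient_inner_Basis[OF b] algebra_simps del: partials.simps)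
  also have "\<dots> = (LINT x|lborel. (\<phi> x * (Z x \<bullet> b)) * \<psi> x) + (LINT x|lborel. \<psi> x * (partials [b] \<phi> x * V x))"
    by (rule Bochner_Integration.integral_add[OF i3 i2])
  finally show "(LINT x|lborel. \<phi> x * V x * partials [b] \<psi> x) = - (LINT x|lborel. ((\<phi> x *\<^sub>R Z x + V x *\<^sub>R gradient \<phi> x) \<bullet> b) * \<psi> x)"
    using eq by (simp add: mult_ac del: partials.simps)
qed

text \<open>The L^1 norm of the cut-off function is at most \<epsilon>(K + LK) plus that of its
  mollification. K bounds the L^1 norms of V and Z uniformly in n, and LK accounts for the gradient
  of the cutoff.\<close>

lemma compactness:
  assumes V: "\<And>n. Lp (V n)" and Z: "\<And>n. Lp (Z n)" and wg: "\<And>n. wgrad \<Omega> (V n) (Z n)"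
    and VB: "\<And>n. Ip (V n) \<le> B" and ZB: "\<And>n. Ip (Z n) \<le> B"
    and weak: "\<And>\<eta> M. \<eta> \<in> borel_measurable borel \<Longrightarrow> (\<And>x. \<bar>\<eta> x\<bar> \<le> M) \<Longrightarrow> (\<lambda>n. LINT x|lborel. \<eta> x * V n x) \<longlonglongrightarrow> 0"
    and r: "0 < r" "cball x0 r \<subseteq> \<Omega>"
  shows "(\<lambda>n. LINT x|lborel. bump x0 r x * \<bar>V n x\<bar>) \<longlonglongrightarrow> 0"
proof -
  define \<phi> where "\<phi> = bump x0 r"
  have \<phi>: "\<phi> \<in> test_functions \<Omega>" unfolding \<phi>_def by (rule bump_test_function[OF r])
  note \<phi>s = test_functions_smooth[OF \<phi>]
  have \<phi>01: "0 \<le> \<phi> x" "\<phi> x \<le> 1" for x by (simp_all add: \<phi>_def bump_nonneg bump_le_1)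
  note [measurable] = smooth_measurable[OF \<phi>s] gradient_measurable[OF \<phi>s] LpD(1)[OF V] LpD(1)[OF Z]
  obtain L where L: "0 < L" "\<And>x. norm (gradient \<phi> x) \<le> L" using gradient_bounded[OF \<phi>] by blast
  define Vc where "Vc n x = \<phi> x * V n x" for n x
  define Zc where "Zc n x = \<phi> x *\<^sub>R Z n x + V n x *\<^sub>R gradient \<phi> x" for n x
  note Vi = Lp_integrable(1)[OF V] and Zi = Lp_integrable(1)[OF Z]
  define K where "K = Iq (\<lambda>x. indicator \<Omega> x * 1 / W x :: real) powr (1/q) * B powr (1/p)"
  have KB: "Iq (\<lambda>x. indicator \<Omega> x * 1 / W x :: real) powr (1/q) * t powr (1/p) \<le> K" if "0 \<le> t" "t \<le> B" for t
    unfolding K_def using that pq by (intro mult_left_mono powr_mono2) auto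
  have VK: "(LINT x|lborel. norm (V n x)) \<le> K" for n
    by (rule order_trans[OF Lp_integrable(2)[OF V] KB[OF Ip_nonneg VB]])
  have ZK: "(LINT x|lborel. norm (Z n x)) \<le> K" for n
    by (rule order_trans[OF Lp_integrable(2)[OF Z] KB[OF Ip_nonneg ZB]])
  have K0: "0 \<le> K" by (rule order_trans[OF integral_nonneg_AE VK[of 0]]) simp
  have Vci: "integrable lborel (Vc n)" for n
    unfolding Vc_def using integrable_bounded_mult[OF Vi, of \<phi> 1] \<phi>01 by simp
  have Zci: "integrable lborel (Zc n)" for n
    unfolding Zc_def
  proof (rule Bochner_Integration.integrable_add)
    show "integrable lborel (\<lambda>x. \<phi> x *\<^sub>R Z n x)" using integrable_bounded_mult[OF Zi, of \<phi> 1] \<phi>01 by simp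
    show "integrable lborel (\<lambda>x. V n x *\<^sub>R gradient \<phi> x)"
    proof (rule Bochner_Integration.integrable_bound)
      show "integrable lborel (\<lambda>x. L * norm (V n x))" using Vi by simp
      show "AE x in lborel. norm (V n x *\<^sub>R gradient \<phi> x) \<le> norm (L * norm (V n x))"
        using L by (intro AE_I2) (auto simp: mult.commute[of L] abs_mult intro!: mult_left_mono)
    qed measurable
  qed
  have ZcK: "(\<integral>\<^sup>+x. ennreal (norm (Zc n x)) \<partial>lborel) \<le> ennreal (K + L * K)" for n
  proof -
    have "(\<integral>\<^sup>+x. ennreal (norm (Zc n x)) \<partial>lborel) = ennreal (LINT x|lborel. norm (Zc n x))"
      using Zci by (intro nn_integral_eq_integral) auto
    also have "(LINT x|lborel. norm (Zc n x)) \<le> (LINT x|lborel. norm (Z n x) + L * norm (V n x))"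
    proof (rule integral_mono)
      show "norm (Zc n x) \<le> norm (Z n x) + L * norm (V n x)" for x
      proof -
        have "norm (\<phi> x *\<^sub>R Z n x) \<le> norm (Z n x)" using \<phi>01[of x] by (simp add: mult_left_le_one_le)
        moreover have "norm (V n x *\<^sub>R gradient \<phi> x) \<le> L * norm (V n x)"
          using L by (simp add: mult.commute[of L] mult_left_mono)
        ultimately show ?thesis unfolding Zc_def by (rule order_trans[OF norm_triangle_ineq add_mono])
      qed
    qed (use Zci Zi Vi in auto)
    also have "\<dots> = (LINT x|lborel. norm (Z n x)) + L * (LINT x|lborel. norm (V n x))" using Zi Vi by simp
    also have "\<dots> \<le> K + L * K" using VK[of n] ZK[of n] L by (intro add_mono mult_left_mono) auto
    finally show ?thesis by (simp add: ennreal_leI)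
  qed
  have wgc: "wgrad UNIV (Vc n) (Zc n)" for n
    unfolding Vc_def Zc_def by (rule wgrad_cutoff[OF wg Vi Zi \<phi>])
  obtain R where R: "0 < R" "\<Omega> \<subseteq> ball 0 R" by (rule \<Omega>_ball)
  have Vout: "Vc n x = 0" if "x \<notin> cball 0 R" for n x
    using LpD(2)[OF V, of x n] that R(2) unfolding Vc_def by fastforce
  have m0: "(\<lambda>n. \<integral>\<^sup>+x. ennreal \<bar>moll \<epsilon> (Vc n) x\<bar> \<partial>lborel) \<longlonglongrightarrow> 0" if \<epsilon>: "0 < \<epsilon>" for \<epsilon>
  proof -
    obtain M0 where M0: "\<And>z::'a. \<bar>mker \<epsilon> z\<bar> \<le> M0" using mker_bounded[OF \<epsilon>] by blast
    have M00: "0 \<le> M0" using M0[of 0] by linarith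
    have "(\<lambda>n. \<integral>\<^sup>+x. ennreal \<bar>moll \<epsilon> (Vc n) x\<bar> \<partial>lborel) \<longlonglongrightarrow> (\<integral>\<^sup>+x. 0 \<partial>(lborel :: 'a measure))"
    proof (rule nn_integral_dominated_convergence[where w = "\<lambda>x. ennreal (M0 * K) * indicator (cball 0 (R + \<epsilon>)) x"])
      show "(\<integral>\<^sup>+x. ennreal (M0 * K) * indicator (cball (0::'a) (R + \<epsilon>)) x \<partial>lborel) < \<infinity>"
        using emeasure_lborel_cball_finite[of "0::'a" "R + \<epsilon>"]
        by (subst nn_integral_cmult_indicator) (auto simp: ennreal_mult_less_top)
      show "AE x in lborel. (\<lambda>n. ennreal \<bar>moll \<epsilon> (Vc n) x\<bar>) \<longlonglongrightarrow> 0"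
      proof (rule AE_I2)
        fix x
        \<comment> \<open>At fixed x the mollification is the integral of V n against a bounded
          function of y, the kernel times the cutoff, so the weak hypothesis applies
          pointwise.\<close>
        have "(\<lambda>n. LINT y|lborel. (mker \<epsilon> (x - y) * \<phi> y) * V n y) \<longlonglongrightarrow> 0"
        proof (rule weak[of "\<lambda>y. mker \<epsilon> (x - y) * \<phi> y" "M0 * 1"])
          show "\<bar>mker \<epsilon> (x - y) * \<phi> y\<bar> \<le> M0 * 1" for y
            unfolding abs_mult using M0 \<phi>01[of y] M00 by (intro mult_mono) auto
        qed measurable
        then have "(\<lambda>n. moll \<epsilon> (Vc n) x) \<longlonglongrightarrow> 0" by (simp add: moll_def Vc_def mult.assoc)
        then have "(\<lambda>n. \<bar>moll \<epsilon> (Vc n) x\<bar>) \<longlonglongrightarrow> 0" by (rule tendsto_rabs_zero)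
        from tendsto_ennrealI[OF this] show "(\<lambda>n. ennreal \<bar>moll \<epsilon> (Vc n) x\<bar>) \<longlonglongrightarrow> 0" by simp
      qed
      show "AE x in lborel. ennreal \<bar>moll \<epsilon> (Vc n) x\<bar> \<le> ennreal (M0 * K) * indicator (cball 0 (R + \<epsilon>)) x" for n
      proof (rule AE_I2)
        fix x
        show "ennreal \<bar>moll \<epsilon> (Vc n) x\<bar> \<le> ennreal (M0 * K) * indicator (cball 0 (R + \<epsilon>)) x"
        proof (cases "x \<in> cball 0 (R + \<epsilon>)")
          case True
          have "\<bar>moll \<epsilon> (Vc n) x\<bar> \<le> (LINT y|lborel. mker \<epsilon> (x - y) * norm (Vc n y))"
            using norm_moll_le[OF \<epsilon> Vci[of n], of x] by simp
          also have "\<dots> \<le> (LINT y|lborel. M0 * norm (V n y))"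
          proof (rule integral_mono)
            show "integrable lborel (\<lambda>y. mker \<epsilon> (x - y) * norm (Vc n y))"
              using moll_integrable[OF \<epsilon> integrable_norm[OF Vci[of n]]] by simp
            show "mker \<epsilon> (x - y) * norm (Vc n y) \<le> M0 * norm (V n y)" for y
            proof (rule mult_mono)
              show "mker \<epsilon> (x - y) \<le> M0" using M0[of "x - y"] by linarith
              show "norm (Vc n y) \<le> norm (V n y)" unfolding Vc_def using \<phi>01[of y] by (simp add: abs_mult mult_left_le_one_le)
            qed (use M00 in auto)
          qed (use Vi in auto)
          also have "\<dots> \<le> M0 * K" using VK[of n] M00 by (simp add: mult_left_mono)
          finally show ?thesis using True by (simp add: ennreal_leI)
        next
          case False
          have "moll \<epsilon> (Vc n) x = 0"
          proof (rule moll_eq_0[OF \<epsilon>])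
            fix y assume "y \<in> ball x \<epsilon>"
            then show "Vc n y = 0" using False norm_triangle_sub[of x y] by (intro Vout) (auto simp: dist_norm)
          qed
          then show ?thesis by simp
        qed
      qed
      have [measurable]: "cball (0::'a) (R + \<epsilon>) \<in> sets borel" by simp
      show "(\<lambda>x. ennreal (M0 * K) * indicator (cball (0::'a) (R + \<epsilon>)) x) \<in> borel_measurable lborel" by measurable
      have [measurable]: "Vc n \<in> borel_measurable borel" for n using Vci by auto
      show "(\<lambda>x. ennreal \<bar>moll \<epsilon> (Vc n) x\<bar>) \<in> borel_measurable lborel" for n by measurable
    qed auto
    then show ?thesis by simp
  qed
  have split: "(\<integral>\<^sup>+x. ennreal \<bar>Vc n x\<bar> \<partial>lborel) \<le> ennreal \<epsilon> * ennreal (K + L * K) + (\<integral>\<^sup>+x. ennreal \<bar>moll \<epsilon> (Vc n) x\<bar> \<partial>lborel)"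
    if \<epsilon>: "0 < \<epsilon>" for \<epsilon> n
  proof -
    have [measurable]: "Vc n \<in> borel_measurable borel" using Vci by auto
    have "(\<integral>\<^sup>+x. ennreal \<bar>Vc n x\<bar> \<partial>lborel) \<le> (\<integral>\<^sup>+x. ennreal \<bar>moll \<epsilon> (Vc n) x - Vc n x\<bar> + ennreal \<bar>moll \<epsilon> (Vc n) x\<bar> \<partial>lborel)"
      by (intro nn_integral_mono) (simp add: ennreal_plus[symmetric] ennreal_leI del: ennreal_plus)
    also have "\<dots> = (\<integral>\<^sup>+x. ennreal \<bar>moll \<epsilon> (Vc n) x - Vc n x\<bar> \<partial>lborel) + (\<integral>\<^sup>+x. ennreal \<bar>moll \<epsilon> (Vc n) x\<bar> \<partial>lborel)"
      by (rule nn_integral_add) measurable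
    also have "(\<integral>\<^sup>+x. ennreal \<bar>moll \<epsilon> (Vc n) x - Vc n x\<bar> \<partial>lborel) \<le> ennreal \<epsilon> * (\<integral>\<^sup>+x. ennreal (norm (Zc n x)) \<partial>lborel)"
      by (rule moll_diff_wgrad[OF Vci Zci Vout wgc \<epsilon>])
    also have "\<dots> \<le> ennreal \<epsilon> * ennreal (K + L * K)" by (intro mult_left_mono ZcK) auto
    finally show ?thesis by (simp add: add_right_mono)
  qed
  have nn: "(\<lambda>n. \<integral>\<^sup>+x. ennreal \<bar>Vc n x\<bar> \<partial>lborel) \<longlonglongrightarrow> 0"
  proof (rule order_tendstoI)
    fix a :: ennreal assume "0 < a"
    then obtain b where "0 < b" "b < a" using dense by blast
    then obtain \<eta> where \<eta>: "0 < \<eta>" "ennreal \<eta> < a" by (cases b) (auto simp: ennreal_less_zero_iff)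
    \<comment> \<open>Makes the gradient part of \<open>split\<close> at most \<eta>/2; the summand
      1 prevents a vanishing denominator.\<close>
    define \<epsilon> where "\<epsilon> = \<eta> / 2 / (K + L * K + 1)"
    have KL: "0 \<le> K + L * K" using K0 L by simp
    have \<epsilon>: "0 < \<epsilon>" using \<eta> KL by (simp add: \<epsilon>_def)
    have eK: "ennreal \<epsilon> * ennreal (K + L * K) \<le> ennreal (\<eta> / 2)"
    proof -
      have "\<epsilon> * (K + L * K) \<le> \<epsilon> * (K + L * K + 1)" using \<epsilon> by (intro mult_left_mono) auto
      also have "\<dots> = \<eta> / 2"
      proof -
        have "K + L * K + 1 \<noteq> 0" using KL by linarith
        moreover have "\<eta> / 2 / D * D = \<eta> / 2" if "D \<noteq> 0" for D using that by simp
        ultimately show ?thesis unfolding \<epsilon>_def by blast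
      qed
      finally have "ennreal (\<epsilon> * (K + L * K)) \<le> ennreal (\<eta> / 2)" by (rule ennreal_leI)
      then show ?thesis using KL \<epsilon> by (simp add: ennreal_mult)
    qed
    have "eventually (\<lambda>n. (\<integral>\<^sup>+x. ennreal \<bar>moll \<epsilon> (Vc n) x\<bar> \<partial>lborel) < ennreal (\<eta> / 2)) sequentially"
      using \<eta> by (intro order_tendstoD(2)[OF m0[OF \<epsilon>]]) simp
    then show "eventually (\<lambda>n. (\<integral>\<^sup>+x. ennreal \<bar>Vc n x\<bar> \<partial>lborel) < a) sequentially"
    proof eventually_elim
      case (elim n)
      have "(\<integral>\<^sup>+x. ennreal \<bar>Vc n x\<bar> \<partial>lborel) \<le> ennreal (\<eta> / 2) + ennreal (\<eta> / 2)"
        by (rule order_trans[OF split[OF \<epsilon>] add_mono[OF eK less_imp_le[OF elim]]])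
      also have "\<dots> = ennreal \<eta>" using \<eta> by (simp add: ennreal_plus[symmetric] del: ennreal_plus)
      finally show ?case using \<eta>(2) by (rule le_less_trans)
    qed
  qed simp
  have "(\<integral>\<^sup>+x. ennreal \<bar>Vc n x\<bar> \<partial>lborel) = ennreal (LINT x|lborel. bump x0 r x * \<bar>V n x\<bar>)" for n
  proof -
    have "(\<integral>\<^sup>+x. ennreal \<bar>Vc n x\<bar> \<partial>lborel) = ennreal (LINT x|lborel. \<bar>Vc n x\<bar>)"
      using Vci by (intro nn_integral_eq_integral) auto
    then show ?thesis using \<phi>01 by (simp add: Vc_def abs_mult \<phi>_def[symmetric])
  qed
  with nn have "(\<lambda>n. ennreal (LINT x|lborel. bump x0 r x * \<bar>V n x\<bar>)) \<longlonglongrightarrow> ennreal 0" by simp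
  then show ?thesis
    by (subst (asm) tendsto_ennreal_iff) (auto intro!: always_eventually integral_nonneg_AE simp: bump_nonneg)
qed

end

section \<open>The truncated energy\<close>

text \<open>The smooth truncation \<open>t \<mapsto> \<delta> * arctan (t / \<delta>)\<close> replaces the usual piecewise linear one:
  it is bounded by \<open>2 * \<delta>\<close>, and compositions of test functions with it remain smooth.\<close>

definition trunc :: "real \<Rightarrow> real \<Rightarrow> real" where "trunc \<delta> t = \<delta> * arctan (t * (1 / \<delta>))"

definition trunc' :: "real \<Rightarrow> real \<Rightarrow> real" where "trunc' \<delta> t = 1 / (1 + (t / \<delta>)\<^sup>2)"

lemma trunc_deriv:
  assumes "0 < \<delta>" shows "(trunc \<delta> has_real_derivative trunc' \<delta> t) (at t)"
proof -
  have "((\<lambda>t. \<delta> * arctan (t * (1 / \<delta>))) has_real_derivative \<delta> * (inverse (1 + (t * (1 / \<delta>))\<^sup>2) * (1 / \<delta>))) (at t)"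
    by (intro DERIV_cmult DERIV_chain2[of arctan] DERIV_arctan) (use assms in \<open>auto intro!: derivative_eq_intros\<close>)
  moreover have "\<delta> * (i * (1 / \<delta>)) = i" for i using assms by simp
  moreover have "inverse (1 + (t * (1 / \<delta>))\<^sup>2) = trunc' \<delta> t" by (simp add: trunc'_def inverse_eq_divide)
  ultimately show ?thesis unfolding trunc_def[abs_def] by simp
qed

lemma trunc_bound: "0 < \<delta> \<Longrightarrow> \<bar>trunc \<delta> t\<bar> \<le> 2 * \<delta>"
proof -
  assume d: "0 < \<delta>"
  have "\<bar>arctan (t * (1 / \<delta>))\<bar> \<le> 2"
    using arctan_bounded[of "t * (1 / \<delta>)"] pi_half_less_two by linarith
  then show ?thesis using d by (simp add: trunc_def abs_mult)
qed

lemma trunc'_bounds: "0 < trunc' \<delta> t" "trunc' \<delta> t \<le> 1"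
proof -
  have *: "0 < 1 / s \<and> 1 / s \<le> 1" if "1 \<le> s" for s :: real using that by auto
  show "0 < trunc' \<delta> t" "trunc' \<delta> t \<le> 1" unfolding trunc'_def using *[of "1 + (t / \<delta>)\<^sup>2"] by simp_all
qed

lemma trunc'_continuous: "continuous_on UNIV (trunc' \<delta>)"
proof -
  have "1 + (t / \<delta>)\<^sup>2 \<noteq> 0" for t by (metis add_pos_nonneg less_irrefl zero_le_power2 zero_less_one)
  then show ?thesis unfolding trunc'_def[abs_def] divide_inverse[of _ \<delta>] by (intro continuous_intros) (auto simp: divide_inverse)
qed

lemma trunc'_0: "trunc' \<delta> 0 = 1" by (simp add: trunc'_def)

lemma trunc'_measurable [measurable]: "trunc' \<delta> \<in> borel_measurable borel"
  by (rule borel_measurable_continuous_onI[OF trunc'_continuous])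

lemma trunc'_tendsto: "(f \<longlongrightarrow> c) F \<Longrightarrow> ((\<lambda>x. trunc' \<delta> (f x)) \<longlongrightarrow> trunc' \<delta> c) F"
  by (rule continuous_on_tendsto_compose[OF trunc'_continuous]) auto

lemma smooth_trunc: "smooth_on UNIV v \<Longrightarrow> smooth_on UNIV (\<lambda>x. trunc \<delta> (v x))"
  unfolding trunc_def by (intro smooth_mult smooth_const smooth_arctan)

lemma trunc_measurable [measurable]: "trunc \<delta> \<in> borel_measurable borel"
  unfolding trunc_def[abs_def] by measurable

lemma gradient_cutoff_trunc:
  fixes \<phi> v :: "'a::euclidean_space \<Rightarrow> real"
  assumes \<delta>: "0 < \<delta>" and \<phi>: "smooth_on UNIV \<phi>" and v: "smooth_on UNIV v"
  shows "gradient (\<lambda>x. \<phi> x * trunc \<delta> (v x)) x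
    = (\<phi> x * trunc' \<delta> (v x)) *\<^sub>R gradient v x + trunc \<delta> (v x) *\<^sub>R gradient \<phi> x"
proof (rule euclidean_eqI)
  fix b :: 'a assume b: "b \<in> Basis"
  have "partials [b] (\<lambda>x. \<phi> x * trunc \<delta> (v x)) x
    = \<phi> x * (trunc' \<delta> (v x) * partials [b] v x) + partials [b] \<phi> x * trunc \<delta> (v x)"
    unfolding partials_mult[OF smooth_differentiable[OF \<phi>] smooth_differentiable[OF smooth_trunc[OF v]]]
      partials_comp[OF smooth_differentiable[OF v] trunc_deriv[OF \<delta>]] ..
  then show "gradient (\<lambda>x. \<phi> x * trunc \<delta> (v x)) x \<bullet> b
     = ((\<phi> x * trunc' \<delta> (v x)) *\<^sub>R gradient v x + trunc \<delta> (v x) *\<^sub>R gradient \<phi> x) \<bullet> b"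
    by (simp add: gradient_inner_Basis[OF b] inner_add_left mult.commute mult.left_commute del: partials.simps)
qed

lemma cutoff_inner_le:
  fixes a z :: "'a::real_inner"
  assumes "0 \<le> s" "s \<le> 1" "0 < t" "t \<le> 1"
  shows "norm ((s * t) * (a \<bullet> z)) \<le> norm a * norm z"
proof -
  have "s * t \<le> 1" "0 \<le> s * t" using assms by (auto intro: mult_le_one)
  then have "norm ((s * t) * (a \<bullet> z)) \<le> \<bar>a \<bullet> z\<bar>" by (simp add: abs_mult mult_left_le_one_le)
  also have "\<dots> \<le> norm a * norm z" by (rule Cauchy_Schwarz_ineq2)
  finally show ?thesis .
qed

section \<open>Fluxes and the truncated energy estimate\<close>

context Ap_domain
begin

definition over :: "('a \<Rightarrow> 'a) \<Rightarrow> 'a \<Rightarrow> 'a" where "over a x = (1 / W x) *\<^sub>R a x"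

lemma over_measurable [measurable]: "a \<in> borel_measurable borel \<Longrightarrow> over a \<in> borel_measurable borel"
  unfolding over_def[abs_def] by measurable

lemma norm_over: "norm (over a x) * t * W x = norm (a x) * t"
  using Wpos[of x] by (simp add: over_def)

lemma inner_over: "(over a x \<bullet> y) * W x = a x \<bullet> y"
  using Wpos[of x] by (simp add: over_def)

text \<open>The abstract form of A(x, \<nabla>u) extended by zero: its norm is at most
  |\<nabla>u|^(p-1) w, so the quotient by w, which is \<open>over\<close>, lies in L^q(w).\<close>

definition flux :: "('a \<Rightarrow> 'a) \<Rightarrow> bool" where
  "flux a \<longleftrightarrow> a \<in> borel_measurable borel \<and> (\<forall>x. x \<notin> \<Omega> \<longrightarrow> a x = 0) \<and> Lq (over a)"

lemma fluxD: "flux a \<Longrightarrow> a \<in> borel_measurable borel" "flux a \<Longrightarrow> x \<notin> \<Omega> \<Longrightarrow> a x = 0" "flux a \<Longrightarrow> Lq (over a)"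
  by (simp_all add: flux_def)

lemma flux_pairing:
  fixes z :: "'a \<Rightarrow> 'b::euclidean_space"
  assumes a: "flux a" and z: "z \<in> borel_measurable borel" "integrable lborel (\<lambda>x. norm (z x) powr p * W x)"
  shows "integrable lborel (\<lambda>x. norm (a x) * norm (z x))"
    "(LINT x|lborel. norm (a x) * norm (z x)) \<le> Iq (over a) powr (1/q) * Ip z powr (1/p)"
  using pairing[OF fluxD(3)[OF a] z] unfolding norm_over by auto

lemma Lp_indicator: "Lp (indicator \<Omega> :: 'a \<Rightarrow> real)"
proof -
  have "norm (indicator \<Omega> x :: real) powr p * W x = indicator \<Omega> x * W x" for x
    using pq by (auto simp: indicator_def)
  then show ?thesis using W_integrable unfolding Lp_def by (simp only:) simp
qed

lemma flux_integrable:
  assumes a: "flux a"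
  shows "integrable lborel a" "(LINT x|lborel. norm (a x)) \<le> Iq (over a) powr (1/q) * Ip (indicator \<Omega> :: 'a \<Rightarrow> real) powr (1/p)"
proof -
  have eq: "norm (a x) * norm (indicator \<Omega> x :: real) = norm (a x)" for x
    using fluxD(2)[OF a, of x] by (auto simp: indicator_def)
  note P = flux_pairing[OF a LpD(1,3)[OF Lp_indicator], unfolded eq]
  show "integrable lborel a" using P(1) fluxD(1)[OF a] by (subst integrable_norm_iff[symmetric]) auto
  show "(LINT x|lborel. norm (a x)) \<le> Iq (over a) powr (1/q) * Ip (indicator \<Omega> :: 'a \<Rightarrow> real) powr (1/p)" by (rule P(2))
qed

lemma integrable_inner_bounded:
  fixes a y :: "'a \<Rightarrow> 'a"
  assumes a: "integrable lborel a" and y: "y \<in> borel_measurable borel" "\<And>x. norm (y x) \<le> B"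
  shows "integrable lborel (\<lambda>x. a x \<bullet> y x)"
proof (rule Bochner_Integration.integrable_bound)
  note [measurable] = borel_measurable_integrable[OF a] y(1)
  show "integrable lborel (\<lambda>x. B * norm (a x))" using a by simp
  show "(\<lambda>x. a x \<bullet> y x) \<in> borel_measurable lborel" by measurable
  have B0: "0 \<le> B" using order_trans[OF norm_ge_zero y(2)] .
  show "AE x in lborel. norm (a x \<bullet> y x) \<le> norm (B * norm (a x))"
  proof (rule AE_I2)
    fix x
    have "\<bar>a x \<bullet> y x\<bar> \<le> norm (a x) * norm (y x)" by (rule Cauchy_Schwarz_ineq2)
    also have "\<dots> \<le> norm (a x) * B" by (intro mult_left_mono y(2)) simp
    finally show "norm (a x \<bullet> y x) \<le> norm (B * norm (a x))" using B0 by (simp add: mult.commute)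
  qed
qed

text \<open>L^1 convergence of the mollifications of V gives almost everywhere convergence along a
  subsequence of radii, and passing to it preserves the convergence for Z in L^p(W).\<close>

lemma moll_AE_sequence:
  assumes V: "Lp (V :: 'a \<Rightarrow> real)" and Z: "Lp (Z :: 'a \<Rightarrow> 'a)" and r: "0 < r"
  shows "\<exists>\<epsilon> :: nat \<Rightarrow> real. (\<forall>j. 0 < \<epsilon> j \<and> \<epsilon> j < r) \<and> (AE x in lborel. (\<lambda>j. moll (\<epsilon> j) V x) \<longlonglongrightarrow> V x) \<and>
    (\<lambda>j. \<integral>\<^sup>+x. ennreal (norm (moll (\<epsilon> j) Z x - Z x) powr p * W x) \<partial>lborel) \<longlonglongrightarrow> 0"
proof -
  \<comment> \<open>The shift by 2 makes the first radius r/2, already below r.\<close>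
  define e where "e j = r / (real j + 2)" for j
  have e: "0 < e j" "e j < r" for j using r by (auto simp: e_def divide_less_eq)
  have "(\<lambda>j. r * inverse (real (j + 2))) \<longlonglongrightarrow> r * 0"
    by (intro tendsto_mult tendsto_const LIMSEQ_ignore_initial_segment[OF lim_inverse_n])
  then have "e \<longlonglongrightarrow> 0" unfolding e_def by (simp add: divide_inverse add.commute)
  then have el: "filterlim e (at_right 0) sequentially"
    using e by (intro tendsto_imp_filterlim_at_right) (auto intro: always_eventually)
  obtain R where R: "0 < R" "\<Omega> \<subseteq> ball 0 R" by (rule \<Omega>_ball)
  note Vi = Lp_integrable(1)[OF V]
  have "((\<lambda>\<epsilon>. \<integral>\<^sup>+x. ennreal (norm (moll \<epsilon> V x - V x)) \<partial>lborel) \<longlongrightarrow> 0) (at_right 0)"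
  proof (rule moll_tendsto_L1[OF Vi])
    show "V x = 0" if "x \<notin> cball 0 R" for x using that R(2) by (intro LpD(2)[OF V]) auto
  qed
  from filterlim_compose[OF this el]
  have l1: "(\<lambda>j. \<integral>\<^sup>+x. ennreal (norm (moll (e j) V x - V x)) \<partial>lborel) \<longlonglongrightarrow> 0" .
  note [measurable] = LpD(1)[OF V]
  have mi: "integrable lborel (\<lambda>x. moll (e j) V x - V x)" for j
  proof -
    have "(\<integral>\<^sup>+x. ennreal (norm (moll (e j) V x)) \<partial>lborel) < \<infinity>"
      using Vi by (intro le_less_trans[OF nn_moll_L1[OF e(1) Vi]]) (simp add: integrable_iff_bounded)
    then have "integrable lborel (moll (e j) V)" by (simp add: integrable_iff_bounded)
    then show ?thesis using Vi by simp
  qed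
  have eq: "(\<integral>\<^sup>+x. ennreal (norm (moll (e j) V x - V x)) \<partial>lborel) = ennreal (LINT x|lborel. norm (moll (e j) V x - V x))" for j
    using mi by (intro nn_integral_eq_integral) auto
  have "(\<lambda>j. ennreal (LINT x|lborel. norm (moll (e j) V x - V x))) \<longlonglongrightarrow> ennreal 0"
    using l1 unfolding eq by simp
  then have "(\<lambda>j. LINT x|lborel. norm (moll (e j) V x - V x)) \<longlonglongrightarrow> 0"
    by (subst (asm) tendsto_ennreal_iff) (auto intro!: always_eventually integral_nonneg_AE)
  from tendsto_L1_AE_subseq[OF mi this] obtain s where s: "strict_mono s"
    "AE x in lborel. (\<lambda>j. moll (e (s j)) V x - V x) \<longlonglongrightarrow> 0" by blast
  show ?thesis
  proof (intro exI[of _ "\<lambda>j. e (s j)"] conjI allI)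
    show "AE x in lborel. (\<lambda>j. moll (e (s j)) V x) \<longlonglongrightarrow> V x"
      using s(2) by eventually_elim (simp add: LIM_zero_iff)
    from filterlim_compose[OF Lp_moll[OF Z] el]
    have "(\<lambda>j. \<integral>\<^sup>+x. ennreal (norm (moll (e j) Z x - Z x) powr p * W x) \<partial>lborel) \<longlonglongrightarrow> 0" .
    from LIMSEQ_subseq_LIMSEQ[OF this s(1)]
    show "(\<lambda>j. \<integral>\<^sup>+x. ennreal (norm (moll (e (s j)) Z x - Z x) powr p * W x) \<partial>lborel) \<longlonglongrightarrow> 0" by (simp add: o_def)
  qed (use e in auto)
qed

text \<open>With v the mollified V, the gradient of the test function has an energy part and the
  part \<open>trunc \<delta> (v x) *\<^sub>R gradient \<phi> x\<close>. The bound 2\<delta> for the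
  truncation controls both the test function itself and the second part, whence the factor 2\<delta>
  for every mollification radius; then the radius tends to 0.\<close>

lemma truncated_energy:
  fixes V :: "'a \<Rightarrow> real" and Z a :: "'a \<Rightarrow> 'a"
  assumes V: "Lp V" and Z: "Lp Z" and wg: "wgrad \<Omega> V Z" and a: "flux a"
    and r: "0 < r" "cball x0 (2 * r) \<subseteq> \<Omega>" and \<delta>: "0 < \<delta>"
    and eq: "\<And>\<psi>. \<psi> \<in> test_functions \<Omega> \<Longrightarrow> supp \<psi> \<subseteq> cball x0 r \<Longrightarrow> (\<And>x. \<bar>\<psi> x\<bar> \<le> 2 * \<delta>) \<Longrightarrow>
      \<bar>LINT x|lborel. a x \<bullet> gradient \<psi> x\<bar> \<le> 2 * \<delta> * C"
    and L: "\<And>x. norm (gradient (bump x0 r) x) \<le> L"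
  shows "\<bar>LINT x|lborel. (bump x0 r x * trunc' \<delta> (V x)) * (a x \<bullet> Z x)\<bar> \<le> 2 * \<delta> * (C + L * (LINT x|lborel. norm (a x)))"
proof -
  define \<phi> where "\<phi> = bump x0 r"
  have rr: "cball x0 r \<subseteq> cball x0 (2 * r)" using r(1) by auto
  have \<phi>: "\<phi> \<in> test_functions \<Omega>" unfolding \<phi>_def using rr r by (intro bump_test_function) auto
  note \<phi>s = test_functions_smooth[OF \<phi>]
  have \<phi>01: "0 \<le> \<phi> x" "\<phi> x \<le> 1" for x by (simp_all add: \<phi>_def bump_nonneg bump_le_1)
  note Vi = Lp_integrable(1)[OF V] and Zi = Lp_integrable(1)[OF Z] and ai = flux_integrable(1)[OF a]
  note [measurable] = LpD(1)[OF V] LpD(1)[OF Z] fluxD(1)[OF a] smooth_measurable[OF \<phi>s] gradient_measurable[OF \<phi>s]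
  define I where "I \<epsilon> = (LINT x|lborel. (\<phi> x * trunc' \<delta> (moll \<epsilon> V x)) * (a x \<bullet> moll \<epsilon> Z x))" for \<epsilon>
  have IB: "\<bar>I \<epsilon>\<bar> \<le> 2 * \<delta> * (C + L * (LINT x|lborel. norm (a x)))"
    and Ii: "integrable lborel (\<lambda>x. (\<phi> x * trunc' \<delta> (moll \<epsilon> V x)) * (a x \<bullet> moll \<epsilon> Z x))"
    if \<epsilon>: "0 < \<epsilon>" "\<epsilon> < r" for \<epsilon>
  proof -
    let ?v = "moll \<epsilon> V"
    have vs: "smooth_on UNIV ?v" by (rule smooth_moll[OF \<epsilon>(1) Vi])
    define \<psi> where "\<psi> x = \<phi> x * trunc \<delta> (?v x)" for x
    have \<psi>: "\<psi> \<in> test_functions \<Omega>" unfolding \<psi>_def by (rule test_functions_mult[OF \<phi> smooth_trunc[OF vs]])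
    \<comment> \<open>The gradient of the mollification is available only where the ball of radius
      \<epsilon> fits into \<Omega>. On the ball of radius r it does, as \<epsilon> < r; elsewhere
      \<phi> vanishes.\<close>
    have gm: "\<phi> x *\<^sub>R gradient ?v x = \<phi> x *\<^sub>R moll \<epsilon> Z x" for x
    proof (cases "x \<in> ball x0 r")
      case True
      have "cball x \<epsilon> \<subseteq> \<Omega>"
      proof
        fix y assume "y \<in> cball x \<epsilon>"
        then have "dist x0 y \<le> 2 * r" using True \<epsilon> dist_triangle[of x0 y x] by simp
        then show "y \<in> \<Omega>" using r(2) by auto
      qed
      then show ?thesis using gradient_moll[OF \<epsilon>(1) Vi Zi wg] by simp
    next
      case False
      then have "\<phi> x = 0" unfolding \<phi>_def using r(1) by (intro bump_eq_0)
      then show ?thesis by simp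
    qed
    have g\<psi>: "a x \<bullet> gradient \<psi> x = (\<phi> x * trunc' \<delta> (?v x)) * (a x \<bullet> moll \<epsilon> Z x) + trunc \<delta> (?v x) * (a x \<bullet> gradient \<phi> x)" for x
    proof -
      have "gradient \<psi> x = trunc' \<delta> (?v x) *\<^sub>R (\<phi> x *\<^sub>R gradient ?v x) + trunc \<delta> (?v x) *\<^sub>R gradient \<phi> x"
        unfolding \<psi>_def gradient_cutoff_trunc[OF \<delta> \<phi>s vs] by (simp add: mult.commute)
      then show ?thesis unfolding gm by (simp add: inner_add_right mult.commute mult.left_commute)
    qed
    obtain B where B: "\<And>x. norm (gradient \<psi> x) \<le> B" using gradient_bounded[OF \<psi>] by blast
    have i1: "integrable lborel (\<lambda>x. a x \<bullet> gradient \<psi> x)"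
      by (rule integrable_inner_bounded[OF ai gradient_measurable[OF test_functions_smooth[OF \<psi>]] B])
    have i2': "integrable lborel (\<lambda>x. a x \<bullet> gradient \<phi> x)"
      by (rule integrable_inner_bounded[OF ai gradient_measurable[OF \<phi>s] L[folded \<phi>_def]])
    have i2: "integrable lborel (\<lambda>x. trunc \<delta> (?v x) * (a x \<bullet> gradient \<phi> x))"
      using integrable_bounded_mult[OF i2', of "\<lambda>x. trunc \<delta> (?v x)" "2 * \<delta>"] trunc_bound[OF \<delta>] by simp
    have "integrable lborel (\<lambda>x. a x \<bullet> gradient \<psi> x - trunc \<delta> (?v x) * (a x \<bullet> gradient \<phi> x))"
      by (rule Bochner_Integration.integrable_diff[OF i1 i2])
    then show i3: "integrable lborel (\<lambda>x. (\<phi> x * trunc' \<delta> (?v x)) * (a x \<bullet> moll \<epsilon> Z x))"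
      unfolding g\<psi> by simp
    have "I \<epsilon> = (LINT x|lborel. a x \<bullet> gradient \<psi> x) - (LINT x|lborel. trunc \<delta> (?v x) * (a x \<bullet> gradient \<phi> x))"
      unfolding g\<psi> I_def using Bochner_Integration.integral_add[OF i3 i2] by simp
    moreover have "\<bar>LINT x|lborel. a x \<bullet> gradient \<psi> x\<bar> \<le> 2 * \<delta> * C"
    proof (rule eq[OF \<psi>])
      show "supp \<psi> \<subseteq> cball x0 r"
      proof (rule supp_subset_closed)
        fix x assume "x \<notin> cball x0 r"
        then have "x \<notin> ball x0 r" by auto
        then have "\<phi> x = 0" unfolding \<phi>_def using r(1) by (intro bump_eq_0)
        then show "\<psi> x = 0" by (simp add: \<psi>_def)
      qed simp
      show "\<bar>\<psi> x\<bar> \<le> 2 * \<delta>" for x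
        unfolding \<psi>_def abs_mult using \<phi>01[of x] trunc_bound[OF \<delta>, of "?v x"]
        by (intro order_trans[OF mult_left_le_one_le]) auto
    qed
    moreover have "\<bar>LINT x|lborel. trunc \<delta> (?v x) * (a x \<bullet> gradient \<phi> x)\<bar> \<le> 2 * \<delta> * (L * (LINT x|lborel. norm (a x)))"
    proof -
      have "norm (LINT x|lborel. trunc \<delta> (?v x) * (a x \<bullet> gradient \<phi> x)) \<le> (LINT x|lborel. 2 * \<delta> * (L * norm (a x)))"
      proof (rule integral_norm_le[OF i2])
        show "integrable lborel (\<lambda>x. 2 * \<delta> * (L * norm (a x)))" using ai by simp
        show "norm (trunc \<delta> (?v x) * (a x \<bullet> gradient \<phi> x)) \<le> 2 * \<delta> * (L * norm (a x))" for x
        proof -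
          have "\<bar>a x \<bullet> gradient \<phi> x\<bar> \<le> norm (a x) * norm (gradient \<phi> x)" by (rule Cauchy_Schwarz_ineq2)
          also have "\<dots> \<le> norm (a x) * L" using L[of x] unfolding \<phi>_def by (intro mult_left_mono) auto
          finally have "\<bar>a x \<bullet> gradient \<phi> x\<bar> \<le> L * norm (a x)" by (simp add: mult.commute)
          then show ?thesis using trunc_bound[OF \<delta>, of "?v x"] unfolding real_norm_def abs_mult by (intro mult_mono) (use \<delta> in auto)
        qed
      qed
      then show ?thesis by simp
    qed
    ultimately show "\<bar>I \<epsilon>\<bar> \<le> 2 * \<delta> * (C + L * (LINT x|lborel. norm (a x)))"
      unfolding distrib_left by linarith
  qed
  obtain \<epsilon> :: "nat \<Rightarrow> real" where \<epsilon>': "\<forall>j. 0 < \<epsilon> j \<and> \<epsilon> j < r"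
    and VAE: "AE x in lborel. (\<lambda>j. moll (\<epsilon> j) V x) \<longlonglongrightarrow> V x"
    and Zlim: "(\<lambda>j. \<integral>\<^sup>+x. ennreal (norm (moll (\<epsilon> j) Z x - Z x) powr p * W x) \<partial>lborel) \<longlonglongrightarrow> 0"
    using moll_AE_sequence[OF V Z r(1)] by (elim exE conjE)
  then have \<epsilon>: "0 < \<epsilon> j" "\<epsilon> j < r" for j by simp_all
  note aZ = flux_pairing(1)[OF a LpD(1,3)[OF Z]]
  define t where "t j x = trunc' \<delta> (moll (\<epsilon> j) V x)" for j x
  have tm [measurable]: "t j \<in> borel_measurable borel" for j unfolding t_def by measurable
  have t01: "0 < t j x" "t j x \<le> 1" for j x unfolding t_def by (rule trunc'_bounds)+
  have i4: "integrable lborel (\<lambda>x. (\<phi> x * t j x) * (a x \<bullet> Z x))" for j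
  proof (rule Bochner_Integration.integrable_bound[OF aZ])
    show "AE x in lborel. norm ((\<phi> x * t j x) * (a x \<bullet> Z x)) \<le> norm (norm (a x) * norm (Z x))"
    proof (rule AE_I2)
      fix x
      have "norm ((\<phi> x * t j x) * (a x \<bullet> Z x)) \<le> norm (a x) * norm (Z x)"
          using \<phi>01[of x] t01[of j x] by (intro cutoff_inner_le)
      then show "norm ((\<phi> x * t j x) * (a x \<bullet> Z x)) \<le> norm (norm (a x) * norm (Z x))" by simp
    qed
  qed measurable
  have A: "(\<lambda>j. LINT x|lborel. (\<phi> x * t j x) * (a x \<bullet> Z x)) \<longlonglongrightarrow> (LINT x|lborel. (\<phi> x * trunc' \<delta> (V x)) * (a x \<bullet> Z x))"
  proof (rule integral_dominated_convergence[OF _ _ aZ])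
    show "AE x in lborel. (\<lambda>j. (\<phi> x * t j x) * (a x \<bullet> Z x)) \<longlonglongrightarrow> (\<phi> x * trunc' \<delta> (V x)) * (a x \<bullet> Z x)"
      using VAE unfolding t_def by eventually_elim (intro tendsto_mult tendsto_const trunc'_tendsto)
    show "AE x in lborel. norm ((\<phi> x * t j x) * (a x \<bullet> Z x)) \<le> norm (a x) * norm (Z x)" for j
    proof (rule AE_I2)
      fix x
      have "norm ((\<phi> x * t j x) * (a x \<bullet> Z x)) \<le> norm (a x) * norm (Z x)"
          using \<phi>01[of x] t01[of j x] by (intro cutoff_inner_le)
      then show "norm ((\<phi> x * t j x) * (a x \<bullet> Z x)) \<le> norm (a x) * norm (Z x)" by simp
    qed
  qed measurable
  \<comment> \<open>The mollified Z is replaced by Z under a factor of modulus at most 1; the error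
    is a pairing of \<open>over a\<close> in L^q(W) with a difference that tends to 0 in
    L^p(W).\<close>
  have B: "(\<lambda>j. I (\<epsilon> j) - (LINT x|lborel. (\<phi> x * t j x) * (a x \<bullet> Z x))) \<longlonglongrightarrow> 0"
  proof -
    define J where "J j = Ip (\<lambda>x. moll (\<epsilon> j) Z x - Z x)" for j
    \<comment> \<open>For early j the integral might be infinite and \<open>Ip\<close>, a Bochner
      integral, would then be 0; finiteness from some index on is enough for the limit.\<close>
    have fin: "eventually (\<lambda>j. (\<integral>\<^sup>+x. ennreal (norm (moll (\<epsilon> j) Z x - Z x) powr p * W x) \<partial>lborel) < 1) sequentially"
      by (rule order_tendstoD(2)[OF Zlim]) simp
    have ok: "eventually (\<lambda>j. integrable lborel (\<lambda>x. norm (moll (\<epsilon> j) Z x - Z x) powr p * W x)) sequentially"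
      using fin
    proof eventually_elim
      case (elim j)
      have "(\<integral>\<^sup>+x. ennreal (norm (norm (moll (\<epsilon> j) Z x - Z x) powr p * W x)) \<partial>lborel) < \<infinity>"
        using elim Wpos by (simp add: abs_mult less_imp_le) (metis ennreal_one_less_top order_less_trans)
      then show ?case by (intro integrableI_bounded) measurable
    qed
    have "eventually (\<lambda>j. (\<integral>\<^sup>+x. ennreal (norm (moll (\<epsilon> j) Z x - Z x) powr p * W x) \<partial>lborel) = ennreal (J j)) sequentially"
      using ok
    proof eventually_elim
      case (elim j)
      show ?case unfolding J_def Ip_def using Wpos by (intro nn_integral_eq_integral[OF elim]) (auto simp: less_imp_le)
    qed
    from Lim_transform_eventually[OF Zlim this] have "(\<lambda>j. ennreal (J j)) \<longlonglongrightarrow> ennreal 0" by simp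
    then have J0: "J \<longlonglongrightarrow> 0"
      by (subst (asm) tendsto_ennreal_iff) (auto intro!: always_eventually simp: J_def Ip_nonneg)
    have "(\<lambda>j. J j powr (1/p)) \<longlonglongrightarrow> 0"
      by (rule tendsto_zero_powrI[OF J0 tendsto_const]) (use pq in \<open>auto simp: J_def Ip_nonneg\<close>)
    then have lim: "(\<lambda>j. Iq (over a) powr (1/q) * J j powr (1/p)) \<longlonglongrightarrow> 0" by (rule tendsto_mult_right_zero)
    show ?thesis
    proof (rule Lim_null_comparison[OF _ lim])
      show "eventually (\<lambda>j. norm (I (\<epsilon> j) - (LINT x|lborel. (\<phi> x * t j x) * (a x \<bullet> Z x))) \<le> Iq (over a) powr (1/q) * J j powr (1/p)) sequentially"
        using ok
      proof eventually_elim
        case (elim j)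
        let ?z = "\<lambda>x. moll (\<epsilon> j) Z x - Z x"
        have zm: "?z \<in> borel_measurable borel" by measurable
        note P = flux_pairing[OF a zm elim]
        have i5: "integrable lborel (\<lambda>x. (\<phi> x * t j x) * (a x \<bullet> moll (\<epsilon> j) Z x) - (\<phi> x * t j x) * (a x \<bullet> Z x))"
          using Ii[OF \<epsilon>(1,2), of j] i4[of j] unfolding t_def by (intro Bochner_Integration.integrable_diff)
        have "I (\<epsilon> j) - (LINT x|lborel. (\<phi> x * t j x) * (a x \<bullet> Z x))
           = (LINT x|lborel. (\<phi> x * t j x) * (a x \<bullet> moll (\<epsilon> j) Z x) - (\<phi> x * t j x) * (a x \<bullet> Z x))"
          using Ii[OF \<epsilon>(1,2), of j] i4[of j] unfolding I_def t_def by (intro Bochner_Integration.integral_diff[symmetric])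
        also have "norm \<dots> \<le> (LINT x|lborel. norm (a x) * norm (?z x))"
        proof (rule integral_norm_le[OF i5 P(1)])
          fix x
          have "(\<phi> x * t j x) * (a x \<bullet> moll (\<epsilon> j) Z x) - (\<phi> x * t j x) * (a x \<bullet> Z x) = (\<phi> x * t j x) * (a x \<bullet> ?z x)"
            by (simp add: inner_diff_right right_diff_distrib)
          also have "norm \<dots> \<le> norm (a x) * norm (?z x)"
            using \<phi>01[of x] t01[of j x] by (intro cutoff_inner_le)
          finally show "norm ((\<phi> x * t j x) * (a x \<bullet> moll (\<epsilon> j) Z x) - (\<phi> x * t j x) * (a x \<bullet> Z x)) \<le> norm (a x) * norm (?z x)" by simp
        qed
        also have "\<dots> \<le> Iq (over a) powr (1/q) * J j powr (1/p)" unfolding J_def by (rule P(2))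
        finally show ?case .
      qed
    qed
  qed
  from tendsto_add[OF B A] have "(\<lambda>j. I (\<epsilon> j)) \<longlonglongrightarrow> (LINT x|lborel. (\<phi> x * trunc' \<delta> (V x)) * (a x \<bullet> Z x))" by simp
  then have "(\<lambda>j. \<bar>I (\<epsilon> j)\<bar>) \<longlonglongrightarrow> \<bar>LINT x|lborel. (\<phi> x * trunc' \<delta> (V x)) * (a x \<bullet> Z x)\<bar>" by (rule tendsto_rabs)
  then have "\<bar>LINT x|lborel. (\<phi> x * trunc' \<delta> (V x)) * (a x \<bullet> Z x)\<bar> \<le> 2 * \<delta> * (C + L * (LINT x|lborel. norm (a x)))"
    by (rule LIMSEQ_le_const2) (use IB \<epsilon> in auto)
  then show ?thesis by (simp add: \<phi>_def)
qed

section \<open>The monotone part of the energy tends to zero\<close>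

text \<open>The minimum is at most e and at most 1, hence at most their average with weights t and 1
  - t.\<close>

lemma min_one_le_weighted:
  fixes e t :: real
  assumes "0 \<le> e" "0 \<le> t" "t \<le> 1"
  shows "min 1 e \<le> t * e + (1 - t)"
proof (cases "e \<le> 1")
  case True
  have "(1 - t) * e \<le> (1 - t) * 1" using True assms by (intro mult_left_mono) auto
  then show ?thesis using True by (simp add: algebra_simps)
next
  case False
  have "t * 1 \<le> t * e" using False assms by (intro mult_left_mono) auto
  then show ?thesis using False by simp
qed

text \<open>The factor \<open>trunc'\<close> depends on n, so weak convergence does not apply at
  once. It applies to \<phi> a alone; the remainder \<phi> (1 - trunc') a, divided by W, tends to 0
  strongly in L^q(W) by dominated convergence and is paired with a bounded sequence.\<close>

lemma truncated_cross_term: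
  fixes V :: "nat \<Rightarrow> 'a \<Rightarrow> real" and Z :: "nat \<Rightarrow> 'a \<Rightarrow> 'a" and \<phi> :: "'a \<Rightarrow> real"
  assumes V: "\<And>n. Lp (V n)" and Z: "\<And>n. Lp (Z n)" and ZB: "\<And>n. Ip (Z n) \<le> B"
    and V0: "AE x in lborel. (\<lambda>n. V n x) \<longlonglongrightarrow> 0"
    and weak: "\<And>k :: 'a \<Rightarrow> 'a. Lq k \<Longrightarrow> (\<lambda>n. LINT x|lborel. (k x \<bullet> Z n x) * W x) \<longlonglongrightarrow> 0"
    and a: "flux a" and \<phi>m [measurable]: "\<phi> \<in> borel_measurable borel" and \<phi>: "\<And>x. 0 \<le> \<phi> x" "\<And>x. \<phi> x \<le> 1"
  shows "(\<lambda>n. LINT x|lborel. (\<phi> x * trunc' \<delta> (V n x)) * (a x \<bullet> Z n x)) \<longlonglongrightarrow> 0"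
proof -
  note [measurable] = LpD(1)[OF V] LpD(1)[OF Z] fluxD(1)[OF a]
  define t where "t n x = trunc' \<delta> (V n x)" for n x
  have tm [measurable]: "t n \<in> borel_measurable borel" for n unfolding t_def by measurable
  have t01: "0 < t n x" "t n x \<le> 1" for n x unfolding t_def by (rule trunc'_bounds)+
  note kq = fluxD(3)[OF a]
  have Lq_scaled: "Lq (over (\<lambda>x. h x *\<^sub>R a x))" if [measurable]: "h \<in> borel_measurable borel" and h: "\<And>x. \<bar>h x\<bar> \<le> 1" for h :: "'a \<Rightarrow> real"
    unfolding Lq_def
  proof
    show "integrable lborel (\<lambda>x. norm (over (\<lambda>x. h x *\<^sub>R a x) x) powr q * W x)"
    proof (rule Bochner_Integration.integrable_bound)
      show "integrable lborel (\<lambda>x. norm (over a x) powr q * W x)" using kq by (simp add: Lq_def)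
      show "AE x in lborel. norm (norm (over (\<lambda>x. h x *\<^sub>R a x) x) powr q * W x) \<le> norm (norm (over a x) powr q * W x)"
      proof (rule AE_I2)
        fix x
        have "norm (over (\<lambda>x. h x *\<^sub>R a x) x) \<le> norm (over a x)"
          using h[of x] Wpos[of x] by (simp add: over_def divide_right_mono mult_left_le_one_le)
        then have "norm (over (\<lambda>x. h x *\<^sub>R a x) x) powr q * W x \<le> norm (over a x) powr q * W x"
          using pq Wpos[of x] by (intro mult_right_mono powr_mono2) auto
        then show "norm (norm (over (\<lambda>x. h x *\<^sub>R a x) x) powr q * W x) \<le> norm (norm (over a x) powr q * W x)"
          using Wpos[of x] by simp
      qed
    qed measurable
  qed measurable
  have flux_scaled: "flux (\<lambda>x. h x *\<^sub>R a x)" if "h \<in> borel_measurable borel" "\<And>x. \<bar>h x\<bar> \<le> 1" for h :: "'a \<Rightarrow> real"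
    unfolding flux_def using Lq_scaled[OF that] fluxD(2)[OF a] that(1) by auto
  define h where "h n x = \<phi> x * (1 - t n x)" for n x
  have [measurable]: "h n \<in> borel_measurable borel" for n unfolding h_def by measurable
  have h01: "0 \<le> h n x" "h n x \<le> 1" for n x
    unfolding h_def using \<phi>[of x] t01[of n x] by (auto intro: mult_le_one)
  have fh: "flux (\<lambda>x. h n x *\<^sub>R a x)" for n using h01 by (intro flux_scaled) auto
  have f\<phi>: "flux (\<lambda>x. \<phi> x *\<^sub>R a x)" using \<phi> by (intro flux_scaled) auto
  have A: "(\<lambda>n. LINT x|lborel. \<phi> x * (a x \<bullet> Z n x)) \<longlonglongrightarrow> 0"
    using weak[OF fluxD(3)[OF f\<phi>]] unfolding inner_over by simp
  have Iq0: "(\<lambda>n. Iq (over (\<lambda>x. h n x *\<^sub>R a x))) \<longlonglongrightarrow> 0"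
  proof -
    have "(\<lambda>n. LINT x|lborel. norm (over (\<lambda>x. h n x *\<^sub>R a x) x) powr q * W x) \<longlonglongrightarrow> (LINT x|(lborel :: 'a measure). 0)"
    proof (rule integral_dominated_convergence)
      show "integrable lborel (\<lambda>x. norm (over a x) powr q * W x)" using kq by (simp add: Lq_def)
      show "AE x in lborel. norm (norm (over (\<lambda>x. h n x *\<^sub>R a x) x) powr q * W x) \<le> norm (over a x) powr q * W x" for n
      proof (rule AE_I2)
        fix x
        have "norm (over (\<lambda>x. h n x *\<^sub>R a x) x) \<le> norm (over a x)"
          using h01[of n x] Wpos[of x] by (simp add: over_def divide_right_mono mult_left_le_one_le)
        then have "norm (over (\<lambda>x. h n x *\<^sub>R a x) x) powr q * W x \<le> norm (over a x) powr q * W x"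
          using pq Wpos[of x] by (intro mult_right_mono powr_mono2) auto
        then show "norm (norm (over (\<lambda>x. h n x *\<^sub>R a x) x) powr q * W x) \<le> norm (over a x) powr q * W x"
          using Wpos[of x] by simp
      qed
      show "AE x in lborel. (\<lambda>n. norm (over (\<lambda>x. h n x *\<^sub>R a x) x) powr q * W x) \<longlonglongrightarrow> 0"
        using V0
      proof eventually_elim
        case (elim x)
        have "(\<lambda>n. t n x) \<longlonglongrightarrow> 1" unfolding t_def using trunc'_tendsto[OF elim, of \<delta>] by (simp add: trunc'_0)
        then have "(\<lambda>n. \<phi> x * (1 - t n x)) \<longlonglongrightarrow> \<phi> x * (1 - 1)" by (intro tendsto_intros)
        then have "(\<lambda>n. h n x) \<longlonglongrightarrow> 0" unfolding h_def by simp
        then have "(\<lambda>n. norm ((1 / W x) *\<^sub>R h n x *\<^sub>R a x)) \<longlonglongrightarrow> norm ((1 / W x) *\<^sub>R 0 *\<^sub>R a x)" by (intro tendsto_intros)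
        then have "(\<lambda>n. norm (over (\<lambda>x. h n x *\<^sub>R a x) x)) \<longlonglongrightarrow> 0" by (simp add: over_def)
        then have "(\<lambda>n. norm (over (\<lambda>x. h n x *\<^sub>R a x) x) powr q) \<longlonglongrightarrow> 0"
          by (rule tendsto_zero_powrI[OF _ tendsto_const]) (use pq in auto)
        then show ?case by (rule tendsto_mult_left_zero)
      qed
    qed measurable
    then show ?thesis by (simp add: Iq_def)
  qed
  have B0: "0 \<le> B" by (rule order_trans[OF Ip_nonneg ZB])
  have Cb: "norm (LINT x|lborel. h n x * (a x \<bullet> Z n x)) \<le> Iq (over (\<lambda>x. h n x *\<^sub>R a x)) powr (1/q) * B powr (1/p)" 
    and hi: "integrable lborel (\<lambda>x. h n x * (a x \<bullet> Z n x))" for n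
  proof -
    note P = flux_pairing[OF fh[of n] LpD(1,3)[OF Z[of n]]]
    have le: "norm (h n x * (a x \<bullet> Z n x)) \<le> norm (h n x *\<^sub>R a x) * norm (Z n x)" for x
      using Cauchy_Schwarz_ineq2[of "h n x *\<^sub>R a x" "Z n x"] by simp
    show i: "integrable lborel (\<lambda>x. h n x * (a x \<bullet> Z n x))"
      by (rule Bochner_Integration.integrable_bound[OF P(1)]) (use le in \<open>auto intro!: AE_I2 simp del: norm_scaleR\<close>)
    have "norm (LINT x|lborel. h n x * (a x \<bullet> Z n x)) \<le> (LINT x|lborel. norm (h n x *\<^sub>R a x) * norm (Z n x))"
      by (rule integral_norm_le[OF i P(1) le])
    also note P(2)
    also have "Iq (over (\<lambda>x. h n x *\<^sub>R a x)) powr (1/q) * Ip (Z n) powr (1/p) \<le> Iq (over (\<lambda>x. h n x *\<^sub>R a x)) powr (1/q) * B powr (1/p)"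
      using ZB[of n] Ip_nonneg[of "Z n"] pq by (intro mult_left_mono powr_mono2) auto
    finally show "norm (LINT x|lborel. h n x * (a x \<bullet> Z n x)) \<le> Iq (over (\<lambda>x. h n x *\<^sub>R a x)) powr (1/q) * B powr (1/p)" .
  qed
  have C: "(\<lambda>n. LINT x|lborel. h n x * (a x \<bullet> Z n x)) \<longlonglongrightarrow> 0"
  proof (rule Lim_null_comparison[OF always_eventually[OF allI[OF Cb]]])
    have "(\<lambda>n. Iq (over (\<lambda>x. h n x *\<^sub>R a x)) powr (1/q)) \<longlonglongrightarrow> 0"
      by (rule tendsto_zero_powrI[OF Iq0 tendsto_const]) (use pq in \<open>auto simp: Iq_nonneg\<close>)
    then show "(\<lambda>n. Iq (over (\<lambda>x. h n x *\<^sub>R a x)) powr (1/q) * B powr (1/p)) \<longlonglongrightarrow> 0" by (rule tendsto_mult_left_zero)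
  qed
  have \<phi>i: "integrable lborel (\<lambda>x. \<phi> x * (a x \<bullet> Z n x))" for n
  proof -
    have le: "norm (\<phi> x * (a x \<bullet> Z n x)) \<le> norm (\<phi> x *\<^sub>R a x) * norm (Z n x)" for x
      using Cauchy_Schwarz_ineq2[of "\<phi> x *\<^sub>R a x" "Z n x"] by simp
    show ?thesis
      by (rule Bochner_Integration.integrable_bound[OF flux_pairing(1)[OF f\<phi> LpD(1,3)[OF Z[of n]]]])
        (use le in \<open>auto intro!: AE_I2 simp del: norm_scaleR\<close>)
  qed
  have "(LINT x|lborel. (\<phi> x * t n x) * (a x \<bullet> Z n x)) = (LINT x|lborel. \<phi> x * (a x \<bullet> Z n x)) - (LINT x|lborel. h n x * (a x \<bullet> Z n x))" for n
    by (subst Bochner_Integration.integral_diff[OF \<phi>i hi, symmetric]) (simp add: h_def algebra_simps)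
  with tendsto_diff[OF A C] show ?thesis by (simp add: t_def)
qed

text \<open>The integral X is at most T - U + P. T is of order \<delta> uniformly in n by the energy
  estimate, U is the cross term, and P is the price of \<open>min 1\<close> where the truncation is
  active. Monotonicity makes X nonnegative, so upper bounds suffice.\<close>

lemma monotone_part_tendsto:
  fixes V :: "nat \<Rightarrow> 'a \<Rightarrow> real" and Z a :: "nat \<Rightarrow> 'a \<Rightarrow> 'a" and a0 :: "'a \<Rightarrow> 'a"
  assumes V: "\<And>n. Lp (V n)" and Z: "\<And>n. Lp (Z n)" and wg: "\<And>n. wgrad \<Omega> (V n) (Z n)" and ZB: "\<And>n. Ip (Z n) \<le> B"
    and V0: "AE x in lborel. (\<lambda>n. V n x) \<longlonglongrightarrow> 0"
    and weak: "\<And>k :: 'a \<Rightarrow> 'a. Lq k \<Longrightarrow> (\<lambda>n. LINT x|lborel. (k x \<bullet> Z n x) * W x) \<longlonglongrightarrow> 0"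
    and a: "\<And>n. flux (a n)" "\<And>n. Iq (over (a n)) \<le> B'" and a0: "flux a0"
    and mono: "\<And>n. AE x in lborel. 0 \<le> (a n x - a0 x) \<bullet> Z n x"
    and r: "0 < r" "cball x0 (2 * r) \<subseteq> \<Omega>" and C: "0 \<le> C"
    and eq: "\<And>n \<psi> m. \<psi> \<in> test_functions \<Omega> \<Longrightarrow> supp \<psi> \<subseteq> cball x0 r \<Longrightarrow> 0 \<le> m \<Longrightarrow> (\<And>x. \<bar>\<psi> x\<bar> \<le> m) \<Longrightarrow>
      \<bar>LINT x|lborel. a n x \<bullet> gradient \<psi> x\<bar> \<le> m * C"
  shows "(\<lambda>n. LINT x|lborel. bump x0 r x * min 1 ((a n x - a0 x) \<bullet> Z n x)) \<longlonglongrightarrow> 0"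
proof -
  define \<phi> where "\<phi> = bump x0 r"
  have rr: "cball x0 r \<subseteq> \<Omega>" using r by (auto simp: subset_iff)
  have \<phi>t: "\<phi> \<in> test_functions \<Omega>" unfolding \<phi>_def using rr r by (intro bump_test_function) auto
  have [measurable]: "\<phi> \<in> borel_measurable borel" by (simp add: \<phi>_def)
  have \<phi>01: "0 \<le> \<phi> x" "\<phi> x \<le> 1" for x by (simp_all add: \<phi>_def bump_nonneg bump_le_1)
  have \<phi>i: "integrable lborel \<phi>" unfolding \<phi>_def by (rule integrable_bump[OF r(1)])
  obtain L where L: "0 < L" "\<And>x. norm (gradient \<phi> x) \<le> L" using gradient_bounded[OF \<phi>t] by blast
  note [measurable] = LpD(1)[OF V] LpD(1)[OF Z] fluxD(1)[OF a(1)] fluxD(1)[OF a0]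
  define K where "K = B' powr (1/q) * Ip (indicator \<Omega> :: 'a \<Rightarrow> real) powr (1/p)"
  have aK: "(LINT x|lborel. norm (a n x)) \<le> K" for n
    unfolding K_def using a(2)[of n] Iq_nonneg[of "over (a n)"] pq
    by (intro order_trans[OF flux_integrable(2)[OF a(1)]] mult_right_mono powr_mono2) auto
  have K0: "0 \<le> K" by (simp add: K_def)
  define e where "e n x = (a n x - a0 x) \<bullet> Z n x" for n x
  have [measurable]: "e n \<in> borel_measurable borel" for n unfolding e_def by measurable
  define X where "X n = (LINT x|lborel. \<phi> x * min 1 (e n x))" for n
  define T where "T \<delta> n = (LINT x|lborel. (\<phi> x * trunc' \<delta> (V n x)) * (a n x \<bullet> Z n x))" for \<delta> n
  define U where "U \<delta> n = (LINT x|lborel. (\<phi> x * trunc' \<delta> (V n x)) * (a0 x \<bullet> Z n x))" for \<delta> n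
  define P where "P \<delta> n = (LINT x|lborel. \<phi> x * (1 - trunc' \<delta> (V n x)))" for \<delta> n
  have T: "T \<delta> n \<le> 2 * \<delta> * (C + L * K)" if \<delta>: "0 < \<delta>" for \<delta> n
  proof -
    have "\<bar>T \<delta> n\<bar> \<le> 2 * \<delta> * (C + L * (LINT x|lborel. norm (a n x)))"
      unfolding T_def \<phi>_def
    proof (rule truncated_energy[OF V Z wg a(1) r \<delta>])
      fix \<psi> assume "\<psi> \<in> test_functions \<Omega>" "supp \<psi> \<subseteq> cball x0 r" "\<And>x. \<bar>\<psi> x\<bar> \<le> 2 * \<delta>"
      then show "\<bar>LINT x|lborel. a n x \<bullet> gradient \<psi> x\<bar> \<le> 2 * \<delta> * C" using \<delta> by (intro eq) auto
    qed (use L(2) in \<open>simp add: \<phi>_def\<close>)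
    also have "\<dots> \<le> 2 * \<delta> * (C + L * K)" using aK[of n] L(1) \<delta> by (intro mult_left_mono add_left_mono) auto
    finally show ?thesis by linarith
  qed
  have U: "U \<delta> \<longlonglongrightarrow> 0" for \<delta>
    unfolding U_def by (rule truncated_cross_term[OF V Z ZB V0 weak a0 _ \<phi>01]) auto
  have P: "P \<delta> \<longlonglongrightarrow> 0" for \<delta>
  proof -
    have "(\<lambda>n. LINT x|lborel. \<phi> x * (1 - trunc' \<delta> (V n x))) \<longlonglongrightarrow> (LINT x|(lborel :: 'a measure). 0)"
    proof (rule integral_dominated_convergence[OF _ _ \<phi>i])
      show "AE x in lborel. (\<lambda>n. \<phi> x * (1 - trunc' \<delta> (V n x))) \<longlonglongrightarrow> 0"
        using V0
      proof eventually_elim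
        case (elim x)
        have "(\<lambda>n. \<phi> x * (1 - trunc' \<delta> (V n x))) \<longlonglongrightarrow> \<phi> x * (1 - trunc' \<delta> 0)"
          by (intro tendsto_intros trunc'_tendsto elim)
        then show ?case by (simp add: trunc'_0)
      qed
      show "AE x in lborel. norm (\<phi> x * (1 - trunc' \<delta> (V n x))) \<le> \<phi> x" for n
      proof (rule AE_I2)
        fix x
        show "norm (\<phi> x * (1 - trunc' \<delta> (V n x))) \<le> \<phi> x"
          using \<phi>01[of x] trunc'_bounds[of \<delta> "V n x"] by (simp add: abs_mult mult_left_le)
      qed
    qed measurable
    then show ?thesis by (simp add: P_def[abs_def])
  qed
  have X: "0 \<le> X n" "X n \<le> T \<delta> n - U \<delta> n + P \<delta> n" for \<delta> n
  proof -
    have "AE x in lborel. 0 \<le> e n x" using mono by (simp add: e_def)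
    then show "0 \<le> X n" unfolding X_def using \<phi>01 by (intro integral_nonneg_AE) (auto elim!: eventually_mono)
    have ii: "integrable lborel (\<lambda>x. (\<phi> x * trunc' \<delta> (V n x)) * (b x \<bullet> Z n x))" if b: "flux b" for b
    proof (rule Bochner_Integration.integrable_bound[OF flux_pairing(1)[OF b LpD(1,3)[OF Z[of n]]]])
      note [measurable] = fluxD(1)[OF b]
      show "(\<lambda>x. (\<phi> x * trunc' \<delta> (V n x)) * (b x \<bullet> Z n x)) \<in> borel_measurable lborel" by measurable
      show "AE x in lborel. norm ((\<phi> x * trunc' \<delta> (V n x)) * (b x \<bullet> Z n x)) \<le> norm (norm (b x) * norm (Z n x))"
      proof (rule AE_I2)
        fix x
        have "norm ((\<phi> x * trunc' \<delta> (V n x)) * (b x \<bullet> Z n x)) \<le> norm (b x) * norm (Z n x)"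
          using \<phi>01[of x] trunc'_bounds[of \<delta> "V n x"] by (intro cutoff_inner_le)
        then show "norm ((\<phi> x * trunc' \<delta> (V n x)) * (b x \<bullet> Z n x)) \<le> norm (norm (b x) * norm (Z n x))" by simp
      qed
    qed
    have iP: "integrable lborel (\<lambda>x. \<phi> x * (1 - trunc' \<delta> (V n x)))"
    proof (rule Bochner_Integration.integrable_bound[OF \<phi>i])
      show "AE x in lborel. norm (\<phi> x * (1 - trunc' \<delta> (V n x))) \<le> norm (\<phi> x)"
      proof (rule AE_I2)
        fix x
        show "norm (\<phi> x * (1 - trunc' \<delta> (V n x))) \<le> norm (\<phi> x)"
          using \<phi>01[of x] trunc'_bounds[of \<delta> "V n x"] by (simp add: abs_mult mult_left_le)
      qed
    qed measurable
    have iX: "integrable lborel (\<lambda>x. \<phi> x * min 1 (e n x))"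
    proof (rule Bochner_Integration.integrable_bound[OF \<phi>i])
      show "AE x in lborel. norm (\<phi> x * min 1 (e n x)) \<le> norm (\<phi> x)"
        using mono[of n] unfolding e_def[symmetric]
      proof eventually_elim
        case (elim x)
        then have "\<bar>min 1 (e n x)\<bar> \<le> 1" by auto
        then show ?case using \<phi>01[of x] by (simp add: abs_mult mult_left_le)
      qed
    qed measurable
    have "X n \<le> (LINT x|lborel. (\<phi> x * trunc' \<delta> (V n x)) * (a n x \<bullet> Z n x)
        - (\<phi> x * trunc' \<delta> (V n x)) * (a0 x \<bullet> Z n x) + \<phi> x * (1 - trunc' \<delta> (V n x)))"
      unfolding X_def
    proof (rule integral_mono_AE[OF iX])
      show "integrable lborel (\<lambda>x. (\<phi> x * trunc' \<delta> (V n x)) * (a n x \<bullet> Z n x)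
        - (\<phi> x * trunc' \<delta> (V n x)) * (a0 x \<bullet> Z n x) + \<phi> x * (1 - trunc' \<delta> (V n x)))"
        by (intro Bochner_Integration.integrable_add Bochner_Integration.integrable_diff ii a(1) a0 iP)
      show "AE x in lborel. \<phi> x * min 1 (e n x) \<le> (\<phi> x * trunc' \<delta> (V n x)) * (a n x \<bullet> Z n x)
        - (\<phi> x * trunc' \<delta> (V n x)) * (a0 x \<bullet> Z n x) + \<phi> x * (1 - trunc' \<delta> (V n x))"
        using mono[of n] unfolding e_def[symmetric]
      proof eventually_elim
        case (elim x)
        have "\<phi> x * min 1 (e n x) \<le> \<phi> x * (trunc' \<delta> (V n x) * e n x + (1 - trunc' \<delta> (V n x)))"
          using elim trunc'_bounds[of \<delta> "V n x"] \<phi>01[of x] by (intro mult_left_mono min_one_le_weighted) auto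
        then show ?case unfolding e_def by (simp add: inner_diff_left algebra_simps)
      qed
    qed
    also have "\<dots> = T \<delta> n - U \<delta> n + P \<delta> n"
      unfolding T_def U_def P_def
      by (subst Bochner_Integration.integral_add[OF Bochner_Integration.integrable_diff[OF ii[OF a(1)] ii[OF a0]] iP],
          subst Bochner_Integration.integral_diff[OF ii[OF a(1)] ii[OF a0]], rule refl)
    finally show "X n \<le> T \<delta> n - U \<delta> n + P \<delta> n" .
  qed
  have "X \<longlonglongrightarrow> 0"
  proof (rule order_tendstoI)
    fix y :: real assume "y < 0"
    from less_le_trans[OF this X(1)] show "eventually (\<lambda>n. y < X n) sequentially"
      by (intro always_eventually allI)
  next
    fix y :: real assume y: "0 < y"
    define D where "D = C + L * K + 1"
    have D: "0 < D" using C K0 L by (simp add: D_def add_nonneg_pos)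
    \<comment> \<open>T is at most 2\<delta>D = y/2 for every n. Only after \<delta> is fixed does n
      grow, to bring P - U below y/2.\<close>
    define \<delta> where "\<delta> = y / (4 * D)"
    have \<delta>: "0 < \<delta>" using y D by (simp add: \<delta>_def)
    have T': "T \<delta> n \<le> y / 2" for n
    proof -
      have "T \<delta> n \<le> 2 * \<delta> * (C + L * K)" by (rule T[OF \<delta>])
      also have "\<dots> \<le> 2 * \<delta> * D" using \<delta> by (intro mult_left_mono) (auto simp: D_def)
      also have "\<dots> = y / 2" using D by (simp add: \<delta>_def)
      finally show ?thesis .
    qed
    have "(\<lambda>n. P \<delta> n - U \<delta> n) \<longlonglongrightarrow> 0 - 0" by (intro tendsto_diff P U)
    then have "eventually (\<lambda>n. P \<delta> n - U \<delta> n < y / 2) sequentially"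
      using y by (intro order_tendstoD(2)) auto
    then show "eventually (\<lambda>n. X n < y) sequentially"
    proof eventually_elim
      case (elim n)
      then show ?case using X(2)[of n \<delta>] T'[of n] by linarith
    qed
  qed
  then show ?thesis by (simp add: X_def[abs_def] \<phi>_def e_def)
qed

end

section \<open>Caratheodory functions\<close>

text \<open>Lebesgue measure is complete, so a change on a null set preserves measurability.\<close>

lemma measurable_AE_lebesgue_on:
  fixes f g :: "'a::euclidean_space \<Rightarrow> 'b::euclidean_space"
  assumes \<Omega>: "open \<Omega>" and f: "f \<in> borel_measurable (lebesgue_on \<Omega>)" and ae: "AE x in lebesgue_on \<Omega>. f x = g x"
  shows "g \<in> borel_measurable (lebesgue_on \<Omega>)"
proof -
  have "(\<lambda>x. indicator \<Omega> x *\<^sub>R f x) \<in> borel_measurable lebesgue"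
    using f \<Omega> by (subst (asm) borel_measurable_restrict_space_iff) auto
  moreover have "AE x in lebesgue. x \<in> \<Omega> \<longrightarrow> f x = g x" using ae \<Omega> by (simp add: AE_restrict_space_iff)
  then have "AE x in lebesgue. indicator \<Omega> x *\<^sub>R f x = indicator \<Omega> x *\<^sub>R g x"
    by eventually_elim (auto simp: indicator_def)
  ultimately have "(\<lambda>x. indicator \<Omega> x *\<^sub>R g x) \<in> borel_measurable lebesgue" by (rule borel_measurable_AE)
  then show ?thesis using \<Omega> by (subst borel_measurable_restrict_space_iff) auto
qed

text \<open>For a simple function in place of g the composition is a finite sum of indicators times
  the measurable functions A(x, c). Continuity in the second argument carries this to the limit
  almost everywhere.\<close>

lemma caratheodory_measurable:
  fixes A :: "'a::euclidean_space \<Rightarrow> 'a \<Rightarrow> 'a"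
  assumes \<Omega>: "open \<Omega>" and A: "caratheodory \<Omega> A" and g: "g \<in> borel_measurable (lebesgue_on \<Omega>)"
  shows "(\<lambda>x. A x (g x)) \<in> borel_measurable (lebesgue_on \<Omega>)"
proof -
  let ?M = "lebesgue_on \<Omega>"
  obtain F where F: "\<forall>i. simple_function ?M (F i)" "\<forall>x\<in>space ?M. (\<lambda>i. F i x) \<longlonglongrightarrow> g x"
    using borel_measurable_implies_sequence_metric[OF g, of 0] by (elim exE conjE)
  have Am: "(\<lambda>x. A x \<zeta>) \<in> borel_measurable ?M" for \<zeta> using A by (simp add: caratheodory_def)
  have FA: "(\<lambda>x. A x (F i x)) \<in> borel_measurable ?M" for i
  proof -
    have fin: "finite (F i ` space ?M)" using F(1) by (simp add: simple_function_def)
    have Fs: "F i -` {c} \<inter> space ?M \<in> sets ?M" for c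
      by (rule simple_functionD(2)) (use F(1) in blast)
    have "(\<lambda>x. \<Sum>c\<in>F i ` space ?M. indicator (F i -` {c} \<inter> space ?M) x *\<^sub>R A x c) \<in> borel_measurable ?M"
      by (intro borel_measurable_sum borel_measurable_scaleR borel_measurable_indicator Fs Am)
    also have "?this \<longleftrightarrow> ?thesis"
    proof (rule measurable_cong)
      fix x assume x: "x \<in> space ?M"
      have "(\<Sum>c\<in>F i ` space ?M. indicator (F i -` {c} \<inter> space ?M) x *\<^sub>R A x c)
          = (\<Sum>c\<in>F i ` space ?M. if c = F i x then A x c else 0)"
        using x by (intro sum.cong) (auto simp: indicator_def)
      also have "\<dots> = A x (F i x)" using fin x by (subst sum.delta) auto
      finally show "(\<Sum>c\<in>F i ` space ?M. indicator (F i -` {c} \<inter> space ?M) x *\<^sub>R A x c) = A x (F i x)" .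
    qed
    finally show ?thesis .
  qed
  have "AE x in ?M. continuous_on UNIV (A x)" using A by (simp add: caratheodory_def)
  then obtain N where N: "{x \<in> space ?M. \<not> continuous_on UNIV (A x)} \<subseteq> N" "N \<in> null_sets ?M"
    unfolding eventually_ae_filter by auto
  have Ns: "N \<in> sets ?M" using N(2) by auto
  \<comment> \<open>Setting the values to 0 on the exceptional null set makes the limit hold at
    every point; h agrees with the composition almost everywhere.\<close>
  define h where "h x = indicator (space ?M - N) x *\<^sub>R A x (g x)" for x
  have "h \<in> borel_measurable ?M"
  proof (rule borel_measurable_LIMSEQ_metric)
    show "(\<lambda>x. indicator (space ?M - N) x *\<^sub>R A x (F i x)) \<in> borel_measurable ?M" for i
      using Ns by (intro borel_measurable_scaleR borel_measurable_indicator FA) auto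
    fix x assume x: "x \<in> space ?M"
    show "(\<lambda>i. indicator (space ?M - N) x *\<^sub>R A x (F i x)) \<longlonglongrightarrow> h x"
    proof (cases "x \<in> N")
      case True then show ?thesis by (simp add: h_def)
    next
      case False
      then have "continuous_on UNIV (A x)" using N(1) x by auto
      then have "(\<lambda>i. A x (F i x)) \<longlonglongrightarrow> A x (g x)"
        by (rule continuous_on_tendsto_compose) (use F(2) x in auto)
      then show ?thesis unfolding h_def by (rule tendsto_scaleR[OF tendsto_const])
    qed
  qed
  moreover have "AE x in ?M. x \<notin> N" using N(2) by (rule AE_not_in)
  then have "AE x in ?M. h x = A x (g x)"
    using AE_space by eventually_elim (simp add: h_def)
  ultimately show ?thesis by (rule measurable_AE_lebesgue_on[OF \<Omega>])
qed

section \<open>Strong monotonicity\<close>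

text \<open>The two sides are the values at \<eta> and at D of t^2 (m+t)^(p-2) = t^p
  (t/(m+t))^(2-p), a product of increasing functions of t.\<close>

lemma powr_quotient_lower:
  fixes p :: real
  assumes "1 < p" "p < 2" "0 \<le> m" "0 < \<eta>" "\<eta> \<le> D"
  shows "\<eta> powr p * (\<eta> / (m + \<eta>)) powr (2 - p) \<le> D powr 2 * (m + D) powr (p - 2)"
proof -
  have "\<eta> * m \<le> D * m" using assms by (intro mult_right_mono)
  then have "\<eta> / (m + \<eta>) \<le> D / (m + D)" using assms by (simp add: field_simps)
  then have "\<eta> powr p * (\<eta> / (m + \<eta>)) powr (2 - p) \<le> D powr p * (D / (m + D)) powr (2 - p)"
    using assms by (intro mult_mono powr_mono2) auto
  also have "\<dots> = D powr p * D powr (2 - p) * (m + D) powr (p - 2)"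
  proof -
    have "(m + D) powr (p - 2) = inverse ((m + D) powr (2 - p))"
      using powr_minus[of "m + D" "2 - p"] by simp
    moreover have "(D / (m + D)) powr (2 - p) = D powr (2 - p) / (m + D) powr (2 - p)"
      using assms by (simp add: powr_divide)
    ultimately show ?thesis by (simp add: divide_inverse)
  qed
  also have "D powr p * D powr (2 - p) = D powr 2" using powr_add[of D p "2 - p"] by simp
  finally show ?thesis .
qed

text \<open>At distance at least \<eta> from \<zeta>0 the monotone quantity is bounded below by some
  \<kappa> > 0, so its smallness forces convergence without a prior bound on the sequence. For p < 2
  the power of \<open>A_bar\<close> decays at infinity, and the square of the distance
  compensates.\<close>

lemma strong_monotonicity_convergence:
  fixes F :: "'a::euclidean_space \<Rightarrow> 'a"
  assumes p: "1 < p" and c: "0 < c" and w: "0 < w"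
    and growth: "\<And>\<zeta>. norm (F \<zeta>) \<le> norm \<zeta> powr (p - 1) * w"
    and deg: "\<And>\<zeta>. norm \<zeta> powr p * w \<le> F \<zeta> \<bullet> \<zeta>"
    and mono: "\<And>\<zeta>1 \<zeta>2. \<zeta>1 \<noteq> \<zeta>2 \<Longrightarrow>
       c * norm (\<zeta>1 - \<zeta>2) powr (max p 2) * (1 / w * (F \<zeta>1 \<bullet> \<zeta>1 + F \<zeta>2 \<bullet> \<zeta>2)) powr (1 - max p 2 / p) * w
         \<le> (F \<zeta>1 - F \<zeta>2) \<bullet> (\<zeta>1 - \<zeta>2)"
    and lim: "(\<lambda>n. max 0 (min 1 ((F (\<zeta> n) - F \<zeta>0) \<bullet> (\<zeta> n - \<zeta>0)))) \<longlonglongrightarrow> 0"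
  shows "\<zeta> \<longlonglongrightarrow> \<zeta>0"
proof -
  \<comment> \<open>Growth with Cauchy-Schwarz is the upper bound, degeneracy the lower one. Both
    have constant 1, so equality holds and \<open>A_bar\<close> is the sum of the p-th powers of the
    norms.\<close>
  have F\<zeta>: "1 / w * (F \<xi> \<bullet> \<xi>) = norm \<xi> powr p" for \<xi>
  proof -
    have "F \<xi> \<bullet> \<xi> \<le> norm (F \<xi>) * norm \<xi>" by (rule norm_cauchy_schwarz)
    also have "\<dots> \<le> norm \<xi> powr (p - 1) * w * norm \<xi>" by (intro mult_right_mono growth) auto
    also have "\<dots> = norm \<xi> powr p * w"
      using powr_add[of "norm \<xi>" "p - 1" 1] by (cases "\<xi> = 0") (auto simp: mult_ac)
    finally have "F \<xi> \<bullet> \<xi> = norm \<xi> powr p * w" using deg[of \<xi>] by linarith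
    then show ?thesis using w by simp
  qed
  define m where "m = norm \<zeta>0"
  have m0: "0 \<le> m" by (simp add: m_def)
  have key: "\<exists>\<kappa>>0. \<forall>\<xi>. \<eta> \<le> norm (\<xi> - \<zeta>0) \<longrightarrow> \<kappa> \<le> (F \<xi> - F \<zeta>0) \<bullet> (\<xi> - \<zeta>0)" if \<eta>: "0 < \<eta>" for \<eta>
  proof (cases "2 \<le> p")
    case True
    show ?thesis
    proof (intro exI[of _ "c * \<eta> powr p * w"] conjI allI impI)
      show "0 < c * \<eta> powr p * w" using c w \<eta> by simp
      fix \<xi> assume D: "\<eta> \<le> norm (\<xi> - \<zeta>0)"
      then have ne: "\<xi> \<noteq> \<zeta>0" using \<eta> by auto
      \<comment> \<open>The exponent is 0 for p \<ge> 2, but \<open>0 powr 0\<close> is 0, so the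
        base must be shown positive to get the value 1.\<close>
      have "0 < norm \<xi> powr p + norm \<zeta>0 powr p"
        using ne by (cases "\<xi> = 0") (auto intro: add_pos_nonneg)
      then have one: "(1 / w * (F \<xi> \<bullet> \<xi> + F \<zeta>0 \<bullet> \<zeta>0)) powr (1 - max p 2 / p) = 1"
        unfolding distrib_left F\<zeta> using True by simp
      have "c * \<eta> powr p * w \<le> c * norm (\<xi> - \<zeta>0) powr p * w"
        using D c w p \<eta> by (intro mult_right_mono mult_left_mono powr_mono2) auto
      also have "\<dots> \<le> (F \<xi> - F \<zeta>0) \<bullet> (\<xi> - \<zeta>0)" using mono[OF ne] True unfolding one by simp
      finally show "c * \<eta> powr p * w \<le> (F \<xi> - F \<zeta>0) \<bullet> (\<xi> - \<zeta>0)" .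
    qed
  next
    case False
    \<comment> \<open>The exponent is negative, so an upper bound for \<open>A_bar\<close> bounds
      its power from below; ps = p - 2 turns this into a power of m + d.\<close>
    define s where "s = 1 - 2 / p"
    have s: "s \<le> 0" "p * s = p - 2" using False p by (auto simp: s_def field_simps)
    define \<kappa> where "\<kappa> = c * (2 powr s * (\<eta> powr p * (\<eta> / (m + \<eta>)) powr (2 - p))) * w"
    have k0: "0 < \<kappa>" unfolding \<kappa>_def using c w \<eta> m0 by (intro mult_pos_pos) auto
    show ?thesis
    proof (intro exI[of _ \<kappa>] conjI allI impI)
      fix \<xi> assume D: "\<eta> \<le> norm (\<xi> - \<zeta>0)"
      then have ne: "\<xi> \<noteq> \<zeta>0" using \<eta> by auto
      define d where "d = norm (\<xi> - \<zeta>0)"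
      have d: "\<eta> \<le> d" "0 < d" using D \<eta> by (auto simp: d_def)
      have pos: "0 < norm \<xi> powr p + norm \<zeta>0 powr p"
        using ne by (cases "\<xi> = 0") (auto intro: add_pos_nonneg)
      have "norm \<xi> \<le> m + d" using norm_triangle_sub[of \<xi> \<zeta>0] by (simp add: m_def d_def)
      then have "norm \<xi> powr p \<le> (m + d) powr p" using p by (intro powr_mono2) auto
      moreover have "norm \<zeta>0 powr p \<le> (m + d) powr p" using p d m0 by (intro powr_mono2) (auto simp: m_def)
      ultimately have "norm \<xi> powr p + norm \<zeta>0 powr p \<le> 2 * (m + d) powr p" by simp
      then have "(2 * (m + d) powr p) powr s \<le> (norm \<xi> powr p + norm \<zeta>0 powr p) powr s"
        using pos s(1) by (intro powr_mono2') auto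
      moreover have "(2 * (m + d) powr p) powr s = 2 powr s * (m + d) powr (p - 2)"
        by (simp add: powr_mult powr_powr s(2))
      ultimately have low: "2 powr s * (m + d) powr (p - 2) \<le> (1 / w * (F \<xi> \<bullet> \<xi> + F \<zeta>0 \<bullet> \<zeta>0)) powr s"
        unfolding distrib_left F\<zeta> by simp
      have "\<kappa> \<le> c * (2 powr s * (d powr 2 * (m + d) powr (p - 2))) * w"
        unfolding \<kappa>_def using c w False p \<eta> d m0
        by (intro mult_right_mono mult_left_mono powr_quotient_lower) auto
      also have "\<dots> = c * d powr 2 * (2 powr s * (m + d) powr (p - 2)) * w" by (simp only: mult_ac)
      also have "\<dots> \<le> c * d powr 2 * (1 / w * (F \<xi> \<bullet> \<xi> + F \<zeta>0 \<bullet> \<zeta>0)) powr s * w"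
        using c w by (intro mult_right_mono mult_left_mono low) auto
      also have "\<dots> \<le> (F \<xi> - F \<zeta>0) \<bullet> (\<xi> - \<zeta>0)"
      proof -
        have "max p 2 = 2" using False by simp
        then show ?thesis using mono[OF ne] unfolding s_def d_def by simp
      qed
      finally show "\<kappa> \<le> (F \<xi> - F \<zeta>0) \<bullet> (\<xi> - \<zeta>0)" .
    qed (rule k0)
  qed
  show ?thesis
  proof (rule metric_LIMSEQ_I)
    fix \<eta> :: real assume "0 < \<eta>"
    from key[OF this] obtain \<kappa> where \<kappa>: "0 < \<kappa>" "\<forall>\<xi>. \<eta> \<le> norm (\<xi> - \<zeta>0) \<longrightarrow> \<kappa> \<le> (F \<xi> - F \<zeta>0) \<bullet> (\<xi> - \<zeta>0)" by (elim exE conjE)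
    \<comment> \<open>Below 1 the truncation from above is inactive, so the product itself is less
      than \<kappa>.\<close>
    have "eventually (\<lambda>n. max 0 (min 1 ((F (\<zeta> n) - F \<zeta>0) \<bullet> (\<zeta> n - \<zeta>0))) < min 1 \<kappa>) sequentially"
      using \<kappa>(1) by (intro order_tendstoD(2)[OF lim]) auto
    then have "eventually (\<lambda>n. dist (\<zeta> n) \<zeta>0 < \<eta>) sequentially"
    proof eventually_elim
      case (elim n)
      then have "(F (\<zeta> n) - F \<zeta>0) \<bullet> (\<zeta> n - \<zeta>0) < \<kappa>" by linarith
      then have "\<not> \<eta> \<le> norm (\<zeta> n - \<zeta>0)" using \<kappa>(2) by (meson not_le)
      then show ?case by (simp add: dist_norm)
    qed
    then show "\<exists>no. \<forall>n\<ge>no. dist (\<zeta> n) \<zeta>0 < \<eta>" by (simp add: eventually_sequentially)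
  qed
qed

lemma Linf_norm_bounds:
  assumes \<phi>: "\<phi> \<in> test_functions \<Omega>" and m: "0 \<le> m" "\<And>x. \<bar>\<phi> x\<bar> \<le> m"
  shows "0 \<le> Linf_norm \<Omega> \<phi>" "Linf_norm \<Omega> \<phi> \<le> m"
proof -
  let ?M = "lebesgue_on \<Omega>" and ?f = "\<lambda>x. ereal \<bar>\<phi> x\<bar>"
  have [measurable]: "\<phi> \<in> borel_measurable ?M"
    by (intro measurable_lebesgue_on_borel smooth_measurable test_functions_smooth[OF \<phi>])
  have fm: "?f \<in> borel_measurable ?M" by measurable
  have up: "esssup ?M ?f \<le> ereal m" by (rule esssup_I[OF fm]) (use m(2) in auto)
  show "Linf_norm \<Omega> \<phi> \<le> m"
    using up m(1) unfolding Linf_norm_def by (cases "esssup ?M ?f") auto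
  show "0 \<le> Linf_norm \<Omega> \<phi>"
  proof (cases "emeasure ?M (space ?M) = 0")
    \<comment> \<open>On a null space the essential supremum is -\<infinity>, which
      \<open>real_of_ereal\<close> sends to 0.\<close>
    case True
    then show ?thesis unfolding Linf_norm_def esssup_zero_space[OF True fm] by simp
  next
    case False
    have "esssup ?M (\<lambda>x. 0 :: ereal) \<le> esssup ?M ?f" by (rule esssup_mono) auto
    then have "0 \<le> esssup ?M ?f" using esssup_const[OF False, of "0 :: ereal"] by simp
    then show ?thesis unfolding Linf_norm_def by (rule real_of_ereal_pos)
  qed
qed

section \<open>Sobolev operators\<close>

lemma weak_grad_measurable:
  assumes "open \<Omega>" "has_weak_gradient \<Omega> u g"
  shows "u \<in> borel_measurable (lebesgue_on \<Omega>)" "g \<in> borel_measurable (lebesgue_on \<Omega>)"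
  using assms by (auto simp: has_weak_gradient_def intro: locally_integrable_measurable)

lemma W1p_integrable:
  assumes \<Omega>: "open \<Omega>" and u: "u \<in> W1p p \<Omega> w"
  shows "integrable (lebesgue_on \<Omega>) (\<lambda>x. norm (u x) powr p * w x)"
    "integrable (lebesgue_on \<Omega>) (\<lambda>x. norm (weak_grad \<Omega> u x) powr p * w x)"
  using u unfolding W1p_def by (simp_all add: absolutely_integrable_lebesgue_on[OF \<Omega>])

lemma W1p_norm_lebesgue_on:
  assumes "open \<Omega>"
  shows "W1p_norm p \<Omega> w u = (LINT x|lebesgue_on \<Omega>. norm (u x) powr p * w x) powr (1 / p) +
     (LINT x|lebesgue_on \<Omega>. norm (weak_grad \<Omega> u x) powr p * w x) powr (1 / p)"
  unfolding W1p_norm_def by (simp add: lint_lebesgue_on[OF assms])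

lemma sobolev_operator_id:
  fixes w :: "'a::euclidean_space \<Rightarrow> real"
  assumes \<Omega>: "open \<Omega>" and pq: "1 < p" "1 < q" "1 / p + 1 / q = 1"
    and w: "w \<in> borel_measurable (lebesgue_on \<Omega>)" "AE x in lebesgue_on \<Omega>. 0 \<le> w x"
  shows "sobolev_operator \<Omega> p q w (\<lambda>v. v :: 'a \<Rightarrow> real)"
proof
  fix u v :: "'a \<Rightarrow> real" and a :: real
  show "v \<in> borel_measurable (lebesgue_on \<Omega>)" if "v \<in> W1p p \<Omega> w" for v :: "'a \<Rightarrow> real"
    using weak_grad_measurable[OF \<Omega> W1p_has_weak_gradient[OF that]] by simp
  note m = this
  show "(\<lambda>x. u x + v x) \<in> borel_measurable (lebesgue_on \<Omega>)" if "u \<in> W1p p \<Omega> w" "v \<in> W1p p \<Omega> w"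
    using m[OF that(1)] m[OF that(2)] by measurable
  show "(\<lambda>x. a * u x) \<in> borel_measurable (lebesgue_on \<Omega>)" if "u \<in> W1p p \<Omega> w"
    using m[OF that] by measurable
  show "integrable (lebesgue_on \<Omega>) (\<lambda>x. norm (v x) powr p * w x)" if "v \<in> W1p p \<Omega> w"
    by (rule W1p_integrable(1)[OF \<Omega> that])
  show "(LINT x|lebesgue_on \<Omega>. norm (v x) powr p * w x) powr (1 / p) \<le> W1p_norm p \<Omega> w v"
    unfolding W1p_norm_lebesgue_on[OF \<Omega>] by simp
qed (use pq w in auto)

lemma sobolev_operator_weak_grad:
  fixes w :: "'a::euclidean_space \<Rightarrow> real"
  assumes \<Omega>: "open \<Omega>" and pq: "1 < p" "1 < q" "1 / p + 1 / q = 1"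
    and w: "w \<in> borel_measurable (lebesgue_on \<Omega>)" "AE x in lebesgue_on \<Omega>. 0 \<le> w x"
  shows "sobolev_operator \<Omega> p q w (weak_grad \<Omega>)"
proof
  fix u v :: "'a \<Rightarrow> real" and a :: real
  show "weak_grad \<Omega> v \<in> borel_measurable (lebesgue_on \<Omega>)" if "v \<in> W1p p \<Omega> w"
    by (rule weak_grad_measurable(2)[OF \<Omega> W1p_has_weak_gradient[OF that]])
  show "weak_grad \<Omega> (\<lambda>x. u x + v x) \<in> borel_measurable (lebesgue_on \<Omega>)" if "u \<in> W1p p \<Omega> w" "v \<in> W1p p \<Omega> w"
    by (rule weak_grad_measurable(2)[OF \<Omega> has_weak_gradient_weak_grad[OF
        has_weak_gradient_add[OF \<Omega> W1p_has_weak_gradient[OF that(1)] W1p_has_weak_gradient[OF that(2)]]]])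
  show "weak_grad \<Omega> (\<lambda>x. a * u x) \<in> borel_measurable (lebesgue_on \<Omega>)" if "u \<in> W1p p \<Omega> w"
    by (rule weak_grad_measurable(2)[OF \<Omega> has_weak_gradient_weak_grad[OF
        has_weak_gradient_cmult[OF \<Omega> W1p_has_weak_gradient[OF that]]]])
  show "integrable (lebesgue_on \<Omega>) (\<lambda>x. norm (weak_grad \<Omega> v x) powr p * w x)" if "v \<in> W1p p \<Omega> w"
    by (rule W1p_integrable(2)[OF \<Omega> that])
  show "(LINT x|lebesgue_on \<Omega>. norm (weak_grad \<Omega> v x) powr p * w x) powr (1 / p) \<le> W1p_norm p \<Omega> w v"
    unfolding W1p_norm_lebesgue_on[OF \<Omega>] by simp
  show "AE x in lebesgue_on \<Omega>. weak_grad \<Omega> (\<lambda>x. u x + v x) x = weak_grad \<Omega> u x + weak_grad \<Omega> v x"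
    if "u \<in> W1p p \<Omega> w" "v \<in> W1p p \<Omega> w" by (rule weak_grad_add[OF \<Omega> that])
  show "AE x in lebesgue_on \<Omega>. weak_grad \<Omega> (\<lambda>x. a * u x) x = a *\<^sub>R weak_grad \<Omega> u x"
    if "u \<in> W1p p \<Omega> w" by (rule weak_grad_cmult[OF \<Omega> that])
qed (use pq w in auto)

section \<open>Borel representatives of a weight and of Sobolev functions\<close>

lemma weight_borel_rep:
  fixes w :: "'a::euclidean_space \<Rightarrow> real"
  assumes w: "w \<in> borel_measurable lebesgue" "AE x in lebesgue. 0 < w x"
  shows "\<exists>W. W \<in> borel_measurable borel \<and> (\<forall>x. 0 < W x) \<and> (AE x in lborel. W x = w x)"
proof -
  have "w \<in> borel_measurable (lebesgue_on UNIV)" using w(1) by simp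
  then obtain w1 where w1: "borel_rep UNIV w w1" using borel_rep_exists[OF open_UNIV] by blast
  have [measurable]: "w1 \<in> borel_measurable borel" using w1 by (simp add: borel_rep_def)
  \<comment> \<open>The value 1 is put where the Borel representative is not positive, which happens
    only on a null set.\<close>
  define W where "W x = (if 0 < w1 x then w1 x else 1)" for x
  have "AE x in lborel. w1 x = w x" using w1 by (simp add: borel_rep_def AE_lebesgue_on)
  moreover have "AE x in lborel. 0 < w x" using w(2) by (simp add: AE_completion_iff)
  ultimately have "AE x in lborel. W x = w x" by eventually_elim (simp add: W_def)
  moreover have "W \<in> borel_measurable borel" unfolding W_def by measurable
  moreover have "0 < W x" for x by (simp add: W_def)
  ultimately show ?thesis by (intro exI[of _ W] conjI allI)
qed

text \<open>F is the identity or the power -1/(p-1): one transfer for both averages in the A_p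
  condition.\<close>

lemma ball_transfer:
  fixes w W :: "'a::euclidean_space \<Rightarrow> real" and F :: "real \<Rightarrow> real"
  assumes w: "w \<in> borel_measurable lebesgue" and W: "W \<in> borel_measurable borel" "AE x in lborel. W x = w x"
    and F: "F \<in> borel_measurable borel"
  shows "(\<lambda>y. F (w y)) absolutely_integrable_on ball x r \<longleftrightarrow> set_integrable lborel (ball x r) (\<lambda>y. F (W y))"
    "(LINT y:ball x r|lebesgue. F (w y)) = (LINT y:ball x r|lborel. F (W y))"
proof -
  note [measurable] = W(1) F
  let ?h = "\<lambda>y. indicator (ball x r) y *\<^sub>R F (W y)"
  have o: "open (ball x r)" by simp
  have [measurable]: "ball x r \<in> sets borel" "(\<lambda>y. F (W y)) \<in> borel_measurable borel"
    using measurable_compose[OF W(1) F] by simp_all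
  have hm: "?h \<in> borel_measurable borel" by measurable
  have h0: "?h y = 0" if "y \<notin> ball x r" for y using that by simp
  have wm: "(\<lambda>y. F (w y)) \<in> borel_measurable (lebesgue_on (ball x r))"
  proof (rule measurable_restrict_space1)
    show "(\<lambda>y. F (w y)) \<in> borel_measurable lebesgue" using measurable_compose[OF w F] .
  qed
  have ae: "AE y in lebesgue_on (ball x r). ?h y = F (w y)"
    unfolding AE_lebesgue_on[OF o] using W(2) by eventually_elim simp
  note t = borel_transfer[OF o hm h0 wm ae]
  show "(\<lambda>y. F (w y)) absolutely_integrable_on ball x r \<longleftrightarrow> set_integrable lborel (ball x r) (\<lambda>y. F (W y))"
    using t(1) absolutely_integrable_lebesgue_on[OF o, of "\<lambda>y. F (w y)"]
    unfolding set_integrable_def[of lborel] by (rule trans[rotated])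
  show "(LINT y:ball x r|lebesgue. F (w y)) = (LINT y:ball x r|lborel. F (W y))"
    using t(2) lint_lebesgue_on[OF o, of "\<lambda>y. F (w y)"]
    unfolding set_lebesgue_integral_def[of lborel] by (rule trans[rotated])
qed

lemma Ap_domainI:
  fixes w W :: "'a::euclidean_space \<Rightarrow> real"
  assumes \<Omega>: "open \<Omega>" "bounded \<Omega>" and pq: "1 < p" "1 < q" "1 / p + 1 / q = 1"
    and Ap: "Ap_weight p w" and wm: "w \<in> borel_measurable lebesgue"
    and W: "W \<in> borel_measurable borel" "\<And>x. 0 < W x" "AE x in lborel. W x = w x"
  shows "\<exists>c. Ap_domain \<Omega> p q c W"
proof -
  have li: "locally_integrable_on w UNIV" using Ap by (simp add: Ap_weight_def)
  obtain c where c: "0 < c" "\<forall>x r. 0 < r \<longrightarrow>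
        (\<lambda>y. w y powr (- 1 / (p - 1))) absolutely_integrable_on ball x r \<and>
        (1 / measure lebesgue (ball x r) * (LINT y:ball x r|lebesgue. w y)) *
        (1 / measure lebesgue (ball x r) *
           (LINT y:ball x r|lebesgue. w y powr (- 1 / (p - 1)))) powr (p - 1) \<le> c"
    using Ap unfolding Ap_weight_def by (elim conjE exE)
  have Fm: "(\<lambda>t. t powr (- 1 / (p - 1))) \<in> borel_measurable (borel :: real measure)" by measurable
  have idm: "(\<lambda>t. t) \<in> borel_measurable (borel :: real measure)" by measurable
  have "Ap_domain \<Omega> p q c W"
  proof
    fix x :: 'a and r :: real assume r: "0 < r"
    have "w absolutely_integrable_on cball x r" using li by (simp add: locally_integrable_on_def)
    then have "w absolutely_integrable_on ball x r" by (rule set_integrable_subset) auto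
    then show "set_integrable lborel (ball x r) W" using ball_transfer(1)[OF wm W(1,3) idm] by simp
    show "set_integrable lborel (ball x r) (\<lambda>y. W y powr (- 1 / (p - 1)))"
      using c(2) r ball_transfer(1)[OF wm W(1,3) Fm, of x r] by simp
    show "1 / measure lborel (ball x r) * (LINT y:ball x r|lborel. W y) *
      (1 / measure lborel (ball x r) * (LINT y:ball x r|lborel. W y powr (- 1 / (p - 1)))) powr (p - 1) \<le> c"
      using c(2)[rule_format, OF r, of x] unfolding ball_transfer(2)[OF wm W(1,3) Fm] ball_transfer(2)[OF wm W(1,3) idm]
      by simp
  qed (use \<Omega> pq W in auto)
  then show ?thesis ..
qed

lemma borel_repD:
  "borel_rep \<Omega> f f' \<Longrightarrow> f' \<in> borel_measurable borel" "borel_rep \<Omega> f f' \<Longrightarrow> x \<notin> \<Omega> \<Longrightarrow> f' x = 0"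
  "borel_rep \<Omega> f f' \<Longrightarrow> AE x in lebesgue_on \<Omega>. f' x = f x"
  by (simp_all add: borel_rep_def)

text \<open>The difference appears as a sum with -1 times g because that is the form produced by
  \<open>has_weak_gradient_add\<close> and \<open>has_weak_gradient_cmult\<close>.\<close>

lemma borel_rep_diff:
  "borel_rep \<Omega> f f' \<Longrightarrow> borel_rep \<Omega> g g' \<Longrightarrow> borel_rep \<Omega> (\<lambda>x. f x + (-1) *\<^sub>R g x) (\<lambda>x. f' x - g' x)"
proof -
  assume a: "borel_rep \<Omega> f f'" "borel_rep \<Omega> g g'"
  note [measurable] = borel_repD(1)[OF a(1)] borel_repD(1)[OF a(2)]
  have "AE x in lebesgue_on \<Omega>. f' x - g' x = f x + (-1) *\<^sub>R g x"
    using borel_repD(3)[OF a(1)] borel_repD(3)[OF a(2)] by eventually_elim simp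
  then show ?thesis using borel_repD(2)[OF a(1)] borel_repD(2)[OF a(2)] unfolding borel_rep_def by auto
qed

lemma wgrad_borel_rep:
  assumes \<Omega>: "open \<Omega>" and wg: "has_weak_gradient \<Omega> u g" and U: "borel_rep \<Omega> u U" and G: "borel_rep \<Omega> g G"
  shows "wgrad \<Omega> U G"
  unfolding wgrad_def
proof (intro ballI)
  fix \<phi> b assume \<phi>: "\<phi> \<in> test_functions \<Omega>" and b: "b \<in> (Basis :: 'a set)"
  have [measurable]: "\<phi> \<in> borel_measurable borel" "partials [b] \<phi> \<in> borel_measurable borel"
    using smooth_measurable smooth_partials[OF _ b] test_functions_smooth[OF \<phi>] by blast+
  note [measurable] = borel_repD(1)[OF U] borel_repD(1)[OF G]
  note i = has_weak_gradient_inner_integrable[OF \<Omega> wg \<phi> b]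
  have "(LINT x|lborel. U x * partials [b] \<phi> x) = (LINT x|lebesgue_on \<Omega>. u x * partials [b] \<phi> x)"
  proof (rule borel_transfer(2)[symmetric, OF \<Omega> _ _ borel_measurable_integrable[OF i(1)]])
    show "AE x in lebesgue_on \<Omega>. U x * partials [b] \<phi> x = u x * partials [b] \<phi> x"
      using borel_repD(3)[OF U] by eventually_elim simp
    show "U x * partials [b] \<phi> x = 0" if "x \<notin> \<Omega>" for x using borel_repD(2)[OF U that] by simp
  qed measurable
  also have "\<dots> = - (LINT x|lebesgue_on \<Omega>. (g x \<bullet> b) * \<phi> x)" by (rule has_weak_gradientD[OF \<Omega> wg \<phi> b])
  also have "(LINT x|lebesgue_on \<Omega>. (g x \<bullet> b) * \<phi> x) = (LINT x|lborel. (G x \<bullet> b) * \<phi> x)"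
  proof (rule borel_transfer(2)[OF \<Omega> _ _ borel_measurable_integrable[OF i(2)]])
    show "AE x in lebesgue_on \<Omega>. (G x \<bullet> b) * \<phi> x = (g x \<bullet> b) * \<phi> x"
      using borel_repD(3)[OF G] by eventually_elim simp
    show "(G x \<bullet> b) * \<phi> x = 0" if "x \<notin> \<Omega>" for x using borel_repD(2)[OF G that] by simp
  qed measurable
  finally show "(LINT x|lborel. U x * partials [b] \<phi> x) = - (LINT x|lborel. (G x \<bullet> b) * \<phi> x)" .
qed

section \<open>Transfer of bounds and weak convergence to Borel representatives\<close>

context Ap_domain
begin

lemma Lp_borel_rep:
  fixes f :: "'a \<Rightarrow> 'b::euclidean_space"
  assumes wW: "AE x in lebesgue_on \<Omega>. W x = w x"
    and f: "f \<in> borel_measurable (lebesgue_on \<Omega>)" "integrable (lebesgue_on \<Omega>) (\<lambda>x. norm (f x) powr p * w x)"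
    and F: "borel_rep \<Omega> f F"
  shows "Lp F" "Ip F = (LINT x|lebesgue_on \<Omega>. norm (f x) powr p * w x)"
proof -
  note [measurable] = borel_repD(1)[OF F]
  have ae: "AE x in lebesgue_on \<Omega>. norm (F x) powr p * W x = norm (f x) powr p * w x"
    using borel_repD(3)[OF F] wW by eventually_elim simp
  have z: "norm (F x) powr p * W x = 0" if "x \<notin> \<Omega>" for x using borel_repD(2)[OF F that] pq by simp
  have m: "(\<lambda>x. norm (F x) powr p * W x) \<in> borel_measurable borel" by measurable
  note t = borel_transfer[OF \<Omega>o m z borel_measurable_integrable[OF f(2)] ae]
  show "Lp F" unfolding Lp_def using t(1) f(2) borel_repD(1,2)[OF F] by simp
  show "Ip F = (LINT x|lebesgue_on \<Omega>. norm (f x) powr p * w x)" unfolding Ip_def using t(2) by simp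
qed

text \<open>Restricted to \<Omega>, an element of L^q(W) defines a bounded functional on W^{1,p}
  through T; weak convergence for this functional is rewritten with representatives.\<close>

lemma Lq_dual_ok:
  fixes T :: "('a \<Rightarrow> real) \<Rightarrow> 'a \<Rightarrow> 'b::euclidean_space"
  assumes so: "sobolev_operator \<Omega> p q w T" and wW: "AE x in lebesgue_on \<Omega>. W x = w x"
    and conv: "W1p_weakly_tendsto p \<Omega> w us u" and k: "Lq k"
    and F: "\<And>n. borel_rep \<Omega> (T (us n)) (F n)" and F0: "borel_rep \<Omega> (T u) F0"
  shows "(\<lambda>n. LINT x|lborel. (k x \<bullet> (F n x - F0 x)) * W x) \<longlonglongrightarrow> 0"
proof -
  interpret sobolev_operator \<Omega> p q w T by (rule so)
  have km [measurable]: "k \<in> borel_measurable borel" using k by (simp add: Lq_def)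
  have kM [measurable]: "k \<in> borel_measurable (lebesgue_on \<Omega>)" by (rule measurable_lebesgue_on_borel[OF km])
  have ok: "dual_ok k"
  proof -
    have "integrable lborel (\<lambda>x. indicator \<Omega> x *\<^sub>R (norm (k x) powr q * W x))"
      by (rule integrable_bounded_mult[where B = 1]) (use k in \<open>auto simp: Lq_def indicator_def\<close>)
    then have "integrable lborel (\<lambda>x. indicator \<Omega> x * (norm (k x) powr q * W x))" by simp
    then have "integrable (lebesgue_on \<Omega>) (\<lambda>x. norm (k x) powr q * w x)"
    proof (subst borel_transfer(1)[OF \<Omega>o])
      show "AE x in lebesgue_on \<Omega>. indicator \<Omega> x * (norm (k x) powr q * W x) = norm (k x) powr q * w x"
        using wW AE_space by eventually_elim simp
    qed auto
    then show ?thesis unfolding dual_ok_def using kM by simp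
  qed
  have us: "us n \<in> W1p p \<Omega> w" "u \<in> W1p p \<Omega> w" for n using conv by (auto simp: W1p_weakly_tendsto_def)
  have tr: "(LINT x|lebesgue_on \<Omega>. (k x \<bullet> T v x) * w x) = (LINT x|lborel. (k x \<bullet> E x) * W x)"
    "integrable lborel (\<lambda>x. (k x \<bullet> E x) * W x)"
    if v: "v \<in> W1p p \<Omega> w" and E: "borel_rep \<Omega> (T v) E" for v E
  proof -
    note [measurable] = borel_repD(1)[OF E]
    have i: "integrable (lebesgue_on \<Omega>) (\<lambda>x. (k x \<bullet> T v x) * w x)" by (rule Fk_bound(2)[OF ok v])
    have m: "(\<lambda>x. (k x \<bullet> E x) * W x) \<in> borel_measurable borel" by measurable
    have z: "(k x \<bullet> E x) * W x = 0" if "x \<notin> \<Omega>" for x using borel_repD(2)[OF E that] by simp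
    have ae: "AE x in lebesgue_on \<Omega>. (k x \<bullet> E x) * W x = (k x \<bullet> T v x) * w x"
      using borel_repD(3)[OF E] wW by eventually_elim simp
    note t = borel_transfer[OF \<Omega>o m z borel_measurable_integrable[OF i] ae]
    show "(LINT x|lebesgue_on \<Omega>. (k x \<bullet> T v x) * w x) = (LINT x|lborel. (k x \<bullet> E x) * W x)" by (rule t(2))
    show "integrable lborel (\<lambda>x. (k x \<bullet> E x) * W x)" using i t(1) by simp
  qed
  have "(LINT x|lborel. (k x \<bullet> (F n x - F0 x)) * W x)
      = (LINT x|lborel. (k x \<bullet> F n x) * W x) - (LINT x|lborel. (k x \<bullet> F0 x) * W x)" for n
    unfolding inner_diff_right left_diff_distrib
    by (rule Bochner_Integration.integral_diff[OF tr(2)[OF us(1) F] tr(2)[OF us(2) F0]])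
  moreover have "(\<lambda>n. LINT x|lborel. (k x \<bullet> F n x) * W x) \<longlonglongrightarrow> (LINT x|lborel. (k x \<bullet> F0 x) * W x)"
    using Fk_tendsto[OF conv ok] unfolding tr(1)[OF us(1) F] tr(1)[OF us(2) F0] .
  ultimately show ?thesis by (simp add: LIM_zero)
qed

text \<open>The function \<eta>/W on \<Omega> is an element of L^q(W), and its weighted pairing with
  V n is the integral of \<eta> V n.\<close>

lemma weak_bounded:
  fixes V :: "nat \<Rightarrow> 'a \<Rightarrow> real"
  assumes weak: "\<And>k :: 'a \<Rightarrow> real. Lq k \<Longrightarrow> (\<lambda>n. LINT x|lborel. (k x \<bullet> V n x) * W x) \<longlonglongrightarrow> 0"
    and V: "\<And>n. Lp (V n)" and \<eta>: "\<eta> \<in> borel_measurable borel" "\<And>x. \<bar>\<eta> x\<bar> \<le> m"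
  shows "(\<lambda>n. LINT x|lborel. \<eta> x * V n x) \<longlonglongrightarrow> 0"
proof -
  have "((indicator \<Omega> x * \<eta> x / W x) \<bullet> V n x) * W x = \<eta> x * V n x" for n x
    using Wpos[of x] LpD(2)[OF V, of x n] by (cases "x \<in> \<Omega>") auto
  with weak[OF Lq_over_W[OF \<eta>]] show ?thesis by simp
qed

text \<open>By the growth condition |a/W|^q W is at most |G|^((p-1)q) W, and (p-1)q = p.\<close>

lemma flux_borel_rep:
  fixes g a :: "'a \<Rightarrow> 'a"
  assumes wW: "AE x in lebesgue_on \<Omega>. W x = w x"
    and G: "borel_rep \<Omega> g G" "Lp G" and a': "borel_rep \<Omega> a a'"
    and growth: "AE x in lebesgue_on \<Omega>. norm (a x) \<le> norm (g x) powr (p - 1) * w x"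
  shows "flux a'" "Iq (over a') \<le> Ip G"
proof -
  note [measurable] = borel_repD(1)[OF G(1)] borel_repD(1)[OF a']
  have "AE x in lebesgue_on \<Omega>. norm (a' x) \<le> norm (G x) powr (p - 1) * W x"
    using borel_repD(3)[OF G(1)] borel_repD(3)[OF a'] wW growth by eventually_elim simp
  then have "AE x in lborel. x \<in> \<Omega> \<longrightarrow> norm (a' x) \<le> norm (G x) powr (p - 1) * W x" using \<Omega>o by (simp add: AE_lebesgue_on)
  then have le: "AE x in lborel. norm (over a' x) powr q * W x \<le> norm (G x) powr p * W x"
  proof eventually_elim
    case (elim x)
    show ?case
    proof (cases "x \<in> \<Omega>")
      case True
      have "norm (over a' x) = norm (a' x) / W x" using Wpos[of x] by (simp add: over_def)
      also have "\<dots> \<le> norm (G x) powr (p - 1)" using elim True Wpos[of x] by (simp add: divide_le_eq)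
      finally have "norm (over a' x) powr q \<le> (norm (G x) powr (p - 1)) powr q" using pq by (intro powr_mono2) auto
      also have "\<dots> = norm (G x) powr p" using qm1(2) by (simp add: powr_powr)
      finally show ?thesis using Wpos[of x] by (intro mult_right_mono) auto
    next
      case False
      then show ?thesis using borel_repD(2)[OF a' False] pq Wpos[of x] by (simp add: over_def)
    qed
  qed
  have Gi: "integrable lborel (\<lambda>x. norm (G x) powr p * W x)" by (rule LpD(3)[OF G(2)])
  have i: "integrable lborel (\<lambda>x. norm (over a' x) powr q * W x)"
  proof (rule Bochner_Integration.integrable_bound[OF Gi])
    show "AE x in lborel. norm (norm (over a' x) powr q * W x) \<le> norm (norm (G x) powr p * W x)"
      using le
    proof eventually_elim
      case (elim x) then show ?case using Wpos[of x] by (simp add: abs_mult)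
    qed
  qed measurable
  show "flux a'" unfolding flux_def Lq_def using i borel_repD(2)[OF a'] by simp
  show "Iq (over a') \<le> Ip G" unfolding Iq_def Ip_def by (rule integral_mono_AE[OF i Gi le])
qed

text \<open>\<open>AE_subseq_of_bumps\<close> takes functions with values between 0 and 1, so it is
  applied to \<open>min 1\<close> of the absolute value; the minimum is inactive once it falls below
  1.\<close>

lemma AE_subseq_locally_L1:
  fixes V :: "nat \<Rightarrow> 'a \<Rightarrow> real"
  assumes ne: "\<Omega> \<noteq> {}" and V: "\<And>n. Lp (V n)"
    and lim: "\<And>x0 r. 0 < r \<Longrightarrow> cball x0 r \<subseteq> \<Omega> \<Longrightarrow> (\<lambda>n. LINT x|lborel. bump x0 r x * \<bar>V n x\<bar>) \<longlonglongrightarrow> 0"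
  shows "\<exists>r. strict_mono r \<and> (AE x in lborel. (\<lambda>n. V (r n) x) \<longlonglongrightarrow> 0)"
proof -
  note [measurable] = LpD(1)[OF V]
  have "\<exists>r. strict_mono r \<and> (AE x in lborel. x \<in> \<Omega> \<longrightarrow> (\<lambda>n. min 1 \<bar>V (r n) x\<bar>) \<longlonglongrightarrow> 0)"
  proof (rule AE_subseq_of_bumps[OF \<Omega>o \<Omega>b ne])
    fix x0 r assume r: "0 < r" "cball x0 (2 * r) \<subseteq> \<Omega>"
    have sub: "cball x0 r \<subseteq> \<Omega>" using r by (auto simp: subset_iff)
    show "(\<lambda>n. LINT x|lborel. bump x0 r x * min 1 \<bar>V n x\<bar>) \<longlonglongrightarrow> 0"
    proof (rule tendsto_sandwich[OF _ _ tendsto_const lim[OF r(1) sub]])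
      show "eventually (\<lambda>n. 0 \<le> (LINT x|lborel. bump x0 r x * min 1 \<bar>V n x\<bar>)) sequentially"
        by (intro always_eventually allI integral_nonneg_AE AE_I2) (simp add: bump_nonneg)
      show "eventually (\<lambda>n. (LINT x|lborel. bump x0 r x * min 1 \<bar>V n x\<bar>) \<le> (LINT x|lborel. bump x0 r x * \<bar>V n x\<bar>)) sequentially"
      proof (intro always_eventually allI integral_mono)
        fix n x
        show "integrable lborel (\<lambda>x. bump x0 r x * min 1 \<bar>V n x\<bar>)" by (rule bump_integrable_bounded[OF r(1), of _ 1]) auto
        show "integrable lborel (\<lambda>x. bump x0 r x * \<bar>V n x\<bar>)"
          using integrable_bounded_mult[of lborel "\<lambda>x. \<bar>V n x\<bar>" "bump x0 r" 1] Lp_integrable(1)[OF V[of n]] bump_nonneg[of x0 r] bump_le_1[of x0 r] by simp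
        show "bump x0 r x * min 1 \<bar>V n x\<bar> \<le> bump x0 r x * \<bar>V n x\<bar>" by (intro mult_left_mono bump_nonneg) simp
      qed
    qed
  qed (auto intro!: borel_measurable_min)
  then obtain r where r: "strict_mono r" "AE x in lborel. x \<in> \<Omega> \<longrightarrow> (\<lambda>n. min 1 \<bar>V (r n) x\<bar>) \<longlonglongrightarrow> 0" by (elim exE conjE)
  have "AE x in lborel. (\<lambda>n. V (r n) x) \<longlonglongrightarrow> 0"
    using r(2)
  proof eventually_elim
    case (elim x)
    show ?case
    proof (cases "x \<in> \<Omega>")
      case True
      then have l: "(\<lambda>n. min 1 \<bar>V (r n) x\<bar>) \<longlonglongrightarrow> 0" using elim by simp
      have "eventually (\<lambda>n. min 1 \<bar>V (r n) x\<bar> < 1) sequentially" by (rule order_tendstoD(2)[OF l]) simp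
      then have "eventually (\<lambda>n. min 1 \<bar>V (r n) x\<bar> = \<bar>V (r n) x\<bar>) sequentially" by eventually_elim auto
      from Lim_transform_eventually[OF l this] show ?thesis by (rule tendsto_rabs_zero_cancel)
    next
      case False
      then show ?thesis using LpD(2)[OF V] by simp
    qed
  qed
  with r(1) show ?thesis by blast
qed

end

theorem theorem2p11:
  fixes \<Omega> :: "'a::euclidean_space set"
    and p s :: real
    and w :: "'a \<Rightarrow> real"
    and A :: "'a \<Rightarrow> 'a \<Rightarrow> 'a"
    and u_seq :: "nat \<Rightarrow> 'a \<Rightarrow> real"
    and u :: "'a \<Rightarrow> real"
    and G :: "nat \<Rightarrow> ('a \<Rightarrow> real) \<Rightarrow> real"
  assumes "DIM('a) \<ge> 2"
    and "bounded_smooth_domain \<Omega>"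
    and "1 < p"
    and "s \<ge> 1 / (p - 1)" and "s > real DIM('a) / p"
    and "As_weight p s \<Omega> w"
    and "structure_conditions p \<Omega> w A"
    and "\<And>n. u_seq n \<in> W1p p \<Omega> w"
    and "\<And>n. distribution_on \<Omega> (G n)"
    and "\<And>n. solves \<Omega> A (u_seq n) (G n)"
    and "W1p_weakly_tendsto p \<Omega> w u_seq u"
    and "\<And>K. compact K \<Longrightarrow> K \<subseteq> \<Omega> \<Longrightarrow>
           \<exists>C. \<forall>n. \<forall>\<phi>\<in>test_functions \<Omega>. supp \<phi> \<subseteq> K \<longrightarrow> \<bar>G n \<phi>\<bar> \<le> C * Linf_norm \<Omega> \<phi>"
  shows "\<exists>r :: nat \<Rightarrow> nat. strict_mono r \<and>
           (AE x in lebesgue_on \<Omega>.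
              (\<lambda>k. weak_grad \<Omega> (u_seq (r k)) x) \<longlonglongrightarrow> weak_grad \<Omega> u x)"
proof -

  \<comment> \<open>A Borel weight and uniform bounds for the sequence\<close>
  note p = assms(3) and us = assms(8) and sol = assms(10) and conv = assms(11)
  have \<Omega>: "open \<Omega>" "bounded \<Omega>" "\<Omega> \<noteq> {}" using assms(2) by (simp_all add: bounded_smooth_domain_def)
  let ?M = "lebesgue_on \<Omega>"
  define q where "q = p / (p - 1)"
  have pq: "1 < p" "1 < q" "1 / p + 1 / q = 1" using p by (auto simp: q_def field_simps)
  have u: "u \<in> W1p p \<Omega> w" using conv by (simp add: W1p_weakly_tendsto_def)
  have Apw: "Ap_weight p w" using assms(6) by (simp add: As_weight_def)
  have wl: "w \<in> borel_measurable lebesgue"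
    using locally_integrable_measurable[OF open_UNIV, of w] Apw by (simp add: Ap_weight_def)
  have wM: "w \<in> borel_measurable ?M" by (rule measurable_restrict_space1[OF wl])
  have wp: "AE x in lebesgue. 0 < w x" using Apw by (simp add: Ap_weight_def)
  obtain W where W': "W \<in> borel_measurable borel" "\<forall>x. 0 < W x" "AE x in lborel. W x = w x"
    using weight_borel_rep[OF wl wp] by (elim exE conjE)
  then have W: "W \<in> borel_measurable borel" "\<And>x. 0 < W x" "AE x in lborel. W x = w x" by blast+
  have wW: "AE x in ?M. W x = w x" unfolding AE_lebesgue_on[OF \<Omega>(1)] using W(3) by eventually_elim simp
  have wpos: "AE x in ?M. 0 < w x" using wW by eventually_elim (use W(2) in metis)
  then have w0: "AE x in ?M. 0 \<le> w x" by eventually_elim simp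
  obtain c where "Ap_domain \<Omega> p q c W" using Ap_domainI[OF \<Omega>(1,2) pq Apw wl W] ..
  then interpret Ap_domain \<Omega> p q c W .
  note so_id = sobolev_operator_id[OF \<Omega>(1) pq wM w0]
  note so_gr = sobolev_operator_weak_grad[OF \<Omega>(1) pq wM w0]
  obtain B1 where B1: "\<forall>n. (LINT x|?M. norm (u_seq n x) powr p * w x) \<le> B1"
    using sobolev_operator.weakly_convergent_bounded[OF so_id conv] ..
  obtain B2 where B2: "\<forall>n. (LINT x|?M. norm (weak_grad \<Omega> (u_seq n) x) powr p * w x) \<le> B2"
    using sobolev_operator.weakly_convergent_bounded[OF so_gr conv] ..

  \<comment> \<open>The differences and their Borel representatives\<close>
  define g where "g n = weak_grad \<Omega> (u_seq n)" for n
  define g0 where "g0 = weak_grad \<Omega> u"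
  have hw: "has_weak_gradient \<Omega> (u_seq n) (g n)" "has_weak_gradient \<Omega> u g0" for n
    unfolding g_def g0_def by (rule W1p_has_weak_gradient[OF us], rule W1p_has_weak_gradient[OF u])
  note um = weak_grad_measurable[OF \<Omega>(1) hw(1)] and u0m = weak_grad_measurable[OF \<Omega>(1) hw(2)]
  have "\<forall>n. \<exists>U. borel_rep \<Omega> (u_seq n) U" using borel_rep_exists[OF \<Omega>(1) um(1)] by metis
  from choice[OF this] obtain U where U: "\<forall>n. borel_rep \<Omega> (u_seq n) (U n)" ..
  have "\<forall>n. \<exists>U. borel_rep \<Omega> (g n) U" using borel_rep_exists[OF \<Omega>(1) um(2)] by metis
  from choice[OF this] obtain H where H: "\<forall>n. borel_rep \<Omega> (g n) (H n)" ..
  obtain U0 where U0: "borel_rep \<Omega> u U0" using borel_rep_exists[OF \<Omega>(1) u0m(1)] .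
  obtain H0 where H0: "borel_rep \<Omega> g0 H0" using borel_rep_exists[OF \<Omega>(1) u0m(2)] .
  define V where "V n x = U n x - U0 x" for n x
  define Z where "Z n x = H n x - H0 x" for n x
  note LU = Lp_borel_rep[OF wW um(1) W1p_integrable(1)[OF \<Omega>(1) us] U[rule_format]]
  note LU0 = Lp_borel_rep[OF wW u0m(1) W1p_integrable(1)[OF \<Omega>(1) u] U0]
  note LH = Lp_borel_rep[OF wW um(2) W1p_integrable(2)[OF \<Omega>(1) us, folded g_def] H[rule_format]]
  note LH0 = Lp_borel_rep[OF wW u0m(2) W1p_integrable(2)[OF \<Omega>(1) u, folded g0_def] H0]
  have IH: "Ip (H n) \<le> B2" for n using LH(2)[of n] B2 by (simp add: g_def)
  have IU: "Ip (U n) \<le> B1" for n using LU(2)[of n] B1 by simp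
  have LV: "Lp (V n)" and LZ: "Lp (Z n)" for n
    unfolding V_def Z_def by (rule Lp_diff(1)[OF LU(1) LU0(1)], rule Lp_diff(1)[OF LH(1) LH0(1)])
  \<comment> \<open>One bound for both the functions and the gradients, the form that
    \<open>compactness\<close> takes; the factor \<open>3 powr p\<close> is that of
    \<open>Lp_diff\<close>.\<close>
  define B where "B = max (3 powr p * (B1 + Ip U0)) (3 powr p * (B2 + Ip H0))"
  have VB: "Ip (V n) \<le> B" for n
  proof -
    have "Ip (V n) \<le> 3 powr p * (Ip (U n) + Ip U0)" unfolding V_def by (rule Lp_diff(2)[OF LU(1) LU0(1)])
    also have "\<dots> \<le> 3 powr p * (B1 + Ip U0)" using IU[of n] by (intro mult_left_mono) auto
    finally show ?thesis by (simp add: B_def)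
  qed
  have ZB: "Ip (Z n) \<le> B" for n
  proof -
    have "Ip (Z n) \<le> 3 powr p * (Ip (H n) + Ip H0)" unfolding Z_def by (rule Lp_diff(2)[OF LH(1) LH0(1)])
    also have "\<dots> \<le> 3 powr p * (B2 + Ip H0)" using IH[of n] by (intro mult_left_mono) auto
    finally show ?thesis by (simp add: B_def)
  qed
  have wg: "wgrad \<Omega> (V n) (Z n)" for n
    unfolding V_def Z_def
  proof (rule wgrad_borel_rep[OF \<Omega>(1)])
    show "has_weak_gradient \<Omega> (\<lambda>x. u_seq n x + (-1) * u x) (\<lambda>x. g n x + (-1) *\<^sub>R g0 x)"
      by (rule has_weak_gradient_add[OF \<Omega>(1) hw(1) has_weak_gradient_cmult[OF \<Omega>(1) hw(2)]])
    show "borel_rep \<Omega> (\<lambda>x. u_seq n x + (-1) * u x) (\<lambda>x. U n x - U0 x)"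
      using borel_rep_diff[OF U[rule_format] U0] by simp
    show "borel_rep \<Omega> (\<lambda>x. g n x + (-1) *\<^sub>R g0 x) (\<lambda>x. H n x - H0 x)"
      by (rule borel_rep_diff[OF H[rule_format] H0])
  qed
  have weakV: "(\<lambda>n. LINT x|lborel. (k x \<bullet> V n x) * W x) \<longlonglongrightarrow> 0" if "Lq k" for k :: "'a \<Rightarrow> real"
    unfolding V_def by (rule Lq_dual_ok[OF so_id wW conv that U[rule_format] U0])
  have weakZ: "(\<lambda>n. LINT x|lborel. (k x \<bullet> Z n x) * W x) \<longlonglongrightarrow> 0" if "Lq k" for k :: "'a \<Rightarrow> 'a"
    unfolding Z_def by (rule Lq_dual_ok[OF so_gr wW conv that H[unfolded g_def, rule_format] H0[unfolded g0_def]])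

  \<comment> \<open>Almost everywhere convergence of the functions along a subsequence\<close>
  have Vloc: "(\<lambda>n. LINT x|lborel. bump x0 r x * \<bar>V n x\<bar>) \<longlonglongrightarrow> 0" if "0 < r" "cball x0 r \<subseteq> \<Omega>" for x0 r
    by (rule compactness[OF LV LZ wg VB ZB weak_bounded[OF weakV LV] that])
  have "\<exists>r. strict_mono r \<and> (AE x in lborel. (\<lambda>n. V (r n) x) \<longlonglongrightarrow> 0)"
    by (rule AE_subseq_locally_L1[OF \<Omega>(3) LV]) (rule Vloc)
  then obtain r1 where r1: "strict_mono r1" "AE x in lborel. (\<lambda>n. V (r1 n) x) \<longlonglongrightarrow> 0"
    by (elim exE conjE)

  \<comment> \<open>The fluxes and their monotonicity\<close>
  have car: "caratheodory \<Omega> A"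
    and growth: "AE x in ?M. \<forall>\<zeta>. norm (A x \<zeta>) \<le> norm \<zeta> powr (p - 1) * w x"
    and deg: "AE x in ?M. \<forall>\<zeta>. A x \<zeta> \<bullet> \<zeta> \<ge> norm \<zeta> powr p * w x"
    using assms(7) by (simp_all add: structure_conditions_def)
  obtain cm where cm: "0 < cm" "AE x in ?M. \<forall>\<zeta>1 \<zeta>2. \<zeta>1 \<noteq> \<zeta>2 \<longrightarrow>
        (A x \<zeta>1 - A x \<zeta>2) \<bullet> (\<zeta>1 - \<zeta>2) \<ge>
          cm * norm (\<zeta>1 - \<zeta>2) powr (max p 2) * A_bar A w x \<zeta>1 \<zeta>2 powr (1 - max p 2 / p) * w x"
    using assms(7) unfolding structure_conditions_def Let_def by (elim conjE exE)
  define a where "a n x = A x (g n x)" for n x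
  define a0 where "a0 x = A x (g0 x)" for x
  have am: "a n \<in> borel_measurable ?M" for n unfolding a_def by (rule caratheodory_measurable[OF \<Omega>(1) car um(2)])
  have a0m: "a0 \<in> borel_measurable ?M" unfolding a0_def by (rule caratheodory_measurable[OF \<Omega>(1) car u0m(2)])
  have "\<forall>n. \<exists>U. borel_rep \<Omega> (a n) U" using borel_rep_exists[OF \<Omega>(1) am] by metis
  from choice[OF this] obtain P where P: "\<forall>n. borel_rep \<Omega> (a n) (P n)" ..
  obtain P0 where P0: "borel_rep \<Omega> a0 P0" using borel_rep_exists[OF \<Omega>(1) a0m] .
  have ga: "AE x in ?M. norm (a n x) \<le> norm (g n x) powr (p - 1) * w x" for n
    using growth unfolding a_def by eventually_elim blast
  have ga0: "AE x in ?M. norm (a0 x) \<le> norm (g0 x) powr (p - 1) * w x"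
    using growth unfolding a0_def by eventually_elim blast
  note fP = flux_borel_rep[OF wW H[rule_format] LH(1) P[rule_format] ga]
  note fP0 = flux_borel_rep[OF wW H0 LH0(1) P0 ga0]
  have reps: "AE x in ?M. H n x = g n x \<and> P n x = a n x \<and> H0 x = g0 x \<and> P0 x = a0 x" for n
    using borel_repD(3)[OF H[rule_format, of n]] borel_repD(3)[OF P[rule_format, of n]]
      borel_repD(3)[OF H0] borel_repD(3)[OF P0] by eventually_elim simp
  have mono: "AE x in lborel. 0 \<le> (P n x - P0 x) \<bullet> Z n x" for n
  proof -
    have "AE x in ?M. 0 \<le> (P n x - P0 x) \<bullet> Z n x"
      using reps[of n] cm(2) wpos
    proof eventually_elim
      case (elim x)
      have e: "(P n x - P0 x) \<bullet> Z n x = (A x (g n x) - A x (g0 x)) \<bullet> (g n x - g0 x)"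
        using elim(1) by (simp add: Z_def a_def a0_def)
      show ?case
      proof (cases "g n x = g0 x")
        case True then show ?thesis unfolding e by simp
      next
        case False
        have "0 \<le> cm * norm (g n x - g0 x) powr (max p 2) * A_bar A w x (g n x) (g0 x) powr (1 - max p 2 / p) * w x"
          using cm(1) elim(3) by simp
        also have "\<dots> \<le> (A x (g n x) - A x (g0 x)) \<bullet> (g n x - g0 x)" using elim(2) False by blast
        finally show ?thesis unfolding e .
      qed
    qed
    then have "AE x in lborel. x \<in> \<Omega> \<longrightarrow> 0 \<le> (P n x - P0 x) \<bullet> Z n x" unfolding AE_lebesgue_on[OF \<Omega>(1)] .
    then show ?thesis
    proof eventually_elim
      case (elim x)
      then show ?case using LpD(2)[OF LZ, of x n] by (cases "x \<in> \<Omega>") auto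
    qed
  qed

  \<comment> \<open>Vanishing of the monotone quantity\<close>
  define e where "e n x = (P n x - P0 x) \<bullet> Z n x" for n x
  have [measurable]: "e n \<in> borel_measurable borel" for n
    using borel_repD(1)[OF P[rule_format, of n]] borel_repD(1)[OF P0] LpD(1)[OF LZ, of n] unfolding e_def by measurable
  have main: "(\<lambda>n. LINT x|lborel. bump x0 r x * min 1 (e (r1 n) x)) \<longlonglongrightarrow> 0"
    if r: "0 < r" "cball x0 (2 * r) \<subseteq> \<Omega>" for x0 r
  proof -
    have sub: "cball x0 r \<subseteq> \<Omega>" using r by (auto simp: subset_iff)
    obtain C where C: "\<forall>n. \<forall>\<phi>\<in>test_functions \<Omega>. supp \<phi> \<subseteq> cball x0 r \<longrightarrow> \<bar>G n \<phi>\<bar> \<le> C * Linf_norm \<Omega> \<phi>"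
      using assms(12)[OF compact_cball sub] ..
    \<comment> \<open>\<open>Linf_norm_bounds\<close> lets any pointwise bound m stand for the
      essential supremum, and \<open>max 0 C\<close> supplies the nonnegative constant of
      \<open>monotone_part_tendsto\<close>, as C itself may be negative.\<close>
    have eq: "\<bar>LINT x|lborel. P n x \<bullet> gradient \<psi> x\<bar> \<le> m * max 0 C"
      if \<psi>: "\<psi> \<in> test_functions \<Omega>" "supp \<psi> \<subseteq> cball x0 r" and m: "0 \<le> m" "\<And>x. \<bar>\<psi> x\<bar> \<le> m" for n \<psi> m
    proof -
      note [measurable] = borel_repD(1)[OF P[rule_format, of n]] gradient_measurable[OF test_functions_smooth[OF \<psi>(1)]]
      have gM [measurable]: "gradient \<psi> \<in> borel_measurable ?M"
        by (rule measurable_lebesgue_on_borel[OF gradient_measurable[OF test_functions_smooth[OF \<psi>(1)]]])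
      have "(LINT x|lborel. P n x \<bullet> gradient \<psi> x) = (LINT x|?M. a n x \<bullet> gradient \<psi> x)"
      proof (rule borel_transfer(2)[symmetric, OF \<Omega>(1)])
        show "(\<lambda>x. P n x \<bullet> gradient \<psi> x) \<in> borel_measurable borel" by measurable
        show "(\<lambda>x. a n x \<bullet> gradient \<psi> x) \<in> borel_measurable ?M"
          by (rule borel_measurable_inner[OF am gM])
        show "P n x \<bullet> gradient \<psi> x = 0" if "x \<notin> \<Omega>" for x using borel_repD(2)[OF P[rule_format] that] by simp
        show "AE x in ?M. P n x \<bullet> gradient \<psi> x = a n x \<bullet> gradient \<psi> x"
          using borel_repD(3)[OF P[rule_format, of n]] by eventually_elim simp
      qed
      also have "\<dots> = G n \<psi>"
        using sol[of n] \<psi>(1) unfolding solves_def a_def g_def by (simp add: lint_lebesgue_on[OF \<Omega>(1)])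
      finally have "\<bar>LINT x|lborel. P n x \<bullet> gradient \<psi> x\<bar> \<le> C * Linf_norm \<Omega> \<psi>" using C \<psi> by simp
      also have "\<dots> \<le> max 0 C * m"
        using Linf_norm_bounds[OF \<psi>(1) m] by (intro mult_mono) auto
      finally show ?thesis by (simp add: mult.commute)
    qed
    show ?thesis
      unfolding e_def
      by (rule monotone_part_tendsto[where V = "\<lambda>n. V (r1 n)" and Z = "\<lambda>n. Z (r1 n)" and a = "\<lambda>n. P (r1 n)" and ?a0.0 = P0,
            OF LV LZ wg ZB r1(2) _ fP(1) order_trans[OF fP(2) IH] fP0(1) mono r _ eq])
         (use LIMSEQ_subseq_LIMSEQ[OF weakZ r1(1)] in \<open>auto simp: o_def\<close>)
  qed
  \<comment> \<open>\<open>AE_subseq_of_bumps\<close> wants values between 0 and 1 at every point,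
    while e is nonnegative only almost everywhere; the outer maximum changes no integral.\<close>
  have main': "(\<lambda>n. LINT x|lborel. bump x0 r x * max 0 (min 1 (e (r1 n) x))) \<longlonglongrightarrow> 0"
    if r: "0 < r" "cball x0 (2 * r) \<subseteq> \<Omega>" for x0 r
  proof -
    have "(LINT x|lborel. bump x0 r x * max 0 (min 1 (e (r1 n) x))) = (LINT x|lborel. bump x0 r x * min 1 (e (r1 n) x))" for n
    proof (rule integral_cong_AE)
      show "AE x in lborel. bump x0 r x * max 0 (min 1 (e (r1 n) x)) = bump x0 r x * min 1 (e (r1 n) x)"
        using mono[of "r1 n"] unfolding e_def[symmetric] by eventually_elim simp
    qed measurable
    with main[OF r] show ?thesis by simp
  qed
  have "\<exists>r. strict_mono r \<and> (AE x in lborel. x \<in> \<Omega> \<longrightarrow> (\<lambda>n. max 0 (min 1 (e (r1 (r n)) x))) \<longlonglongrightarrow> 0)"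
    by (rule AE_subseq_of_bumps[OF \<Omega> _ _ _ main']) auto
  then obtain r2 where r2: "strict_mono r2" "AE x in lborel. x \<in> \<Omega> \<longrightarrow> (\<lambda>n. max 0 (min 1 (e (r1 (r2 n)) x))) \<longlonglongrightarrow> 0"
    by (elim exE conjE)
  have r2': "AE x in ?M. (\<lambda>n. max 0 (min 1 (e (r1 (r2 n)) x))) \<longlonglongrightarrow> 0" unfolding AE_lebesgue_on[OF \<Omega>(1)] by (rule r2(2))
  \<comment> \<open>The countably many exceptional sets are united, so that at a fixed x the
    representatives agree with the original functions along the whole sequence.\<close>
  have "AE x in ?M. \<forall>n. H n x = g n x \<and> P n x = a n x \<and> H0 x = g0 x \<and> P0 x = a0 x"
    unfolding AE_all_countable using reps by simp
  with r2' growth deg cm(2) wpos have "AE x in ?M. (\<lambda>k. g (r1 (r2 k)) x) \<longlonglongrightarrow> g0 x"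
  proof eventually_elim
    case (elim x)
    have ex: "e n x = (A x (g n x) - A x (g0 x)) \<bullet> (g n x - g0 x)" for n
      using elim(6) by (simp add: e_def Z_def a_def a0_def)
    show ?case
    proof (rule strong_monotonicity_convergence[OF p cm(1) elim(5), where F = "A x"])
      show "norm (A x \<zeta>) \<le> norm \<zeta> powr (p - 1) * w x" "norm \<zeta> powr p * w x \<le> A x \<zeta> \<bullet> \<zeta>" for \<zeta>
        using elim(2,3) by simp_all
      show "cm * norm (\<zeta>1 - \<zeta>2) powr (max p 2) * (1 / w x * (A x \<zeta>1 \<bullet> \<zeta>1 + A x \<zeta>2 \<bullet> \<zeta>2)) powr (1 - max p 2 / p) * w x
         \<le> (A x \<zeta>1 - A x \<zeta>2) \<bullet> (\<zeta>1 - \<zeta>2)" if "\<zeta>1 \<noteq> \<zeta>2" for \<zeta>1 \<zeta>2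
        using elim(4)[rule_format, OF that] unfolding A_bar_def .
      show "(\<lambda>n. max 0 (min 1 ((A x (g (r1 (r2 n)) x) - A x (g0 x)) \<bullet> (g (r1 (r2 n)) x - g0 x)))) \<longlonglongrightarrow> 0"
        using elim(1) unfolding ex .
    qed
  qed
  moreover have "strict_mono (\<lambda>k. r1 (r2 k))" using strict_mono_o[OF r1(1) r2(1)] by (simp add: o_def)
  ultimately show ?thesis unfolding g_def g0_def by (intro exI[of _ "\<lambda>k. r1 (r2 k)"] conjI)
qed

end
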